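(* Let $\varphi:\mathbb{P}^3\dashrightarrow\overline{\varphi(\mathbb{P}^3)}=\mathbf{Q}\subset\mathbb{P}^4$ be a quadratic birational transformation onto an irreducible quadric hypersurface $\mathbf{Q}$, and suppose that its base locus $\mathfrak{B}\subset\mathbb{P}^3$ is nonempty and reduced. Then either (i) $\varphi$ is of type $(2,1)$, or (ii) $\varphi$ is of type $(2,2)$, $\mathrm{rk}(\mathbf{Q})=4$, and $\mathfrak{B}$ is the union of a line $r$ with two points $p_1,p_2$ such that $\langle p_1,p_2\rangle\cap r=\emptyset$.
   Context: Everything is over $\mathbb{C}$. A birational transformation $\varphi:\mathbb{P}^n\dashrightarrow\overline{\varphi(\mathbb{P}^n)}=\mathbf{Q}\subset\mathbb{P}^{n+1}$ is quadratic if it is defined by a linear system of quadrics without fixed component; its base locus is the base scheme of this system. It is of type $(2,d)$ if it is quadratic and $\varphi^{-1}$ can be defined by a linear system contained in $|\mathcal{O}_{\mathbf{Q}}(d)|$, with $d$ minimal with this property. $\mathrm{rk}(\mathbf{Q})$ is the rank of the quadratic form defining $\mathbf{Q}$ (irreducible quadrics are taken reduced). *)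

theory Defs
  imports "HOL-Analysis.Analysis" "HOL-Library.Poly_Mapping"
begin

section \<open>Homogeneous polynomials\<close>

text \<open>
  The polynomial ring over the complex numbers whose variables are indexed by the finite
  type \<^typ>\<open>'v\<close>.  A polynomial maps an exponent vector to its coefficient;
  multiplication is the convolution product of \<^theory>\<open>HOL-Library.Poly_Mapping\<close>.
  With \<open>'v = 4\<close> this is the homogeneous coordinate ring of P^3, with \<open>'v = 5\<close> that of P^4.
\<close>

type_synonym 'v cpoly = "('v \<Rightarrow>\<^sub>0 nat) \<Rightarrow>\<^sub>0 complex"

definition pvar :: "'v \<Rightarrow> 'v cpoly" where
  "pvar i = Poly_Mapping.single (Poly_Mapping.single i 1) 1"

definition peval :: "'v::finite cpoly \<Rightarrow> complex^'v \<Rightarrow> complex" where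
  "peval f x = (\<Sum>m\<in>Poly_Mapping.keys f.
     Poly_Mapping.lookup f m * (\<Prod>i\<in>UNIV. x $ i ^ Poly_Mapping.lookup m i))"

text \<open>The zero polynomial is homogeneous of every degree.\<close>

definition homogeneous :: "nat \<Rightarrow> 'v::finite cpoly \<Rightarrow> bool" where
  "homogeneous d f \<longleftrightarrow>
     (\<forall>m\<in>Poly_Mapping.keys f. (\<Sum>i\<in>UNIV. Poly_Mapping.lookup m i) = d)"

definition ideal_of :: "('w::finite \<Rightarrow> 'v cpoly) \<Rightarrow> 'v cpoly set" where
  "ideal_of F = {f. \<exists>a. f = (\<Sum>j\<in>UNIV. a j * F j)}"


section \<open>Projective space and its Zariski topology\<close>

text \<open>
  A point of the projective space with homogeneous coordinates indexed by \<^typ>\<open>'v\<close> is a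
  one-dimensional complex subspace of \<^typ>\<open>complex^'v\<close>.  For a linear subspace \<open>W\<close>,
  \<open>proj_of W\<close> is the associated projective linear subspace, as a set of points.
\<close>

definition proj_of :: "(complex^'v) set \<Rightarrow> (complex^'v::finite) set set" where
  "proj_of W = {p. vec.subspace p \<and> vec.dim p = 1 \<and> p \<subseteq> W}"

abbreviation proj_space :: "(complex^'v::finite) set set" where
  "proj_space \<equiv> proj_of UNIV"

definition proj_line :: "(complex^'v::finite) set set \<Rightarrow> bool" where
  "proj_line r \<longleftrightarrow> (\<exists>W. vec.subspace W \<and> vec.dim W = 2 \<and> r = proj_of W)"

definition proj_join :: "(complex^'v) set \<Rightarrow> (complex^'v) set \<Rightarrow> (complex^'v::finite) set set" where
  "proj_join p p' = proj_of (vec.span (p \<union> p'))"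

definition vanishes_at :: "'v::finite cpoly \<Rightarrow> (complex^'v) set \<Rightarrow> bool" where
  "vanishes_at f p \<longleftrightarrow> (\<forall>x\<in>p. peval f x = 0)"

definition zero_locus :: "'v::finite cpoly set \<Rightarrow> (complex^'v) set set" where
  "zero_locus S = {p \<in> proj_space. \<forall>f\<in>S. vanishes_at f p}"

definition zariski_closed :: "(complex^'v::finite) set set \<Rightarrow> bool" where
  "zariski_closed Z \<longleftrightarrow> (\<exists>S. (\<forall>f\<in>S. \<exists>d. homogeneous d f) \<and> Z = zero_locus S)"

definition zariski_closure :: "(complex^'v::finite) set set \<Rightarrow> (complex^'v) set set" where
  "zariski_closure A = \<Inter>{Z. zariski_closed Z \<and> A \<subseteq> Z}"

definition nonempty_open_in :: "(complex^'v::finite) set set \<Rightarrow> (complex^'v) set set \<Rightarrow> bool" where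
  "nonempty_open_in X U \<longleftrightarrow> U \<noteq> {} \<and> (\<exists>Z. zariski_closed Z \<and> U = X - Z)"


section \<open>Rational maps given by forms of equal degree\<close>

definition forms :: "nat \<Rightarrow> ('w \<Rightarrow> 'v::finite cpoly) \<Rightarrow> bool" where
  "forms d F \<longleftrightarrow> (\<forall>j. homogeneous d (F j))"

definition defined_at :: "('w \<Rightarrow> 'v::finite cpoly) \<Rightarrow> (complex^'v) set \<Rightarrow> bool" where
  "defined_at F p \<longleftrightarrow> (\<exists>j. \<not> vanishes_at (F j) p)"

text \<open>
  For forms of equal degree and \<open>p\<close> spanned by \<open>x\<close>, this is the line spanned by
  \<open>(F j (x))\<^sub>j\<close>; it is a point of the target exactly when \<open>F\<close> is defined at \<open>p\<close>.
\<close>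

definition rmap :: "('w::finite \<Rightarrow> 'v::finite cpoly) \<Rightarrow> (complex^'v) set \<Rightarrow> (complex^'w) set" where
  "rmap F p = vec.span ((\<lambda>x. \<chi> j. peval (F j) x) ` p)"

definition image_closure :: "('w::finite \<Rightarrow> 'v::finite cpoly) \<Rightarrow> (complex^'w) set set" where
  "image_closure F = zariski_closure (rmap F ` {p \<in> proj_space. defined_at F p})"

definition no_fixed_component :: "('w \<Rightarrow> 'v::finite cpoly) \<Rightarrow> bool" where
  "no_fixed_component F \<longleftrightarrow> (\<forall>g. (\<forall>j. g dvd F j) \<longrightarrow> g dvd 1)"

definition quadratic_map :: "('w \<Rightarrow> 'v::finite cpoly) \<Rightarrow> bool" where
  "quadratic_map F \<longleftrightarrow> forms 2 F \<and> no_fixed_component F"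

text \<open>
  \<open>G\<close>, restricted to \<open>Y\<close>, is inverse to \<open>F\<close>: both composites are the identity as rational
  maps, that is, on nonempty open subsets where they are defined.  For this to be the
  usual notion \<open>Y\<close> has to be irreducible, which is automatic when \<open>Y = image_closure F\<close>.
\<close>

definition rational_inverse ::
    "('w::finite \<Rightarrow> 'v::finite cpoly) \<Rightarrow> (complex^'w) set set \<Rightarrow> ('v \<Rightarrow> 'w cpoly) \<Rightarrow> bool" where
  "rational_inverse F Y G \<longleftrightarrow>
     (\<exists>U. nonempty_open_in proj_space U \<and>
        (\<forall>p\<in>U. defined_at F p \<and> defined_at G (rmap F p) \<and> rmap G (rmap F p) = p)) \<and>
     (\<exists>V. nonempty_open_in Y V \<and>
        (\<forall>y\<in>V. defined_at G y \<and> defined_at F (rmap G y) \<and> rmap F (rmap G y) = y))"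

text \<open>
  The inverse is defined by a linear system contained in |O_Y(d)|.  Forms of degree \<open>d\<close> on
  the ambient space suffice here: for a hypersurface \<open>Y\<close> of dimension at least 1, every
  section of O_Y(d) is the restriction of such a form.
\<close>

definition inverse_in_degree ::
    "('w::finite \<Rightarrow> 'v::finite cpoly) \<Rightarrow> (complex^'w) set set \<Rightarrow> nat \<Rightarrow> bool" where
  "inverse_in_degree F Y d \<longleftrightarrow> (\<exists>G. forms d G \<and> rational_inverse F Y G)"

text \<open>
  No degree is prescribed for the inverse: every rational map from a projective variety
  to a projective space is given by forms of some common degree.
\<close>

definition birational_onto ::
    "('w::finite \<Rightarrow> 'v::finite cpoly) \<Rightarrow> (complex^'w) set set \<Rightarrow> bool" where
  "birational_onto F Y \<longleftrightarrow> image_closure F = Y \<and> (\<exists>d. inverse_in_degree F Y d)"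

text \<open>Type \<open>(2,d)\<close>.\<close>

definition of_type_2 ::
    "('w::finite \<Rightarrow> 'v::finite cpoly) \<Rightarrow> (complex^'w) set set \<Rightarrow> nat \<Rightarrow> bool" where
  "of_type_2 F Y d \<longleftrightarrow> quadratic_map F \<and> birational_onto F Y \<and>
     inverse_in_degree F Y d \<and> (\<forall>e<d. \<not> inverse_in_degree F Y e)"


section \<open>The base scheme\<close>

definition base_points :: "('w \<Rightarrow> 'v::finite cpoly) \<Rightarrow> (complex^'v) set set" where
  "base_points F = zero_locus (range F)"

text \<open>
  The base scheme is B = Proj(S/I) with \<open>I = ideal_of F\<close>.  Sections of O_B over the
  standard affine chart D_+(x_i) are the fractions \<open>f / x_i^m\<close> with \<open>f\<close> homogeneous of
  degree \<open>m\<close>, and such a fraction is zero iff \<open>x_i^N * f\<close> lies in \<open>I\<close> for some \<open>N\<close>.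
  B is reduced iff none of these coordinate rings has a nonzero nilpotent element.
\<close>

definition zero_on_chart :: "('w::finite \<Rightarrow> 'v::finite cpoly) \<Rightarrow> 'v \<Rightarrow> 'v cpoly \<Rightarrow> bool" where
  "zero_on_chart F i f \<longleftrightarrow> (\<exists>N. pvar i ^ N * f \<in> ideal_of F)"

definition reduced_base_scheme :: "('w::finite \<Rightarrow> 'v::finite cpoly) \<Rightarrow> bool" where
  "reduced_base_scheme F \<longleftrightarrow>
     (\<forall>i m f k. homogeneous m f \<and> zero_on_chart F i (f ^ k) \<longrightarrow> zero_on_chart F i f)"


section \<open>Quadratic forms\<close>

text \<open>The symmetric matrix \<open>A\<close> with \<open>q(x) = x\<^sup>T A x\<close>.\<close>

definition quad_matrix :: "'v::finite cpoly \<Rightarrow> complex^'v^'v" where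
  "quad_matrix q = (\<chi> i j.
     (let c = Poly_Mapping.lookup q (Poly_Mapping.single i 1 + Poly_Mapping.single j 1)
      in if i = j then c else c / 2))"

definition quad_rank :: "'v::finite cpoly \<Rightarrow> nat" where
  "quad_rank q = rank (quad_matrix q)"

end

(*
Write b for the bilinear form of q and P(x, z) for the polar form of F, so that q(F) = 0. At a general
point x0 the point y0 = F(x0) lies off the vertex of the quadric, hence q = y1 y5 + q'(y2, y3, y4) with y0 the
first basis vector and q' a sum of squares. Injectivity of F on an open set forces v |-> P(x0, v) to be
injective, and its components serve as coordinates on the source. Comparing coefficients of powers of the
first coordinate in q(F) = 0 then determines F, up to linear changes, according to the rank of q'.

Rank of q' = 3: the components span l * (linear forms) + (one quadric), so the inverse is linear.

Rank 2: F = (ac, ad, bc, bd, g) with linear forms a, b, c, d. If these are independent, then g must vanish on one of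
the skew lines a = b = 0, c = d = 0, for otherwise F has degree two on the lines joining them; the two zeros of g on the
other line are distinct because the base scheme is reduced, and we are in case (ii). If they are dependent,
reducedness at the common zero turns F into the linear-inverse form.

Rank 1: F = (a^2, ab, b^2, g, h), which contradicts reducedness and injectivity along the line a = b = 0.
*)
theory Submission
  imports Defs "HOL-Computational_Algebra.Polynomial"
begin


section \<open>Evaluation of polynomials\<close>

text \<open>The scheme and the rational maps enter only through the locale
  \<open>admissible\<close>, a list of facts about one function from C^4 to C^5. All the work in
  between is linear algebra with polarizations, where coordinates change freely by
  \<open>admissible_transform\<close> and nothing has to be substituted into a \<open>cpoly\<close>.

  As a condition on an ideal, reducedness is awkward to carry through coordinate changes. It is
  therefore used in a weak form: if the square of a linear form a is a combination of the components
  of F, then, near a base point, a power of a coordinate times a lies in the ideal. If F vanishes to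
  order k+1 along a curve through the base point, a cannot vanish only to order k. Jets of order one
  and two detect every double structure that has to be excluded.

  An inverse is certified by one identity G(F(x)) = h(x) x; the other composite follows because the
  image is dense in the quadric. Whether degree two is minimal is settled by a case split: an
  inverse of degree one lands in alternative (i).\<close>

lemma peval_superset:
  assumes "finite K" "Poly_Mapping.keys f \<subseteq> K"
  shows "peval f x = (\<Sum>m\<in>K. Poly_Mapping.lookup f m * (\<Prod>i\<in>UNIV. x $ i ^ Poly_Mapping.lookup m i))"
  unfolding peval_def using assms
  by (intro sum.mono_neutral_left) (auto simp: in_keys_iff)

lemma peval_0 [simp]: "peval 0 x = 0"
  by (simp add: peval_def)

lemma peval_single [simp]:
  "peval (Poly_Mapping.single m c) x = c * (\<Prod>i\<in>UNIV. x $ i ^ Poly_Mapping.lookup m i)"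
  by (cases "c = 0") (auto simp: peval_def)

lemma peval_1 [simp]: "peval 1 x = 1"
  by (simp flip: single_one)

lemma peval_add [simp]: "peval (f + g) x = peval f x + peval g x"
proof -
  let ?K = "Poly_Mapping.keys f \<union> Poly_Mapping.keys g"
  have "Poly_Mapping.keys (f + g) \<subseteq> ?K" by (rule keys_add)
  then show ?thesis
    by (subst (1 2 3) peval_superset[of ?K]) (auto simp: lookup_add ring_distribs sum.distrib)
qed

lemma peval_sum [simp]: "peval (\<Sum>a\<in>A. f a) x = (\<Sum>a\<in>A. peval (f a) x)"
  by (induction A rule: infinite_finite_induct) auto

lemma sum_of_monomials:
  "(\<Sum>m\<in>Poly_Mapping.keys f. Poly_Mapping.single m (Poly_Mapping.lookup f m)) = f"
  by (rule poly_mapping_eqI)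
     (auto simp: lookup_sum lookup_single when_def in_keys_iff sum.delta' cong: if_cong)

lemma peval_times [simp]: "peval (f * g) x = peval f x * peval g x"
proof -
  let ?s = "\<lambda>f m. Poly_Mapping.single m (Poly_Mapping.lookup f m)"
  have "peval ((\<Sum>m\<in>Poly_Mapping.keys f. ?s f m) * (\<Sum>n\<in>Poly_Mapping.keys g. ?s g n)) x =
    peval (\<Sum>m\<in>Poly_Mapping.keys f. ?s f m) x * peval (\<Sum>n\<in>Poly_Mapping.keys g. ?s g n) x"
    by (simp add: sum_product mult_single lookup_add power_add prod.distrib mult_ac)
  then show ?thesis by (simp only: sum_of_monomials)
qed

lemma peval_power [simp]: "peval (f ^ n) x = peval f x ^ n"
  by (induction n) auto

lemma peval_prod [simp]: "peval (\<Prod>a\<in>A. f a) x = (\<Prod>a\<in>A. peval (f a) x)"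
  by (induction A rule: infinite_finite_induct) auto

lemma peval_pvar [simp]: "peval (pvar i) x = x $ i"
proof -
  have "(\<Prod>j\<in>UNIV. x $ j ^ Poly_Mapping.lookup (Poly_Mapping.single i 1) j) =
      (\<Prod>j\<in>UNIV. if j = i then x $ i else 1)"
    by (intro prod.cong) (auto simp: lookup_single when_def)
  then show ?thesis by (simp add: pvar_def)
qed

definition pconst :: "complex \<Rightarrow> 'v cpoly" where
  "pconst c = Poly_Mapping.single 0 c"

lemma peval_pconst [simp]: "peval (pconst c) x = c"
  by (simp add: pconst_def)

section \<open>Forms under ring operations, scaling and substitution\<close>

lemma homogeneous_0 [simp]: "homogeneous d 0"
  by (simp add: homogeneous_def)

lemma homogeneous_pconst [simp]: "homogeneous 0 (pconst c)"
  by (simp add: homogeneous_def pconst_def)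

lemma homogeneous_1 [simp]: "homogeneous 0 1"
  by (simp add: homogeneous_def)

lemma homogeneous_pvar [simp]: "homogeneous 1 (pvar i)"
  by (simp add: homogeneous_def pvar_def lookup_single when_def)

lemma homogeneous_add: "homogeneous d f \<Longrightarrow> homogeneous d g \<Longrightarrow> homogeneous d (f + g)"
  using keys_add[of f g] by (fastforce simp: homogeneous_def)

lemma homogeneous_sum: "(\<And>a. a \<in> A \<Longrightarrow> homogeneous d (f a)) \<Longrightarrow> homogeneous d (\<Sum>a\<in>A. f a)"
  by (induction A rule: infinite_finite_induct) (auto intro: homogeneous_add)

lemma homogeneous_mult: "homogeneous d f \<Longrightarrow> homogeneous e g \<Longrightarrow> homogeneous (d + e) (f * g)"
  using keys_mult[of f g] by (fastforce simp: homogeneous_def lookup_add sum.distrib)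

lemma homogeneous_power: "homogeneous d f \<Longrightarrow> homogeneous (n * d) (f ^ n)"
  by (induction n) (auto dest: homogeneous_mult)

lemma homogeneous_prod:
  "finite A \<Longrightarrow> (\<And>a. a \<in> A \<Longrightarrow> homogeneous (d a) (f a)) \<Longrightarrow> homogeneous (\<Sum>a\<in>A. d a) (\<Prod>a\<in>A. f a)"
  by (induction A rule: finite_induct) (auto intro: homogeneous_mult)

lemma homogeneous_scale: "homogeneous d f \<Longrightarrow> homogeneous d (pconst c * f)"
  using homogeneous_mult[of 0 "pconst c" d f] by simp

lemma homogeneous_uminus: "homogeneous d f \<Longrightarrow> homogeneous d (- f)"
  by (auto simp: homogeneous_def in_keys_iff)

lemma peval_uminus [simp]: "peval (- f) x = - peval f x"
proof -
  have "peval (f + - f) x = 0" by simp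
  then show ?thesis unfolding peval_add by (simp add: add_eq_0_iff)
qed

lemma peval_diff [simp]: "peval (f - g) x = peval f x - peval g x"
  using peval_add[of f "- g" x] by simp

lemma homogeneous_diff: "homogeneous d f \<Longrightarrow> homogeneous d g \<Longrightarrow> homogeneous d (f - g)"
  using homogeneous_add[of d f "- g"] homogeneous_uminus by auto

lemma peval_scale:
  assumes "homogeneous d f"
  shows "peval f (c *s x) = c ^ d * peval f x"
  unfolding peval_def sum_distrib_left using assms
  by (intro sum.cong)
     (auto simp: homogeneous_def power_mult_distrib prod.distrib power_sum[symmetric] mult_ac)

text \<open>The open sets on which composites of rational maps are compared must be cut out by
  forms, so the composites have to be represented by forms again.\<close>

lemma peval_compose:
  fixes F :: "'w::finite \<Rightarrow> 'v::finite cpoly"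
  assumes "homogeneous d g" "forms e F"
  obtains h where "homogeneous (d * e) h" "\<And>x. peval h x = peval g (\<chi> j. peval (F j) x)"
proof
  define h where "h = (\<Sum>m\<in>Poly_Mapping.keys g.
     pconst (Poly_Mapping.lookup g m) * (\<Prod>i\<in>UNIV. F i ^ Poly_Mapping.lookup m i))"
  show "peval h x = peval g (\<chi> j. peval (F j) x)" for x
    by (simp add: h_def) (simp add: peval_def)
  have "homogeneous (\<Sum>i\<in>UNIV. Poly_Mapping.lookup m i * e) (\<Prod>i\<in>UNIV. F i ^ Poly_Mapping.lookup m i)" for m
    using assms(2) by (intro homogeneous_prod homogeneous_power) (auto simp: forms_def)
  then show "homogeneous (d * e) h"
    unfolding h_def using assms(1)
    by (intro homogeneous_sum homogeneous_scale) (simp add: homogeneous_def flip: sum_distrib_right)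
qed

lemma continuous_peval:
  assumes "\<And>i. continuous_on UNIV (\<lambda>t. \<gamma> t $ i)"
  shows "continuous_on UNIV (\<lambda>t. peval f (\<gamma> t))"
  unfolding peval_def by (intro continuous_intros assms)


section \<open>Functions that are polynomial on lines\<close>

text \<open>A substitute for polynomial functions that is stable under linear changes of variables
  and involves no coefficients. Root counting on lines is what the genericity arguments use.\<close>

definition line_poly :: "(complex^'v \<Rightarrow> complex) \<Rightarrow> bool" where
  "line_poly f \<longleftrightarrow> (\<forall>x v. \<exists>p. \<forall>t. f (x + t *s v) = poly p t)"

lemma line_poly_const [simp]: "line_poly (\<lambda>x. c)"
  unfolding line_poly_def by (auto intro: exI[of _ "[:c:]"])

lemma line_poly_add: "line_poly f \<Longrightarrow> line_poly g \<Longrightarrow> line_poly (\<lambda>x. f x + g x)"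
  unfolding line_poly_def by (metis poly_add)

lemma line_poly_mult: "line_poly f \<Longrightarrow> line_poly g \<Longrightarrow> line_poly (\<lambda>x. f x * g x)"
  unfolding line_poly_def by (metis poly_mult)

lemma line_poly_sum: "(\<And>a. a \<in> A \<Longrightarrow> line_poly (f a)) \<Longrightarrow> line_poly (\<lambda>x. \<Sum>a\<in>A. f a x)"
  by (induction A rule: infinite_finite_induct) (auto intro: line_poly_add)

lemma line_poly_prod: "(\<And>a. a \<in> A \<Longrightarrow> line_poly (f a)) \<Longrightarrow> line_poly (\<lambda>x. \<Prod>a\<in>A. f a x)"
  by (induction A rule: infinite_finite_induct) (auto intro: line_poly_mult)

lemma line_poly_power: "line_poly f \<Longrightarrow> line_poly (\<lambda>x. f x ^ n)"
  by (induction n) (auto intro: line_poly_mult)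

lemma line_poly_nth: "line_poly (\<lambda>x. x $ i)"
  unfolding line_poly_def
proof (intro allI)
  fix x v :: "complex^'a"
  show "\<exists>p. \<forall>t. (x + t *s v) $ i = poly p t" by (rule exI[of _ "[:x $ i, v $ i:]"]) auto
qed

lemma line_poly_peval: "line_poly (peval f)"
  unfolding peval_def
  by (intro line_poly_sum line_poly_mult line_poly_prod line_poly_power line_poly_nth line_poly_const)

lemma line_poly_cofinite:
  assumes "line_poly f" "f (x + s *s v) \<noteq> 0"
  shows "finite {t. f (x + t *s v) = 0}"
proof -
  obtain p where p: "\<And>t. f (x + t *s v) = poly p t"
    using assms(1) unfolding line_poly_def by blast
  have "p \<noteq> 0" using assms(2) p by auto
  then show ?thesis using poly_roots_finite[of p] by (simp add: p)
qed

text \<open>On the line through \<open>x\<close> and \<open>z\<close> each function has finitely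
  many zeros, and the field is infinite. This plays the role of irreducibility of affine space: two
  nonempty open conditions can be met at once.\<close>

lemma line_poly_common_nonzero:
  assumes "line_poly f" "line_poly g" "f x \<noteq> 0" "g z \<noteq> 0"
  obtains y where "f y \<noteq> 0" "g y \<noteq> 0"
proof -
  have "finite {t. f (x + t *s (z - x)) = 0}" "finite {t. g (x + t *s (z - x)) = 0}"
    using line_poly_cofinite[OF assms(1), of x 0 "z - x"] line_poly_cofinite[OF assms(2), of x 1 "z - x"]
      assms(3,4) by simp_all
  then have "finite ({t. f (x + t *s (z - x)) = 0} \<union> {t. g (x + t *s (z - x)) = 0})" by simp
  from ex_new_if_finite[OF _ this] obtain t
    where "t \<notin> {t. f (x + t *s (z - x)) = 0} \<union> {t. g (x + t *s (z - x)) = 0}"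
    using infinite_UNIV_char_0 by blast
  then show ?thesis using that by blast
qed

lemma line_poly_diff: "line_poly f \<Longrightarrow> line_poly g \<Longrightarrow> line_poly (\<lambda>x. f x - g x)"
  unfolding line_poly_def by (metis poly_diff)

lemma line_poly_uminus: "line_poly f \<Longrightarrow> line_poly (\<lambda>x. - f x)"
  unfolding line_poly_def by (metis poly_minus)

lemmas line_poly_intros = line_poly_add line_poly_diff line_poly_uminus line_poly_mult line_poly_power
  line_poly_nth line_poly_const

text \<open>A nonzero value of \<open>h\<close> would give a point where \<open>h\<close> and
  \<open>k\<close> are both nonzero. Serves to cancel a factor that is only generically
  nonzero.\<close>

lemma line_poly_eq_0:
  assumes "line_poly h" "line_poly k" "k z \<noteq> 0" "\<And>x. k x * h x = 0"
  shows "h x = 0"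
  using line_poly_common_nonzero[OF assms(1,2) _ assms(3)] assms(4) by (metis mult_eq_0_iff)


section \<open>Quadratic maps and linear changes of coordinates\<close>

abbreviation lin_map :: "(complex^'n::finite \<Rightarrow> complex^'m::finite) \<Rightarrow> bool" where
  "lin_map \<equiv> Vector_Spaces.linear (*s) (*s)"

abbreviation lin_form :: "(complex^'n::finite \<Rightarrow> complex) \<Rightarrow> bool" where
  "lin_form \<equiv> Vector_Spaces.linear (*s) (*)"

lemma lin_map_iff:
  "lin_map f \<longleftrightarrow> (\<forall>x y. f (x + y) = f x + f y) \<and> (\<forall>c x. f (c *s x) = c *s f x)"
  by (simp add: Vector_Spaces.linear_iff vec.vector_space_axioms)

lemma lin_form_iff:
  "lin_form f \<longleftrightarrow> (\<forall>x y. f (x + y) = f x + f y) \<and> (\<forall>c x. f (c *s x) = c * f x)"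
  by (simp add: Vector_Spaces.linear_iff vec.vector_space_axioms vector_space_over_itself.vector_space_axioms)

lemma lin_mapD:
  assumes "lin_map f"
  shows "f (x + y) = f x + f y" "f (c *s x) = c *s f x" "f (x - y) = f x - f y" "f 0 = 0"
proof -
  show *: "f (x + y) = f x + f y" "f (c *s x) = c *s f x" for x y c
    using assms by (auto simp: lin_map_iff)
  show "f 0 = 0" using *(2)[of 0 0] by simp
  show "f (x - y) = f x - f y"
    using *(1)[of x "(- 1) *s y"] *(2)[of "-1" y] by (simp add: vec_eq_iff)
qed

lemma lin_formD:
  assumes "lin_form f"
  shows "f (x + y) = f x + f y" "f (c *s x) = c * f x" "f (x - y) = f x - f y" "f 0 = 0"
proof -
  show *: "f (x + y) = f x + f y" "f (c *s x) = c * f x" for x y c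
    using assms by (auto simp: lin_form_iff)
  show "f 0 = 0" using *(2)[of 0 0] by simp
  have "x - y = x + (- 1) *s y" by (simp add: vec_eq_iff)
  then show "f (x - y) = f x - f y"
    using *(1)[of x "(- 1) *s y"] *(2)[of "-1" y] by simp
qed

lemma vec_basis_expand: "x = (\<Sum>i\<in>UNIV. (x $ i) *s axis i 1)" for x :: "complex^'n"
  using basis_expansion[of x] by simp

lemma lin_form_expand:
  assumes "lin_form f"
  shows "f x = (\<Sum>i\<in>UNIV. f (axis i 1) * x $ i)"
proof -
  interpret f: Vector_Spaces.linear "(*s)" "(*)" f by (rule assms)
  have "f x = f (\<Sum>i\<in>UNIV. (x $ i) *s axis i 1)" by (subst vec_basis_expand) simp
  also have "\<dots> = (\<Sum>i\<in>UNIV. x $ i * f (axis i 1))" by (simp add: f.sum lin_formD[OF assms])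
  finally show ?thesis by (simp add: mult.commute)
qed

lemma lin_form_nth: "lin_form (\<lambda>x. x $ i)"
  by (simp add: lin_form_iff)

lemma lin_form_add: "lin_form f \<Longrightarrow> lin_form g \<Longrightarrow> lin_form (\<lambda>x. f x + g x)"
  by (simp add: lin_form_iff algebra_simps)

lemma lin_form_diff: "lin_form f \<Longrightarrow> lin_form g \<Longrightarrow> lin_form (\<lambda>x. f x - g x)"
  by (simp add: lin_form_iff algebra_simps)

lemma lin_form_cmult: "lin_form f \<Longrightarrow> lin_form (\<lambda>x. c * f x)"
  by (simp add: lin_form_iff algebra_simps)

lemma lin_form_comp: "lin_form f \<Longrightarrow> lin_map g \<Longrightarrow> lin_form (\<lambda>x. f (g x))"
  by (simp add: lin_form_iff lin_map_iff)

lemma lin_map_comp: "lin_map f \<Longrightarrow> lin_map g \<Longrightarrow> lin_map (\<lambda>x. f (g x))"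
  by (simp add: lin_map_iff)

lemma lin_map_iff_nth: "lin_map f \<longleftrightarrow> (\<forall>i. lin_form (\<lambda>x. f x $ i))"
  by (auto simp: lin_map_iff lin_form_iff vec_eq_iff)

definition lin_iso :: "(complex^'n::finite \<Rightarrow> complex^'n) \<Rightarrow> bool" where
  "lin_iso f \<longleftrightarrow> lin_map f \<and> bij f"

lemma lin_iso_injI: "lin_map f \<Longrightarrow> (\<And>x. f x = 0 \<Longrightarrow> x = 0) \<Longrightarrow> lin_iso f"
  unfolding lin_iso_def bij_def
  using vec.linear_injective_imp_surjective vec.linear_inj_iff_eq_0 by blast

lemma lin_iso_inv: "lin_iso f \<Longrightarrow> lin_iso (inv f)"
  unfolding lin_iso_def
  by (metis bij_def bij_imp_bij_inv vec.inj_linear_imp_inv_linear)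

lemma lin_iso_comp: "lin_iso f \<Longrightarrow> lin_iso g \<Longrightarrow> lin_iso (\<lambda>x. f (g x))"
  unfolding lin_iso_def using bij_comp[of g f] by (auto intro: lin_map_comp simp: comp_def)

lemma lin_iso_id: "lin_iso (\<lambda>x. x)"
  unfolding lin_iso_def by (auto simp: lin_map_iff bij_id[unfolded id_def])

lemma lin_isoD:
  assumes "lin_iso f"
  shows "lin_map f" "f (inv f y) = y" "inv f (f x) = x" "f x = 0 \<longleftrightarrow> x = 0"
proof -
  show 1: "lin_map f" and "f (inv f y) = y" and i: "inv f (f x) = x" for x y
    using assms by (auto simp: lin_iso_def bij_def surj_f_inv_f)
  show "f x = 0 \<longleftrightarrow> x = 0"
    using i[of x] i[of 0] lin_mapD(4)[OF 1] by auto
qed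

section \<open>Quadratic maps and their polarizations\<close>

definition polar :: "(complex^'n::finite \<Rightarrow> complex^'m::finite) \<Rightarrow> complex^'n \<Rightarrow> complex^'n \<Rightarrow> complex^'m" where
  "polar F x z = (1/2) *s (F (x + z) - F x - F z)"

definition quad_map :: "(complex^'n::finite \<Rightarrow> complex^'m::finite) \<Rightarrow> bool" where
  "quad_map F \<longleftrightarrow> (\<forall>z. lin_map (\<lambda>x. polar F x z)) \<and> (\<forall>c x. F (c *s x) = c\<^sup>2 *s F x)"

lemma polar_commute: "polar F x z = polar F z x"
  by (simp add: polar_def add.commute diff_diff_eq)

context
  fixes F :: "complex^'n::finite \<Rightarrow> complex^'m::finite"
  assumes F: "quad_map F"
begin

lemma quad_map_scale: "F (c *s x) = c\<^sup>2 *s F x"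
  using F by (simp add: quad_map_def)

lemma quad_map_0: "F 0 = 0"
  using quad_map_scale[of 0 0] by simp

lemma polar_linear1: "lin_map (\<lambda>x. polar F x z)"
  using F by (simp add: quad_map_def)

lemma polar_linear2: "lin_map (\<lambda>z. polar F x z)"
  using polar_linear1[of x] by (simp add: polar_commute)

lemmas polar_simps = lin_mapD[OF polar_linear1] lin_mapD[OF polar_linear2]

lemma polar_self: "polar F x x = F x"
proof -
  have "x + x = 2 *s x" by (simp add: vec_eq_iff)
  then have "F (x + x) = 4 *s F x" using quad_map_scale[of 2 x] by simp
  then show ?thesis unfolding polar_def by (simp add: vec_eq_iff)
qed

lemma quad_map_add: "F (x + z) = F x + 2 *s polar F x z + F z"
  by (simp add: polar_def vec_eq_iff)

lemma quad_map_line: "F (x + t *s v) = F x + (2 * t) *s polar F x v + t\<^sup>2 *s F v"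
  by (simp add: quad_map_add polar_simps quad_map_scale vec_eq_iff)

text \<open>Sorted by order in t: the coefficients of 1, t and t^2 are the conditions on a
  second-order jet in \<open>red2\<close>, and the rest is visibly divisible by t^3.\<close>

lemma quad_map_curve:
  "F (p + t *s v + t\<^sup>2 *s w) = F p + (2 * t) *s polar F p v + t\<^sup>2 *s (F v + 2 *s polar F p w)
     + t ^ 3 *s (2 *s polar F v w + t *s F w)"
  by (simp add: quad_map_add polar_simps quad_map_scale vec_eq_iff power2_eq_square power3_eq_cube algebra_simps)

lemma quad_map_compose:
  assumes "lin_map S" "lin_map T"
  shows "quad_map (\<lambda>x. T (F (S x)))" "polar (\<lambda>x. T (F (S x))) x z = T (polar F (S x) (S z))"
proof -
  show *: "polar (\<lambda>x. T (F (S x))) x z = T (polar F (S x) (S z))" for x z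
    unfolding polar_def by (simp add: lin_mapD[OF assms(1)] lin_mapD[OF assms(2)])
  show "quad_map (\<lambda>x. T (F (S x)))"
    unfolding quad_map_def *
    by (auto simp: lin_map_iff lin_mapD[OF assms(1)] lin_mapD[OF assms(2)] quad_map_scale polar_simps)
qed

lemma quad_map_expand:
  "F x = (\<Sum>i\<in>UNIV. \<Sum>j\<in>UNIV. (x $ i * x $ j) *s polar F (axis i 1) (axis j 1))"
proof -
  have *: "polar F x z = (\<Sum>i\<in>UNIV. (x $ i) *s polar F (axis i 1) z)" for x z
  proof -
    interpret L: Vector_Spaces.linear "(*s)" "(*s)" "\<lambda>x. polar F x z" by (rule polar_linear1)
    have "polar F x z = polar F (\<Sum>i\<in>UNIV. (x $ i) *s axis i 1) z"
      by (subst vec_basis_expand) simp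
    also have "\<dots> = (\<Sum>i\<in>UNIV. (x $ i) *s polar F (axis i 1) z)"
      by (simp only: L.sum L.scale)
    finally show ?thesis .
  qed
  have "F x = (\<Sum>i\<in>UNIV. (x $ i) *s polar F (axis i 1) x)"
    using *[of x x] by (simp add: polar_self)
  also have "\<dots> = (\<Sum>i\<in>UNIV. (x $ i) *s (\<Sum>j\<in>UNIV. (x $ j) *s polar F (axis i 1) (axis j 1)))"
    using *[of x "axis _ 1"] by (simp add: polar_commute)
  finally show ?thesis
    by (simp add: vec_eq_iff sum_distrib_left mult.assoc)
qed

lemma line_poly_quad_map_nth: "line_poly (\<lambda>x. F x $ i)"
  unfolding line_poly_def
proof (intro allI)
  fix x v
  show "\<exists>p. \<forall>t. F (x + t *s v) $ i = poly p t"
    by (rule exI[of _ "[:F x $ i, 2 * polar F x v $ i, F v $ i:]"])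
       (simp add: quad_map_line power2_eq_square algebra_simps)
qed

end

text \<open>
  Clause \<open>generic\<close> comes from injectivity on an open set:
  if \<open>polar F x v = c *s F v\<close> then \<open>F\<close> takes the same value at
  \<open>x + t *s v\<close> and \<open>x + (- 2 * c - t) *s v\<close>.  Clauses \<open>red1\<close> and \<open>red2\<close> express that a linear form
  whose square is a combination of the components of \<open>F\<close> vanishes on the base scheme, tested
  on jets of curves of order one and two.
\<close>

locale admissible =
  fixes F :: "complex^4 \<Rightarrow> complex^5"
  assumes quad: "quad_map F"
    and indep: "\<And>c y. lin_form c \<Longrightarrow> (\<And>x. c (F x) = 0) \<Longrightarrow> c y = 0"
    and generic: "\<exists>f. line_poly f \<and> (\<exists>x. f x \<noteq> 0) \<and>
      (\<forall>x. f x \<noteq> 0 \<longrightarrow> F x \<noteq> 0 \<and> (\<forall>v c. polar F x v = c *s F v \<longrightarrow> (\<exists>k. v = k *s x)))"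
    and red1: "\<And>a c p v. lin_form a \<Longrightarrow> lin_form c \<Longrightarrow> (\<And>x. (a x)\<^sup>2 = c (F x)) \<Longrightarrow>
      p \<noteq> 0 \<Longrightarrow> F p = 0 \<Longrightarrow> polar F p v = 0 \<Longrightarrow> a v = 0"
    and red2: "\<And>a c p v w. lin_form a \<Longrightarrow> lin_form c \<Longrightarrow> (\<And>x. (a x)\<^sup>2 = c (F x)) \<Longrightarrow>
      p \<noteq> 0 \<Longrightarrow> F p = 0 \<Longrightarrow> polar F p v = 0 \<Longrightarrow> F v + 2 *s polar F p w = 0 \<Longrightarrow> a w = 0"
    and base: "\<exists>p. p \<noteq> 0 \<and> F p = 0"

text \<open>Every condition is phrased through \<open>F\<close>, its polarization and linear forms:
  forms on the source are carried along by the inverse of \<open>S\<close>, forms on the target are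
  composed with \<open>T\<close>.\<close>

lemma admissible_transform:
  assumes "admissible F" "lin_iso S" "lin_iso T"
  shows "admissible (\<lambda>x. T (F (S x)))"
proof -
  interpret admissible F by (rule assms)
  note S = lin_isoD[OF assms(2)] and T = lin_isoD[OF assms(3)]
  note S' = lin_isoD(1)[OF lin_iso_inv[OF assms(2)]]
  note SS = lin_mapD[OF S(1)] and TT = lin_mapD[OF T(1)] and SS' = lin_mapD[OF S']
  note pol = quad_map_compose(2)[OF quad S(1) T(1)]
  have T0: "T y = c *s T z \<longleftrightarrow> y = c *s z" for y z c
    by (metis T(3) TT(2))
  show ?thesis
  proof
    show "quad_map (\<lambda>x. T (F (S x)))" by (rule quad_map_compose(1)[OF quad S(1) T(1)])
    show "c y = 0" if "lin_form c" "\<And>x. c (T (F (S x))) = 0" for c y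
    proof -
      have "c (T (F x)) = 0" for x using that(2)[of "inv S x"] by (simp add: S)
      then have "c (T (inv T y)) = 0"
        using indep[OF lin_form_comp[OF that(1) T(1)]] by blast
      then show ?thesis by (simp add: T)
    qed
    from generic obtain f x0 where f: "line_poly f" "f x0 \<noteq> 0"
      "\<And>x. f x \<noteq> 0 \<Longrightarrow> F x \<noteq> 0 \<and> (\<forall>v c. polar F x v = c *s F v \<longrightarrow> (\<exists>k. v = k *s x))"
      by blast
    show "\<exists>f. line_poly f \<and> (\<exists>x. f x \<noteq> 0) \<and> (\<forall>x. f x \<noteq> 0 \<longrightarrow> T (F (S x)) \<noteq> 0 \<and>
         (\<forall>v c. polar (\<lambda>x. T (F (S x))) x v = c *s T (F (S v)) \<longrightarrow> (\<exists>k. v = k *s x)))"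
    proof (intro exI[of _ "\<lambda>x. f (S x)"] conjI allI impI)
      show "line_poly (\<lambda>x. f (S x))"
        using f(1) by (simp add: line_poly_def SS)
      show "\<exists>x. f (S x) \<noteq> 0" using f(2) by (intro exI[of _ "inv S x0"]) (simp add: S)
    next
      fix x assume "f (S x) \<noteq> 0"
      then show "T (F (S x)) \<noteq> 0" using f(3) T(4) by auto
    next
      fix x v c assume "f (S x) \<noteq> 0" "polar (\<lambda>x. T (F (S x))) x v = c *s T (F (S v))"
      then obtain k where "S v = k *s S x" using f(3) unfolding pol T0 by blast
      then show "\<exists>k. v = k *s x" by (metis S(3) SS(2))
    qed
    show "\<exists>p. p \<noteq> 0 \<and> T (F (S p)) = 0"
      using base by (metis S(2,4) T(4))
  next
    fix a c p v assume a: "lin_form a" "lin_form c" "\<And>x. (a x)\<^sup>2 = c (T (F (S x)))"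
      "p \<noteq> 0" "T (F (S p)) = 0" "polar (\<lambda>x. T (F (S x))) p v = 0"
    have "a (inv S (S v)) = 0"
    proof (rule red1[where a = "\<lambda>x. a (inv S x)" and c = "\<lambda>x. c (T x)" and p = "S p"])
      show "lin_form (\<lambda>x. a (inv S x))" by (rule lin_form_comp[OF a(1) S'])
      show "lin_form (\<lambda>x. c (T x))" by (rule lin_form_comp[OF a(2) T(1)])
      show "(a (inv S x))\<^sup>2 = c (T (F x))" for x by (simp add: a(3) S)
    qed (use a S T pol in auto)
    then show "a v = 0" by (simp add: S)
  next
    fix a c p v w assume a: "lin_form a" "lin_form c" "\<And>x. (a x)\<^sup>2 = c (T (F (S x)))"
      "p \<noteq> 0" "T (F (S p)) = 0" "polar (\<lambda>x. T (F (S x))) p v = 0"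
      "T (F (S v)) + 2 *s polar (\<lambda>x. T (F (S x))) p w = 0"
    have "a (inv S (S w)) = 0"
    proof (rule red2[where a = "\<lambda>x. a (inv S x)" and c = "\<lambda>x. c (T x)" and p = "S p" and v = "S v"])
      show "lin_form (\<lambda>x. a (inv S x))" by (rule lin_form_comp[OF a(1) S'])
      show "lin_form (\<lambda>x. c (T x))" by (rule lin_form_comp[OF a(2) T(1)])
      show "(a (inv S x))\<^sup>2 = c (T (F x))" for x by (simp add: a(3) S)
      have "T (F (S v) + 2 *s polar F (S p) (S w)) = 0"
        using a(7) unfolding pol by (simp add: TT)
      then show "F (S v) + 2 *s polar F (S p) (S w) = 0" by (simp only: T(4))
    qed (use a S T pol in auto)
    then show "a w = 0" by (simp add: S)
  qed
qed


section \<open>Normal forms over quadrics of rank three and four\<close>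

lemma exhaust_5: "x = 1 \<or> x = 2 \<or> x = 3 \<or> x = 4 \<or> x = 5" for x :: 5
proof (induct x)
  case (of_int z)
  then have "0 \<le> z" "z < 5" by simp_all
  then have "z = 0 \<or> z = 1 \<or> z = 2 \<or> z = 3 \<or> z = 4" by arith
  then show ?case by auto
qed

lemma forall_5: "(\<forall>i::5. P i) \<longleftrightarrow> P 1 \<and> P 2 \<and> P 3 \<and> P 4 \<and> P 5"
  by (metis exhaust_5)

definition vec4 :: "complex \<Rightarrow> complex \<Rightarrow> complex \<Rightarrow> complex \<Rightarrow> complex^4" where
  "vec4 a b c d = (\<chi> i. if i = 1 then a else if i = 2 then b else if i = 3 then c else d)"

definition vec5 :: "complex \<Rightarrow> complex \<Rightarrow> complex \<Rightarrow> complex \<Rightarrow> complex \<Rightarrow> complex^5" where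
  "vec5 a b c d e =
    (\<chi> i. if i = 1 then a else if i = 2 then b else if i = 3 then c else if i = 4 then d else e)"

lemma vec4_nth [simp]: "vec4 a b c d $ 1 = a" "vec4 a b c d $ 2 = b" "vec4 a b c d $ 3 = c" "vec4 a b c d $ 4 = d"
  by (simp_all add: vec4_def)

lemma vec5_nth [simp]: "vec5 a b c d e $ 1 = a" "vec5 a b c d e $ 2 = b" "vec5 a b c d e $ 3 = c"
  "vec5 a b c d e $ 4 = d" "vec5 a b c d e $ 5 = e"
  by (simp_all add: vec5_def)

lemma vec_eq_iff_4: "x = y \<longleftrightarrow> x $ 1 = y $ 1 \<and> x $ 2 = y $ 2 \<and> x $ 3 = y $ 3 \<and> x $ 4 = y $ 4"
  for x y :: "complex^4"
  by (simp add: vec_eq_iff forall_4)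

lemma vec_eq_iff_5: "x = y \<longleftrightarrow> x $ 1 = y $ 1 \<and> x $ 2 = y $ 2 \<and> x $ 3 = y $ 3 \<and> x $ 4 = y $ 4 \<and> x $ 5 = y $ 5"
  for x y :: "complex^5"
  by (simp add: vec_eq_iff forall_5)

lemma axis_4_nth [simp]:
  "axis (1::4) (1::complex) = vec4 1 0 0 0" "axis (2::4) (1::complex) = vec4 0 1 0 0"
  "axis (3::4) (1::complex) = vec4 0 0 1 0" "axis (4::4) (1::complex) = vec4 0 0 0 1"
  by (simp_all add: vec_eq_iff_4 axis_def)

text \<open>A linear map after a quadratic one has degree two, so the factor common to all
  coordinates has to be a linear form.\<close>

definition linear_inverse :: "(complex^4 \<Rightarrow> complex^5) \<Rightarrow> bool" where
  "linear_inverse F \<longleftrightarrow>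
    (\<exists>G l. lin_map G \<and> lin_form l \<and> (\<exists>x. l x \<noteq> 0) \<and> (\<forall>x. G (F x) = l x *s x))"

text \<open>A basis of the quadrics containing the line x1 = x2 = 0 and the first two coordinate
  points. The image satisfies y1 y5 = y2 y3, a cone whose vertex is the fourth coordinate
  point.\<close>

definition line_two_points :: "complex^4 \<Rightarrow> complex^5" where
  "line_two_points x = vec5 (x $ 1 * x $ 3) (x $ 1 * x $ 4) (x $ 2 * x $ 3) (x $ 1 * x $ 2) (x $ 2 * x $ 4)"

definition equiv_line_two_points :: "(complex^4 \<Rightarrow> complex^5) \<Rightarrow> bool" where
  "equiv_line_two_points F \<longleftrightarrow>
    (\<exists>S T. lin_iso S \<and> lin_iso T \<and> (\<forall>x. T (F (S x)) = line_two_points x))"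

lemma linear_inverse_transform:
  assumes "linear_inverse (\<lambda>x. T (F (S x)))" "lin_iso S" "lin_iso T"
  shows "linear_inverse F"
proof -
  from assms(1) obtain G l x0 where G: "lin_map G" "lin_form l" "l x0 \<noteq> 0"
      "\<And>x. G (T (F (S x))) = l x *s x"
    unfolding linear_inverse_def by blast
  note S = lin_isoD[OF assms(2)] and S' = lin_isoD(1)[OF lin_iso_inv[OF assms(2)]]
  show ?thesis unfolding linear_inverse_def
  proof (intro exI conjI allI)
    show "lin_map (\<lambda>y. S (G (T y)))"
      by (rule lin_map_comp[OF S(1) lin_map_comp[OF G(1) lin_isoD(1)[OF assms(3)]]])
    show "lin_form (\<lambda>x. l (inv S x))" by (rule lin_form_comp[OF G(2) S'])
    show "l (inv S (S x0)) \<noteq> 0" using G(3) by (simp add: S)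
    show "S (G (T (F x))) = l (inv S x) *s x" for x
      using G(4)[of "inv S x"] by (simp add: S lin_mapD(2)[OF S(1)])
  qed
qed

lemma equiv_line_two_points_transform:
  assumes "equiv_line_two_points (\<lambda>x. T (F (S x)))" "lin_iso S" "lin_iso T"
  shows "equiv_line_two_points F"
proof -
  from assms(1) obtain S' T' where *: "lin_iso S'" "lin_iso T'" "\<And>x. T' (T (F (S (S' x)))) = line_two_points x"
    unfolding equiv_line_two_points_def by blast
  show ?thesis unfolding equiv_line_two_points_def
    using lin_iso_comp[OF assms(2) *(1)] lin_iso_comp[OF *(2) assms(3)] *(3) by blast
qed

lemma quad_map_4_expand:
  fixes F :: "complex^4 \<Rightarrow> complex^5"
  assumes "quad_map F"
  shows "\<exists>m11 m12 m13 m14 m22 m23 m24 m33 m34 m44. (\<forall>x. F x $ k =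
     m11 * (x$1)\<^sup>2 + m12 * (x$1 * x$2) + m13 * (x$1 * x$3) + m14 * (x$1 * x$4) + m22 * (x$2)\<^sup>2 +
     m23 * (x$2 * x$3) + m24 * (x$2 * x$4) + m33 * (x$3)\<^sup>2 + m34 * (x$3 * x$4) + m44 * (x$4)\<^sup>2)"
proof -
  let ?e1 = "vec4 1 0 0 0" and ?e2 = "vec4 0 1 0 0" and ?e3 = "vec4 0 0 1 0" and ?e4 = "vec4 0 0 0 1"
  let ?b = "\<lambda>x z. polar F x z $ k"
  have s: "?b ?e2 ?e1 = ?b ?e1 ?e2" "?b ?e3 ?e1 = ?b ?e1 ?e3" "?b ?e4 ?e1 = ?b ?e1 ?e4"
    "?b ?e3 ?e2 = ?b ?e2 ?e3" "?b ?e4 ?e2 = ?b ?e2 ?e4" "?b ?e4 ?e3 = ?b ?e3 ?e4"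
    by (simp_all add: polar_commute)
  have "F x $ k = ?b ?e1 ?e1 * (x$1)\<^sup>2 + (2 * ?b ?e1 ?e2) * (x$1 * x$2) + (2 * ?b ?e1 ?e3) * (x$1 * x$3)
     + (2 * ?b ?e1 ?e4) * (x$1 * x$4) + ?b ?e2 ?e2 * (x$2)\<^sup>2 + (2 * ?b ?e2 ?e3) * (x$2 * x$3)
     + (2 * ?b ?e2 ?e4) * (x$2 * x$4) + ?b ?e3 ?e3 * (x$3)\<^sup>2 + (2 * ?b ?e3 ?e4) * (x$3 * x$4)
     + ?b ?e4 ?e4 * (x$4)\<^sup>2" for x
    by (subst quad_map_expand[OF assms]) (simp add: sum_4 s power2_eq_square algebra_simps)
  then show ?thesis by blast
qed

lemma lin_map_vec4I:
  "lin_form f1 \<Longrightarrow> lin_form f2 \<Longrightarrow> lin_form f3 \<Longrightarrow> lin_form f4 \<Longrightarrow>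
    lin_map (\<lambda>x. vec4 (f1 x) (f2 x) (f3 x) (f4 x))"
  by (simp add: lin_map_iff_nth forall_4)

lemma lin_map_vec5I:
  "lin_form f1 \<Longrightarrow> lin_form f2 \<Longrightarrow> lin_form f3 \<Longrightarrow> lin_form f4 \<Longrightarrow> lin_form f5 \<Longrightarrow>
    lin_map (\<lambda>x. vec5 (f1 x) (f2 x) (f3 x) (f4 x) (f5 x))"
  by (simp add: lin_map_iff_nth forall_5)

lemma lin_form_divide: "lin_form f \<Longrightarrow> lin_form (\<lambda>x. f x / c)"
  by (simp add: lin_form_iff add_divide_distrib)

lemma lin_form_uminus: "lin_form f \<Longrightarrow> lin_form (\<lambda>x. - f x)"
  by (simp add: lin_form_iff)

lemma lin_form_0: "lin_form (\<lambda>x. 0)"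
  by (simp add: lin_form_iff)

lemmas lin_intros = lin_map_vec4I lin_map_vec5I lin_form_nth lin_form_add lin_form_diff
  lin_form_cmult lin_form_divide lin_form_uminus lin_form_0

lemma polar_nth: "polar F x z $ i = (F (x + z) $ i - F x $ i - F z $ i) / 2"
  by (simp add: polar_def)

text \<open>The components x1^2, x1 x2, x1 x3 are present, so only x1 x4 is missing for an inverse
  with common factor x1. Genericity makes the fourth coordinate point a base point. As x1^2 is a
  component, x1 vanishes on first and second order jets there, and this removes from the fourth
  component every monomial except x1 x4 and those already available.\<close>

lemma linear_inverse_of_vertex:
  assumes "admissible F"
    and F: "\<And>x. F x $ 1 = (x $ 1)\<^sup>2" "\<And>x. F x $ 2 = x $ 1 * x $ 2" "\<And>x. F x $ 3 = x $ 1 * x $ 3"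
      "\<And>x. F x $ 5 = x $ 2 * x $ 3"
  shows "linear_inverse F"
proof -
  interpret admissible F by fact
  obtain m11 m12 m13 m14 m22 m23 m24 m33 m34 m44 where m: "\<And>x. F x $ 4 =
     m11 * (x$1)\<^sup>2 + m12 * (x$1 * x$2) + m13 * (x$1 * x$3) + m14 * (x$1 * x$4) + m22 * (x$2)\<^sup>2 +
     m23 * (x$2 * x$3) + m24 * (x$2 * x$4) + m33 * (x$3)\<^sup>2 + m34 * (x$3 * x$4) + m44 * (x$4)\<^sup>2"
    using quad_map_4_expand[OF quad, of 4] by blast
  obtain f x0 where f: "line_poly f" "f x0 \<noteq> 0"
    "\<And>x. f x \<noteq> 0 \<Longrightarrow> (\<forall>v c. polar F x v = c *s F v \<longrightarrow> (\<exists>k. v = k *s x))"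
    using generic by blast
  let ?e = "vec4 0 0 0 1"
  have m44: "m44 = 0"
  proof (rule ccontr)
    assume nz: "m44 \<noteq> 0"
    obtain x where x: "f x \<noteq> 0" "x $ 1 \<noteq> 0"
      using line_poly_common_nonzero[OF f(1) line_poly_nth[of 1] f(2), of "vec4 1 0 0 0"] by auto
    \<comment> \<open>If \<open>?e\<close> were no base point, \<open>F ?e\<close> and
      \<open>polar F x ?e\<close> would both lie on the fourth axis, and \<open>generic\<close>
      would make \<open>?e\<close> a multiple of \<open>x\<close>.\<close>
    have "polar F x ?e = (polar F x ?e $ 4 / m44) *s F ?e"
      using nz by (simp add: vec_eq_iff_5 polar_nth F m power2_eq_square)
    then obtain k where "?e = k *s x" using f(3)[OF x(1)] by blast
    then show False using x(2) by (auto simp: vec_eq_iff_4)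
  qed
  have red: "v $ 1 = 0" if "m14 * v $ 1 + m24 * v $ 2 + m34 * v $ 3 = 0" for v :: "complex^4"
  proof (rule red1[where a = "\<lambda>x. x $ 1" and c = "\<lambda>y. y $ 1" and p = ?e])
    show "polar F ?e v = 0"
      using that by (simp add: vec_eq_iff_5 polar_nth F m m44 algebra_simps power2_eq_square)
  qed (simp_all add: lin_form_nth F m m44 vec_eq_iff_5 vec_eq_iff_4)
  \<comment> \<open>The first two test vectors annihilate the differential of the fourth component
    at \<open>?e\<close>, and their first coordinate is the coefficient to be killed.\<close>
  have 24: "m24 = 0" using red[of "vec4 m24 (- m14) 0 0"] by simp
  have 34: "m34 = 0" using red[of "vec4 m34 0 (- m14) 0"] by simp
  have 14: "m14 \<noteq> 0" using red[of "vec4 1 0 0 0"] by auto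
  \<comment> \<open>The alternative v2 = 0 or v3 = 0 keeps the component x2 x3 of \<open>F v\<close>
    zero; \<open>w\<close> then only has to compensate a pure square in the fourth
    component.\<close>
  have red': "w $ 1 = 0" if "v $ 1 = 0" "v $ 2 = 0 \<or> v $ 3 = 0"
     "m22 * (v $ 2)\<^sup>2 + m23 * (v $ 2 * v $ 3) + m33 * (v $ 3)\<^sup>2 + m14 * w $ 1 = 0" for v w :: "complex^4"
  proof (rule red2[where a = "\<lambda>x. x $ 1" and c = "\<lambda>y. y $ 1" and p = ?e and v = v])
    show "F v + 2 *s polar F ?e w = 0" "polar F ?e v = 0"
      using that by (auto simp: vec_eq_iff_5 polar_nth F m m44 24 34 algebra_simps power2_eq_square)
  qed (simp_all add: lin_form_nth F m m44 24 34 vec_eq_iff_5 vec_eq_iff_4)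
  have 22: "m22 = 0" using red'[of "vec4 0 1 0 0" "vec4 (- m22 / m14) 0 0 0"] 14 by simp
  have 33: "m33 = 0" using red'[of "vec4 0 0 1 0" "vec4 (- m33 / m14) 0 0 0"] 14 by simp
  define G where "G = (\<lambda>y :: complex^5. vec4 (y $ 1) (y $ 2) (y $ 3)
    ((y $ 4 - m11 * y $ 1 - m12 * y $ 2 - m13 * y $ 3 - m23 * y $ 5) / m14))"
  show ?thesis unfolding linear_inverse_def
  proof (intro exI conjI allI)
    show "lin_map G" unfolding G_def by (intro lin_intros)
    show "lin_form (\<lambda>x :: complex^4. x $ 1)" by (rule lin_form_nth)
    show "vec4 1 0 0 0 $ 1 \<noteq> 0" by simp
    show "G (F x) = x $ 1 *s x" for x
      using 14 by (simp add: G_def vec_eq_iff_4 F m m44 24 34 22 33 power2_eq_square field_simps)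
  qed
qed

lemma complex_sqrt: "\<exists>s::complex. s\<^sup>2 = z"
  by (rule exI[of _ "csqrt z"]) simp

text \<open>In both cases p s - q r is, up to sign, a square root of the discriminant, so a nonzero
  discriminant makes the two factors independent.\<close>

lemma binary_form_factor:
  fixes \<alpha> \<beta> \<gamma> :: complex
  assumes "\<beta>\<^sup>2 \<noteq> 4 * \<alpha> * \<gamma>"
  shows "\<exists>p q r s. p * s \<noteq> q * r \<and>
    (\<forall>a b. \<alpha> * a\<^sup>2 + \<beta> * (a * b) + \<gamma> * b\<^sup>2 = (p * a + q * b) * (r * a + s * b))"
proof (cases "\<alpha> = 0")
  case True
  show ?thesis
  proof (intro exI conjI allI)
    show "0 * \<gamma> \<noteq> 1 * \<beta>" using assms True by auto
    show "\<alpha> * a\<^sup>2 + \<beta> * (a * b) + \<gamma> * b\<^sup>2 = (0 * a + 1 * b) * (\<beta> * a + \<gamma> * b)" for a b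
      by (simp add: True power2_eq_square algebra_simps)
  qed
next
  case False
  obtain d where d: "d\<^sup>2 = \<beta>\<^sup>2 - 4 * \<alpha> * \<gamma>" using complex_sqrt by blast
  then have "d \<noteq> 0" using assms by auto
  show ?thesis
  proof (intro exI conjI allI)
    show "1 * ((\<beta> - d) / 2) \<noteq> ((\<beta> + d) / (2 * \<alpha>)) * \<alpha>" using \<open>d \<noteq> 0\<close> False by (simp add: field_simps)
    have "4 * \<alpha> * (\<alpha> * a\<^sup>2 + \<beta> * (a * b) + \<gamma> * b\<^sup>2) =
        4 * \<alpha> * ((1 * a + (\<beta> + d) / (2 * \<alpha>) * b) * (\<alpha> * a + (\<beta> - d) / 2 * b))" for a b
      using False d by (simp add: field_simps) algebra
    then show "\<alpha> * a\<^sup>2 + \<beta> * (a * b) + \<gamma> * b\<^sup>2 =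
        (1 * a + (\<beta> + d) / (2 * \<alpha>) * b) * (\<alpha> * a + (\<beta> - d) / 2 * b)" for a b
      using False by simp
  qed
qed

lemma binary_form_square:
  fixes \<alpha> \<beta> \<gamma> :: complex
  assumes "\<beta>\<^sup>2 = 4 * \<alpha> * \<gamma>"
  shows "\<exists>p q. \<forall>a b. \<alpha> * a\<^sup>2 + \<beta> * (a * b) + \<gamma> * b\<^sup>2 = (p * a + q * b)\<^sup>2"
proof (cases "\<alpha> = 0")
  case True
  obtain q where "q\<^sup>2 = \<gamma>" using complex_sqrt by blast
  then show ?thesis using True assms by (intro exI[of _ 0] exI[of _ q]) (simp add: power_mult_distrib)
next
  case False
  obtain p where p: "p\<^sup>2 = \<alpha>" using complex_sqrt by blast
  then have "p \<noteq> 0" using False by auto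
  have "\<alpha> * a\<^sup>2 + \<beta> * (a * b) + \<gamma> * b\<^sup>2 = (p * a + \<beta> / (2 * p) * b)\<^sup>2" for a b
  proof -
    have "4 * \<alpha> * (\<alpha> * a\<^sup>2 + \<beta> * (a * b) + \<gamma> * b\<^sup>2) = 4 * \<alpha> * (p * a + \<beta> / (2 * p) * b)\<^sup>2"
      using \<open>p \<noteq> 0\<close> assms unfolding p[symmetric] by (simp add: field_simps) algebra
    then show ?thesis using False by simp
  qed
  then show ?thesis by blast
qed

text \<open>Subtracting multiples of the four products leaves a binary form in x1, x2 as fourth
  component. Its zeros on the line x3 = x4 = 0 are the isolated base points. A double zero is
  excluded because the square root of the form would be nilpotent there, and two distinct zeros
  become coordinate points.\<close>

lemma equiv_line_two_points_of_base_line: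
  assumes "admissible F"
    and F: "\<And>x. F x $ 1 = x $ 1 * x $ 3" "\<And>x. F x $ 2 = x $ 1 * x $ 4" "\<And>x. F x $ 3 = x $ 2 * x $ 3"
      "\<And>x. F x $ 5 = x $ 2 * x $ 4"
    and F0: "\<And>c d. F (vec4 0 0 c d) $ 4 = 0"
  shows "equiv_line_two_points F"
proof -
  interpret admissible F by fact
  obtain m11 m12 m13 m14 m22 m23 m24 m33 m34 m44 where m: "\<And>x. F x $ 4 =
     m11 * (x$1)\<^sup>2 + m12 * (x$1 * x$2) + m13 * (x$1 * x$3) + m14 * (x$1 * x$4) + m22 * (x$2)\<^sup>2 +
     m23 * (x$2 * x$3) + m24 * (x$2 * x$4) + m33 * (x$3)\<^sup>2 + m34 * (x$3 * x$4) + m44 * (x$4)\<^sup>2"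
    using quad_map_4_expand[OF quad, of 4] by blast
  have 33: "m33 = 0" and 44: "m44 = 0" using F0[of 1 0] F0[of 0 1] by (simp_all add: m)
  then have 34: "m34 = 0" using F0[of 1 1] by (simp add: m)
  have "m12\<^sup>2 \<noteq> 4 * m11 * m22"
  proof
    assume D: "m12\<^sup>2 = 4 * m11 * m22"
    obtain p q where pq: "\<And>a b. m11 * a\<^sup>2 + m12 * (a * b) + m22 * b\<^sup>2 = (p * a + q * b)\<^sup>2"
      using binary_form_square[OF D] by blast
    let ?c = "\<lambda>y :: complex^5. y $ 4 - m13 * y $ 1 - m14 * y $ 2 - m23 * y $ 3 - m24 * y $ 5"
    have c: "lin_form ?c" by (intro lin_intros)
    have sq: "(p * x $ 1 + q * x $ 2)\<^sup>2 = ?c (F x)" for x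
      unfolding pq[symmetric] m F 33 34 44 by (simp add: algebra_simps)
    have p2: "m11 = p\<^sup>2" using pq[of 1 0] by simp
    have q2: "m22 = q\<^sup>2" using pq[of 0 1] by simp
    have pq2: "m12 = 2 * p * q" using pq[of 1 1] p2 q2 by (simp add: power2_sum)
    have "p \<noteq> 0 \<or> q \<noteq> 0"
    proof (rule ccontr)
      assume "\<not> ?thesis"
      then have "?c (F x) = 0" for x using sq[of x] by simp
      from indep[OF c this, of "vec5 0 0 0 1 0"] show False by simp
    qed
    \<comment> \<open>The zero of the double factor on the line x3 = x4 = 0. The differential of
      \<open>F\<close> kills every direction inside that line, though the factor does not vanish on
      all of them.\<close>
    then have pt: "vec4 q (- p) 0 0 \<noteq> 0" by (auto simp: vec_eq_iff_4)
    have "p * v $ 1 + q * v $ 2 = 0" if "v $ 3 = 0" "v $ 4 = 0" for v :: "complex^4"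
    proof (rule red1[where a = "\<lambda>x :: complex^4. p * x $ 1 + q * x $ 2" and c = ?c and p = "vec4 q (- p) 0 0" and v = v])
      show "lin_form (\<lambda>x :: complex^4. p * x $ 1 + q * x $ 2)" by (intro lin_intros)
      show "F (vec4 q (- p) 0 0) = 0"
        by (simp add: vec_eq_iff_5 F m p2 q2 pq2 33 44 34 power2_eq_square algebra_simps)
      show "polar F (vec4 q (- p) 0 0) v = 0"
        using that by (simp add: vec_eq_iff_5 polar_nth F m p2 q2 pq2 33 44 34 power2_eq_square algebra_simps)
    qed (fact c sq pt)+
    from this[of "vec4 1 0 0 0"] this[of "vec4 0 1 0 0"] \<open>p \<noteq> 0 \<or> q \<noteq> 0\<close> show False by simp
  qed
  then obtain p q r s where d: "p * s \<noteq> q * r"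
    "\<And>a b. m11 * a\<^sup>2 + m12 * (a * b) + m22 * b\<^sup>2 = (p * a + q * b) * (r * a + s * b)"
    using binary_form_factor[of m12 m11 m22] by blast
  have z: "a = 0 \<and> b = 0" if "p * a + q * b = 0" "r * a + s * b = 0" for a b
  proof -
    have "(p * s - q * r) * a = 0" "(p * s - q * r) * b = 0" using that by algebra+
    then show ?thesis using d(1) by auto
  qed
  define N where "N = (\<lambda>x :: complex^4. vec4 (p * x $ 1 + q * x $ 2) (r * x $ 1 + s * x $ 2) (x $ 3) (x $ 4))"
  \<comment> \<open>\<open>T\<close> is forced by \<open>N\<close>: it makes the same substitution
    in the products x_i x_j with i in {1, 2} and j in {3, 4}, and strips their multiples from the
    fourth component.\<close>
  define T where "T = (\<lambda>y :: complex^5. vec5 (p * y $ 1 + q * y $ 3) (p * y $ 2 + q * y $ 5) (r * y $ 1 + s * y $ 3)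
    (y $ 4 - m13 * y $ 1 - m14 * y $ 2 - m23 * y $ 3 - m24 * y $ 5) (r * y $ 2 + s * y $ 5))"
  have N: "lin_iso N"
  proof (rule lin_iso_injI)
    show "lin_map N" unfolding N_def by (intro lin_intros)
    show "x = 0" if "N x = 0" for x using that z[of "x $ 1" "x $ 2"] by (simp add: N_def vec_eq_iff_4)
  qed
  have T: "lin_iso T"
  proof (rule lin_iso_injI)
    show "lin_map T" unfolding T_def by (intro lin_intros)
    show "y = 0" if "T y = 0" for y
      using that z[of "y $ 1" "y $ 3"] z[of "y $ 2" "y $ 5"] by (simp add: T_def vec_eq_iff_5)
  qed
  have "T (F x) = line_two_points (N x)" for x
    using d(2)[of "x $ 1" "x $ 2"]
    by (simp add: T_def N_def line_two_points_def vec_eq_iff_5 F m 33 44 34 algebra_simps)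
  then have "T (F (inv N x)) = line_two_points x" for x by (simp add: lin_isoD[OF N])
  then show ?thesis
    unfolding equiv_line_two_points_def using lin_iso_inv[OF N] T by blast
qed

text \<open>Exchanging the lines x1 = x2 = 0 and x3 = x4 = 0 merely permutes the four products, so
  it is enough that the fourth component vanishes on one of them.\<close>

lemma equiv_line_two_points_of_skew_lines:
  assumes "admissible F"
    and F: "\<And>x. F x $ 1 = x $ 1 * x $ 3" "\<And>x. F x $ 2 = x $ 1 * x $ 4" "\<And>x. F x $ 3 = x $ 2 * x $ 3"
      "\<And>x. F x $ 5 = x $ 2 * x $ 4"
  shows "equiv_line_two_points F"
proof -
  interpret admissible F by fact
  obtain f x0 where f: "line_poly f" "f x0 \<noteq> 0"
    "\<And>x. f x \<noteq> 0 \<Longrightarrow> (\<forall>v c. polar F x v = c *s F v \<longrightarrow> (\<exists>k. v = k *s x))"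
    using generic by blast
  have "(\<forall>c d. F (vec4 0 0 c d) $ 4 = 0) \<or> (\<forall>a b. F (vec4 a b 0 0) $ 4 = 0)"
  proof (rule ccontr)
    assume "\<not> ?thesis"
    then obtain a b c d where abcd: "F (vec4 0 0 c d) $ 4 \<noteq> 0" "F (vec4 a b 0 0) $ 4 \<noteq> 0"
      by blast
    let ?p1 = "\<lambda>x :: complex^4. vec4 (x $ 1) (x $ 2) 0 0" and ?p2 = "\<lambda>x :: complex^4. vec4 0 0 (x $ 3) (x $ 4)"
    have p: "lin_map ?p1" "lin_map ?p2" by (intro lin_intros)+
    have g: "line_poly (\<lambda>x. F (?p1 x) $ 4)" "line_poly (\<lambda>x. F (?p2 x) $ 4)"
      using line_poly_quad_map_nth[OF quad_map_compose(1)[OF quad p(1) lin_isoD(1)[OF lin_iso_id]]]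
        line_poly_quad_map_nth[OF quad_map_compose(1)[OF quad p(2) lin_isoD(1)[OF lin_iso_id]]] by auto
    obtain y where "f y * F (?p1 y) $ 4 \<noteq> 0"
      using line_poly_common_nonzero[OF f(1) g(1) f(2), of "vec4 a b 0 0"] abcd by auto
    then obtain x where x: "f x \<noteq> 0" "F (?p1 x) $ 4 \<noteq> 0" "F (?p2 x) $ 4 \<noteq> 0"
      using line_poly_common_nonzero[OF line_poly_mult[OF f(1) g(1)] g(2), of y "vec4 0 0 c d"] abcd by auto
    let ?g1 = "F (?p1 x) $ 4" and ?g2 = "F (?p2 x) $ 4"
    \<comment> \<open>On the line through \<open>?p1 x\<close> and \<open>?p2 x\<close> a point with
      coordinates (s, t) goes to s^2 \<open>?g1\<close> + t^2 \<open>?g2\<close> times the fourth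
      basis vector plus 2 s t times \<open>?w\<close>, a map of degree two. The vector
      \<open>?v\<close> defined below is a ramification point, so the differential there sends
      \<open>x\<close> to a multiple of \<open>F ?v\<close>, against \<open>generic\<close>.\<close>
    obtain s where s: "s\<^sup>2 = ?g2 / ?g1" using complex_sqrt by blast
    then have "s \<noteq> 0" using x by auto
    \<comment> \<open>Of the two square roots, one different from 1 is taken to keep
      \<open>?v\<close> apart from \<open>x\<close>.\<close>
    obtain t where t: "t\<^sup>2 = ?g2 / ?g1" "t \<noteq> 1" "t \<noteq> 0"
    proof (cases "s = 1")
      case True
      then show ?thesis using that[of "- s"] s by auto
    qed (use that s \<open>s \<noteq> 0\<close> in auto)
    then have t2: "?g2 = t\<^sup>2 * ?g1" using x(2) by simp
    define g where "g = ?g1"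
    let ?v = "t *s ?p1 x + ?p2 x"
    let ?w = "polar F (?p1 x) (?p2 x)"
    have F1: "F (?p1 x) = vec5 0 0 0 g 0" and F2: "F (?p2 x) = t\<^sup>2 *s vec5 0 0 0 g 0"
      using t2 by (simp_all add: vec_eq_iff_5 F g_def)
    have Fv: "F ?v = (2 * t\<^sup>2) *s vec5 0 0 0 g 0 + (2 * t) *s ?w"
      unfolding quad_map_add[OF quad] quad_map_scale[OF quad] polar_simps[OF quad] F1 F2
      by (simp add: vec_eq_iff_5 algebra_simps)
    have "x = ?p1 x + ?p2 x" by (simp add: vec_eq_iff_4)
    then have "polar F x ?v = polar F (?p1 x + ?p2 x) ?v" by simp
    also have "\<dots> = t *s F (?p1 x) + F (?p2 x) + (1 + t) *s ?w"
      unfolding polar_simps[OF quad] polar_self[OF quad] polar_commute[of F "?p2 x" "?p1 x"]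
      by (simp add: vec_eq_iff_5 algebra_simps)
    also have "\<dots> = ((1 + t) / (2 * t)) *s F ?v"
      unfolding Fv F1 F2 using t(3) by (simp add: vec_eq_iff_5 field_simps power2_eq_square)
    finally obtain k where k: "?v = k *s x" using f(3)[OF x(1)] by blast
    have "x $ 1 \<noteq> 0 \<or> x $ 2 \<noteq> 0"
    proof (rule ccontr)
      assume "\<not> ?thesis"
      then have "?p1 x = 0" by (simp add: vec_eq_iff_4)
      then show False using x(2) quad_map_0[OF quad] by simp
    qed
    then have "t = k" using k by (auto simp: vec_eq_iff_4)
    moreover have "x $ 3 \<noteq> 0 \<or> x $ 4 \<noteq> 0"
    proof (rule ccontr)
      assume "\<not> ?thesis"
      then have "?p2 x = 0" by (simp add: vec_eq_iff_4)
      then show False using x(3) quad_map_0[OF quad] by simp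
    qed
    then have "1 = k" using k by (auto simp: vec_eq_iff_4)
    ultimately show False using t(2) by simp
  qed
  then show ?thesis
  proof (elim disjE)
    assume 1: "\<forall>c d. F (vec4 0 0 c d) $ 4 = 0"
    then show ?thesis using equiv_line_two_points_of_base_line[OF assms] by blast
  next
    assume 2: "\<forall>a b. F (vec4 a b 0 0) $ 4 = 0"
    define S :: "complex^4 \<Rightarrow> complex^4" where "S = (\<lambda>x. vec4 (x $ 3) (x $ 4) (x $ 1) (x $ 2))"
    define T :: "complex^5 \<Rightarrow> complex^5" where "T = (\<lambda>y. vec5 (y $ 1) (y $ 3) (y $ 2) (y $ 4) (y $ 5))"
    have S: "lin_iso S"
      by (rule lin_iso_injI) (auto simp: S_def vec_eq_iff_4 intro!: lin_intros)
    have T: "lin_iso T"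
      by (rule lin_iso_injI) (auto simp: T_def vec_eq_iff_5 intro!: lin_intros)
    have "equiv_line_two_points (\<lambda>x. T (F (S x)))"
      by (rule equiv_line_two_points_of_base_line[OF admissible_transform[OF assms(1) S T]])
         (use 2 in \<open>simp_all add: S_def T_def F\<close>)
    then show ?thesis by (rule equiv_line_two_points_transform) fact+
  qed
qed

section \<open>Exclusion of quadrics of rank three\<close>

lemma binary_form_root:
  fixes \<alpha> \<beta> \<gamma> :: complex
  shows "\<exists>s t. (s \<noteq> 0 \<or> t \<noteq> 0) \<and> \<alpha> * s\<^sup>2 + \<beta> * (s * t) + \<gamma> * t\<^sup>2 = 0"
proof (cases "\<alpha> = 0")
  case True
  then show ?thesis by (intro exI[of _ 1] exI[of _ 0]) simp
next
  case False
  obtain d where d: "d\<^sup>2 = \<beta>\<^sup>2 - 4 * \<alpha> * \<gamma>" using complex_sqrt by blast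
  have "\<alpha> * (d - \<beta>)\<^sup>2 + \<beta> * ((d - \<beta>) * (2 * \<alpha>)) + \<gamma> * (2 * \<alpha>)\<^sup>2 = 0"
    using d by algebra
  then show ?thesis using False by (intro exI[of _ "d - \<beta>"] exI[of _ "2 * \<alpha>"]) simp
qed

lemma singular_2_kernel:
  fixes a b c d :: complex
  assumes "a * d - b * c = 0"
  shows "\<exists>u v. (u \<noteq> 0 \<or> v \<noteq> 0) \<and> a * u + b * v = 0 \<and> c * u + d * v = 0"
proof (cases "a = 0 \<and> b = 0")
  case True
  show ?thesis
  proof (cases "c = 0 \<and> d = 0")
    case True
    then show ?thesis using \<open>a = 0 \<and> b = 0\<close> by (intro exI[of _ 1]) simp
  next
    case False
    then show ?thesis using True by (intro exI[of _ "- d"] exI[of _ c]) auto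
  qed
next
  case False
  then show ?thesis using assms by (intro exI[of _ "- b"] exI[of _ a]) (auto simp: algebra_simps)
qed

text \<open>As x1^2 and x2^2 are components, a tangent vector killed at a base point has x1 = x2 =
  0. If the line x1 = x2 = 0 lies in the base locus, a pencil of 2 by 2 matrices has a singular
  member, which yields a forbidden tangent vector. Otherwise this line is contracted to one point,
  and a suitable direction along it contradicts \<open>generic\<close>.\<close>

lemma no_rank_three_at_vertex:
  assumes "admissible F"
    and F: "\<And>x. F x $ 1 = (x $ 1)\<^sup>2" "\<And>x. F x $ 2 = x $ 1 * x $ 2" "\<And>x. F x $ 5 = (x $ 2)\<^sup>2"
    and Fe: "F (vec4 0 0 0 1) = 0"
  shows False
proof -
  interpret admissible F by fact
  obtain m11 m12 m13 m14 m22 m23 m24 m33 m34 m44 where m: "\<And>x. F x $ 3 =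
     m11 * (x$1)\<^sup>2 + m12 * (x$1 * x$2) + m13 * (x$1 * x$3) + m14 * (x$1 * x$4) + m22 * (x$2)\<^sup>2 +
     m23 * (x$2 * x$3) + m24 * (x$2 * x$4) + m33 * (x$3)\<^sup>2 + m34 * (x$3 * x$4) + m44 * (x$4)\<^sup>2"
    using quad_map_4_expand[OF quad, of 3] by blast
  obtain n11 n12 n13 n14 n22 n23 n24 n33 n34 n44 where n: "\<And>x. F x $ 4 =
     n11 * (x$1)\<^sup>2 + n12 * (x$1 * x$2) + n13 * (x$1 * x$3) + n14 * (x$1 * x$4) + n22 * (x$2)\<^sup>2 +
     n23 * (x$2 * x$3) + n24 * (x$2 * x$4) + n33 * (x$3)\<^sup>2 + n34 * (x$3 * x$4) + n44 * (x$4)\<^sup>2"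
    using quad_map_4_expand[OF quad, of 4] by blast
  have 44: "m44 = 0" "n44 = 0" using m[of "vec4 0 0 0 1"] n[of "vec4 0 0 0 1"] by (simp_all add: Fe)
  note pol = vec_eq_iff_5 polar_nth F m n 44 power2_eq_square algebra_simps
  have red: "v $ 1 = 0 \<and> v $ 2 = 0" if "p \<noteq> 0" "F p = 0" "polar F p v = 0" for p v
    using red1[where a = "\<lambda>x. x $ 1" and c = "\<lambda>y. y $ 1" and p = p and v = v]
      red1[where a = "\<lambda>x. x $ 2" and c = "\<lambda>y. y $ 5" and p = p and v = v]
      that by (simp add: lin_form_nth F)
  have rede: "v $ 1 = 0 \<and> v $ 2 = 0"
    if "m14 * v $ 1 + m24 * v $ 2 + m34 * v $ 3 = 0" "n14 * v $ 1 + n24 * v $ 2 + n34 * v $ 3 = 0"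
    for v :: "complex^4"
  proof (rule red[OF _ Fe])
    show "polar F (vec4 0 0 0 1) v = 0" using that by (simp add: pol)
  qed (simp add: vec_eq_iff_4)
  have D: "m14 * n24 \<noteq> m24 * n14"
  proof
    assume *: "m14 * n24 = m24 * n14"
    have 1: "m14 = 0 \<and> m24 = 0" using rede[of "vec4 m24 (- m14) 0 0"] * by (simp add: algebra_simps)
    have 2: "n14 = 0 \<and> n24 = 0" using rede[of "vec4 n24 (- n14) 0 0"] * by (simp add: algebra_simps)
    from 1 2 show False using rede[of "vec4 1 0 0 0"] by simp
  qed
  \<comment> \<open>The cross product of the two coefficient rows is annihilated by both
    differentials.\<close>
  have cr: "m24 * n34 - m34 * n24 = 0 \<and> m34 * n14 - m14 * n34 = 0"
    using rede[of "vec4 (m24 * n34 - m34 * n24) (m34 * n14 - m14 * n34) (m14 * n24 - m24 * n14) 0"]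
    by (simp add: algebra_simps)
  have "m34 * (m14 * n24 - m24 * n14) = 0" "n34 * (m14 * n24 - m24 * n14) = 0"
    using cr by algebra+
  then have 34: "m34 = 0" "n34 = 0" using D by auto
  show False
  proof (cases "m33 = 0 \<and> n33 = 0")
    case True
    let ?A = "\<lambda>s t. m13 * s + m23 * t" and ?B = "\<lambda>s t. m14 * s + m24 * t"
      and ?C = "\<lambda>s t. n13 * s + n23 * t" and ?D = "\<lambda>s t. n14 * s + n24 * t"
    \<comment> \<open>The differential at a base point (0, 0, u, v) pairs (u, v) bilinearly with (s,
      t). Read as a linear system in (u, v), it has this determinant; a root (s, t) produces both
      the base point and the tangent vector.\<close>
    obtain s t where st: "s \<noteq> 0 \<or> t \<noteq> 0"
      "(m13 * n14 - m14 * n13) * s\<^sup>2 + (m13 * n24 + m23 * n14 - m14 * n23 - m24 * n13) * (s * t)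
         + (m23 * n24 - m24 * n23) * t\<^sup>2 = 0"
      using binary_form_root by blast
    then have "?A s t * ?D s t - ?B s t * ?C s t = 0"
      by (simp add: power2_eq_square algebra_simps)
    from singular_2_kernel[OF this] obtain u v where uv: "u \<noteq> 0 \<or> v \<noteq> 0"
      "?A s t * u + ?B s t * v = 0" "?C s t * u + ?D s t * v = 0" by blast
    have "vec4 s t 0 0 $ 1 = 0 \<and> vec4 s t 0 0 $ 2 = 0"
    proof (rule red)
      show "vec4 0 0 u v \<noteq> 0" using uv(1) by (auto simp: vec_eq_iff_4)
      show "F (vec4 0 0 u v) = 0" using True 34 by (simp add: pol)
      show "polar F (vec4 0 0 u v) (vec4 s t 0 0) = 0" using uv(2,3) True 34 by (simp add: pol)
    qed
    then show False using st(1) by simp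
  next
    case False
    \<comment> \<open>For a vector (0, 0, v3, v4), n33 times the third minus m33 times the fourth
      component of the polarization at \<open>x\<close> is (\<open>?N3 x\<close> v3 +
      \<open>?N4 x\<close> v4) / 2; the terms in x3 cancel. The vector \<open>?v\<close> below is a
      zero, so its polarization is parallel to (m33, n33), as is \<open>F ?v\<close>.\<close>
    let ?N4 = "\<lambda>x :: complex^4. (n33 * m14 - m33 * n14) * x $ 1 + (n33 * m24 - m33 * n24) * x $ 2"
    let ?N3 = "\<lambda>x :: complex^4. (n33 * m13 - m33 * n13) * x $ 1 + (n33 * m23 - m33 * n23) * x $ 2"
    have lN: "line_poly ?N4" by (intro line_poly_add line_poly_mult line_poly_const line_poly_nth)
    have "n33 * m14 - m33 * n14 \<noteq> 0 \<or> n33 * m24 - m33 * n24 \<noteq> 0"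
    proof (rule ccontr)
      assume "\<not> ?thesis"
      then have "n33 * (m14 * n24 - m24 * n14) = 0" "m33 * (m14 * n24 - m24 * n14) = 0" by algebra+
      then show False using D False by auto
    qed
    then obtain z where z: "?N4 z \<noteq> 0"
    proof
      assume "n33 * m14 - m33 * n14 \<noteq> 0"
      then show ?thesis using that[of "vec4 1 0 0 0"] by simp
    next
      assume "n33 * m24 - m33 * n24 \<noteq> 0"
      then show ?thesis using that[of "vec4 0 1 0 0"] by simp
    qed
    obtain f x0 where f: "line_poly f" "f x0 \<noteq> 0"
      "\<And>x. f x \<noteq> 0 \<Longrightarrow> (\<forall>v c. polar F x v = c *s F v \<longrightarrow> (\<exists>k. v = k *s x))"
      using generic by blast
    obtain y where "f y \<noteq> 0" "y $ 1 \<noteq> 0"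
      using line_poly_common_nonzero[OF f(1) line_poly_nth[of 1] f(2), of "vec4 1 0 0 0"] by auto
    then obtain x where x: "f x \<noteq> 0" "x $ 1 \<noteq> 0" "?N4 x \<noteq> 0"
      using line_poly_common_nonzero[OF line_poly_mult[OF f(1) line_poly_nth[of 1]] lN, of y z] z by auto
    define a b where "a = ?N3 x" and "b = ?N4 x"
    let ?v = "vec4 0 0 (- b) a"
    let ?b1 = "- b * (m13 * x $ 1 + m23 * x $ 2 + 2 * m33 * x $ 3) + a * (m14 * x $ 1 + m24 * x $ 2)"
    let ?b2 = "- b * (n13 * x $ 1 + n23 * x $ 2 + 2 * n33 * x $ 3) + a * (n14 * x $ 1 + n24 * x $ 2)"
    have "b \<noteq> 0" using x(3) by (simp add: b_def)
    have "n33 * ?b1 = m33 * ?b2" unfolding a_def b_def by algebra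
    then obtain k where k: "?b1 = k * m33" "?b2 = k * n33"
    proof (cases "m33 = 0")
      case True
      then have "n33 \<noteq> 0" using False by simp
      then show ?thesis using that[of "?b2 / n33"] \<open>n33 * ?b1 = m33 * ?b2\<close> True by simp
    next
      case False
      then show ?thesis using that[of "?b1 / m33"] \<open>n33 * ?b1 = m33 * ?b2\<close> by (simp add: field_simps)
    qed
    have "polar F x ?v $ 3 = ?b1 / 2" "polar F x ?v $ 4 = ?b2 / 2"
      by (simp_all add: polar_nth m n 44 34 power2_eq_square algebra_simps)
    then have p34: "polar F x ?v $ 3 = k * m33 / 2" "polar F x ?v $ 4 = k * n33 / 2"
      using k by simp_all
    have "polar F x ?v = (k / (2 * b\<^sup>2)) *s F ?v"
      unfolding vec_eq_iff_5 using p34 \<open>b \<noteq> 0\<close> by (simp add: m n 44 34) (simp add: polar_nth F algebra_simps)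
    then obtain c where "?v = c *s x" using f(3)[OF x(1)] by blast
    then show False using x(2) \<open>b \<noteq> 0\<close> by (auto simp: vec_eq_iff_4)
  qed
qed

text \<open>A base point has x1 = x2 = 0 because two components are x1^2 and x2^2. It can thus be
  moved to the fourth coordinate point by changing x3 and x4 only, which preserves the three known
  components.\<close>

lemma no_rank_three:
  assumes "admissible F"
    and F: "\<And>x. F x $ 1 = (x $ 1)\<^sup>2" "\<And>x. F x $ 2 = x $ 1 * x $ 2" "\<And>x. F x $ 5 = (x $ 2)\<^sup>2"
  shows False
proof -
  interpret admissible F by fact
  obtain p where p: "p \<noteq> 0" "F p = 0" using base by blast
  then have p12: "p $ 1 = 0" "p $ 2 = 0" using F(1,3)[of p] by (simp_all add: vec_eq_iff_5)
  obtain a b where ab: "a * p $ 4 - b * p $ 3 \<noteq> 0"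
  proof (cases "p $ 4 = 0")
    case True
    then have "p $ 3 \<noteq> 0" using p p12 by (simp add: vec_eq_iff_4)
    then show ?thesis using that[of 0 1] by simp
  qed (use that[of 1 0] in simp)
  define S where "S = (\<lambda>x :: complex^4. vec4 (x $ 1) (x $ 2) (a * x $ 3 + p $ 3 * x $ 4) (b * x $ 3 + p $ 4 * x $ 4))"
  have S: "lin_iso S"
  proof (rule lin_iso_injI)
    show "lin_map S" unfolding S_def by (intro lin_intros)
    fix x assume "S x = 0"
    then have *: "x $ 1 = 0" "x $ 2 = 0" "a * x $ 3 + p $ 3 * x $ 4 = 0" "b * x $ 3 + p $ 4 * x $ 4 = 0"
      by (simp_all add: S_def vec_eq_iff_4)
    then have "(a * p $ 4 - b * p $ 3) * x $ 3 = 0" "(a * p $ 4 - b * p $ 3) * x $ 4 = 0" by algebra+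
    then show "x = 0" using ab * by (simp add: vec_eq_iff_4)
  qed
  have "S (vec4 0 0 0 1) = p" using p12 by (simp add: S_def vec_eq_iff_4)
  then show False
    using no_rank_three_at_vertex[OF admissible_transform[OF assms(1) S lin_iso_id]] p
    by (simp add: F) (simp add: S_def)
qed

section \<open>Reduction to the normal forms\<close>

text \<open>The polarization at the first coordinate point fixes all monomials containing x1, which
  leaves an unknown quadratic map in x2, x3, x4.\<close>

lemma normal_form_expand:
  fixes F :: "complex^4 \<Rightarrow> complex^5"
  assumes "quad_map F" and e: "\<And>x. polar F (vec4 1 0 0 0) x = vec5 (x $ 1) (x $ 2 / 2) (x $ 3 / 2) (x $ 4 / 2) 0"
  obtains n22 n23 n24 n33 n34 n44 where "\<And>x. F x = vec5 ((x $ 1)\<^sup>2) (x $ 1 * x $ 2) (x $ 1 * x $ 3) (x $ 1 * x $ 4) 0 +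
    ((x$2)\<^sup>2 *s n22 + (x$2 * x$3) *s n23 + (x$2 * x$4) *s n24 + (x$3)\<^sup>2 *s n33 + (x$3 * x$4) *s n34 + (x$4)\<^sup>2 *s n44)"
proof -
  let ?e1 = "vec4 1 0 0 0" and ?e2 = "vec4 0 1 0 0" and ?e3 = "vec4 0 0 1 0" and ?e4 = "vec4 0 0 0 1"
  have s: "polar F ?e2 ?e1 = polar F ?e1 ?e2" "polar F ?e3 ?e1 = polar F ?e1 ?e3"
    "polar F ?e4 ?e1 = polar F ?e1 ?e4" "polar F ?e3 ?e2 = polar F ?e2 ?e3"
    "polar F ?e4 ?e2 = polar F ?e2 ?e4" "polar F ?e4 ?e3 = polar F ?e3 ?e4"
    by (simp_all add: polar_commute)
  show ?thesis
    by (rule that[of "polar F ?e2 ?e2" "2 *s polar F ?e2 ?e3" "2 *s polar F ?e2 ?e4" "polar F ?e3 ?e3"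
          "2 *s polar F ?e3 ?e4" "polar F ?e4 ?e4"], subst quad_map_expand[OF assms(1)])
       (simp add: sum_4 s e vec_eq_iff_5 power2_eq_square algebra_simps)
qed

lemma poly_coeffs_0:
  fixes a b c d e f g :: complex
  assumes "\<And>s. a + b * s + c * s ^ 2 + d * s ^ 3 + e * s ^ 4 + f * s ^ 5 + g * s ^ 6 = 0"
  shows "a = 0 \<and> b = 0 \<and> c = 0 \<and> d = 0 \<and> e = 0 \<and> f = 0 \<and> g = 0"
proof -
  have "\<forall>s. poly [:a, b, c, d, e, f, g:] s = 0"
    using assms by (simp add: algebra_simps eval_nat_numeral)
  then show ?thesis by (simp only: poly_all_0_iff_0) simp
qed

lemma quadratic_coeffs_0:
  fixes a b c :: complex
  assumes "\<And>t. a + b * t + c * t\<^sup>2 = 0"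
  shows "a = 0" "b = 0" "c = 0"
  using poly_coeffs_0[of a b c 0 0 0 0] assms by simp_all

text \<open>
  The restriction of \<open>(n2, n3, n4)\<close> to the conic parametrised by \<open>(s\<^sup>2, s, 1)\<close> is isotropic and
  orthogonal to the point of the conic, hence proportional to it; comparing degrees, the factor is a
  linear form \<open>\<mu>\<close>.
\<close>

lemma linear_inverse_smooth_quadric:
  fixes F :: "complex^4 \<Rightarrow> complex^5"
  assumes "quad_map F"
    and e: "\<And>x. polar F (vec4 1 0 0 0) x = vec5 (x $ 1) (x $ 2 / 2) (x $ 3 / 2) (x $ 4 / 2) 0"
    and Q: "\<And>x. F x $ 1 * F x $ 5 + (F x $ 3)\<^sup>2 - F x $ 2 * F x $ 4 = 0"
  shows "linear_inverse F"
proof -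
  obtain n22 n23 n24 n33 n34 n44 where F: "\<And>x. F x = vec5 ((x $ 1)\<^sup>2) (x $ 1 * x $ 2) (x $ 1 * x $ 3) (x $ 1 * x $ 4) 0 +
    ((x$2)\<^sup>2 *s n22 + (x$2 * x$3) *s n23 + (x$2 * x$4) *s n24 + (x$3)\<^sup>2 *s n33 + (x$3 * x$4) *s n34 + (x$4)\<^sup>2 *s n44)"
    using normal_form_expand[OF assms(1) e] by blast
  define n where "n = (\<lambda>k x y z. x\<^sup>2 * n22 $ k + (x * y) * n23 $ k + (x * z) * n24 $ k +
    y\<^sup>2 * n33 $ k + (y * z) * n34 $ k + z\<^sup>2 * n44 $ k)"
  have Fn: "F x $ 1 = (x $ 1)\<^sup>2 + n 1 (x$2) (x$3) (x$4)" "F x $ 2 = x $ 1 * x $ 2 + n 2 (x$2) (x$3) (x$4)"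
    "F x $ 3 = x $ 1 * x $ 3 + n 3 (x$2) (x$3) (x$4)" "F x $ 4 = x $ 1 * x $ 4 + n 4 (x$2) (x$3) (x$4)"
    "F x $ 5 = n 5 (x$2) (x$3) (x$4)" for x
    by (simp_all add: F n_def)
  have q: "(t\<^sup>2 + n 1 x y z) * n 5 x y z + (t * y + n 3 x y z)\<^sup>2 - (t * x + n 2 x y z) * (t * z + n 4 x y z) = 0"
    for t x y z
    using Q[of "vec4 t x y z"] by (simp add: Fn)
  have "(n 1 x y z * n 5 x y z + (n 3 x y z)\<^sup>2 - n 2 x y z * n 4 x y z) +
      (2 * y * n 3 x y z - (x * n 4 x y z + z * n 2 x y z)) * t + (n 5 x y z - (x * z - y\<^sup>2)) * t\<^sup>2 = 0" for t x y z
    using q[of t x y z] by (simp add: power2_eq_square algebra_simps)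
  \<comment> \<open>Coefficients of powers of t = x1: \<open>q2\<close> identifies the fifth
    component, \<open>q1\<close> says that (n2, n3, n4) is orthogonal to (x, y, z), and
    \<open>q0\<close> determines n1 wherever n5 is nonzero.\<close>
  from quadratic_coeffs_0[OF this]
  have q0: "n 1 x y z * n 5 x y z + (n 3 x y z)\<^sup>2 - n 2 x y z * n 4 x y z = 0"
    and q1: "2 * y * n 3 x y z = x * n 4 x y z + z * n 2 x y z"
    and q2: "n 5 x y z = x * z - y\<^sup>2" for x y z
    by simp_all
  define N where "N = (\<lambda>k s. n k (s\<^sup>2) s 1)"
  have N: "N 2 s = s\<^sup>2 * N 4 s \<and> s * N 3 s = N 2 s" for s
  proof -
    have "(N 3 s)\<^sup>2 = N 2 s * N 4 s" "2 * s * N 3 s = s\<^sup>2 * N 4 s + N 2 s"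
      using q0[of "s\<^sup>2" s 1] q1[of s "s\<^sup>2" 1] q2[of "s\<^sup>2" s 1] by (simp_all add: N_def)
    \<comment> \<open>Squaring the second equation and inserting the first gives (s^2 N4 + N2)^2 = 4
      s^2 N2 N4.\<close>
    then have "(N 2 s - s\<^sup>2 * N 4 s)\<^sup>2 = 0" by algebra
    then have "N 2 s = s\<^sup>2 * N 4 s" by simp
    then show ?thesis using \<open>2 * s * N 3 s = s\<^sup>2 * N 4 s + N 2 s\<close> by simp
  qed
  have "- (n44$2) + (n44$3 - n34$2) * s + (n34$3 - n24$2 - n33$2) * s ^ 2 +
     (n24$3 + n33$3 - n23$2) * s ^ 3 + (n23$3 - n22$2) * s ^ 4 + n22$3 * s ^ 5 + 0 * s ^ 6 = 0" for s
    using N[of s] unfolding N_def n_def by (simp add: algebra_simps eval_nat_numeral)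
  from poly_coeffs_0[OF this] have c1: "n44$2 = 0" "n44$3 = n34$2" "n24$2 = n34$3 - n33$2"
     "n33$3 = n23$2 - n24$3" "n22$2 = n23$3" "n22$3 = 0" by (auto simp: algebra_simps)
  have "0 + n44$3 * s + (n34$3 - n44$4) * s ^ 2 + (n24$3 + n33$3 - n34$4) * s ^ 3 +
     (n23$3 - n24$4 - n33$4) * s ^ 4 + (n22$3 - n23$4) * s ^ 5 + (- (n22$4)) * s ^ 6 = 0" for s
  proof -
    have "s * N 3 s - s\<^sup>2 * N 4 s = 0" using N[of s] by simp
    then show ?thesis unfolding N_def n_def by (simp add: algebra_simps eval_nat_numeral)
  qed
  from poly_coeffs_0[OF this] have c2: "n44$3 = 0" "n44$4 = n34$3" "n34$4 = n24$3 + n33$3"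
    "n24$4 = n23$3 - n33$4" "n23$4 = n22$3" "n22$4 = 0" by (auto simp: algebra_simps)
  have c4: "n34$2 = 0" using c1 c2 by simp
  \<comment> \<open>These turn out to be the coefficients of the multiplier \<open>N 4\<close> on
    the conic. Off the conic n2, n3, n4 acquire multiples of y^2 - x z, and orthogonality to (x, y,
    z) forces the factors 2 \<gamma>, - \<beta>, 2 \<alpha>.\<close>
  define \<alpha> \<beta> \<gamma> where "\<alpha> = n33$4 / 2" and "\<beta> = n24$3" and "\<gamma> = n33$2 / 2"
  have d: "n33$4 = 2 * \<alpha>" "n24$3 = \<beta>" "n33$2 = 2 * \<gamma>" by (simp_all add: \<alpha>_def \<beta>_def \<gamma>_def)
  have "n23$3 + n23$2 = \<alpha> + \<beta>" "n23$3 - n23$2 = \<alpha> - \<beta>" "n23$2 + n34$3 = \<beta> + \<gamma>"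
    using q1[of 1 1 0] q1[of "-1" 1 0] q1[of 1 0 1]
    by (simp_all add: n_def c1 c2 c4 d algebra_simps) algebra+
  then have c3: "n23$3 = \<alpha>" "n23$2 = \<beta>" "n34$3 = \<gamma>" by algebra+
  define \<mu> where "\<mu> = (\<lambda>x y z. \<alpha> * x + \<beta> * y + \<gamma> * z)"
  define \<kappa> where "\<kappa> = (\<lambda>x y z :: complex. y\<^sup>2 - x * z)"
  define \<epsilon> where "\<epsilon> = \<beta>\<^sup>2 - 4 * \<alpha> * \<gamma>"
  have n2: "n 2 x y z = x * \<mu> x y z + 2 * \<gamma> * \<kappa> x y z"
    and n3: "n 3 x y z = y * \<mu> x y z - \<beta> * \<kappa> x y z"
    and n4: "n 4 x y z = z * \<mu> x y z + 2 * \<alpha> * \<kappa> x y z" for x y z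
    by (simp_all add: n_def \<mu>_def \<kappa>_def c1 c2 c4 d c3 power2_eq_square algebra_simps)
  \<comment> \<open>By \<open>q0\<close>, \<kappa> n1 = n3^2 - n2 n4 = \<kappa> (\<epsilon> \<kappa>
    - \<mu>^2), and \<kappa> is cancelled as a generically nonzero factor.\<close>
  have n1: "n 1 (x$2) (x$3) (x$4) - (\<epsilon> * \<kappa> (x$2) (x$3) (x$4) - (\<mu> (x$2) (x$3) (x$4))\<^sup>2) = 0" for x :: "complex^4"
  proof (rule line_poly_eq_0[where z = "vec4 0 0 1 0" and k = "\<lambda>x. \<kappa> (x$2) (x$3) (x$4)"])
    show "\<kappa> (x$2) (x$3) (x$4) * (n 1 (x$2) (x$3) (x$4) - (\<epsilon> * \<kappa> (x$2) (x$3) (x$4) - (\<mu> (x$2) (x$3) (x$4))\<^sup>2)) = 0"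
      for x :: "complex^4"
      using q0[of "x$2" "x$3" "x$4"] unfolding q2 n2 n3 n4 \<kappa>_def \<mu>_def \<epsilon>_def by algebra
    show "line_poly (\<lambda>x :: complex^4. n 1 (x$2) (x$3) (x$4) - (\<epsilon> * \<kappa> (x$2) (x$3) (x$4) - (\<mu> (x$2) (x$3) (x$4))\<^sup>2))"
      unfolding n_def \<kappa>_def \<mu>_def by (intro line_poly_intros)
    show "line_poly (\<lambda>x :: complex^4. \<kappa> (x$2) (x$3) (x$4))" unfolding \<kappa>_def by (intro line_poly_intros)
  qed (simp add: \<kappa>_def)
  \<comment> \<open>The fifth component is - \<kappa>. Adding its multiples turns components two to
    four into (x1 + \<mu>) x_j; combined with the first component, which becomes x1^2 - \<mu>^2,
    they give (x1 + \<mu>) x1.\<close>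
  define G where "G = (\<lambda>y :: complex^5. vec4
    (y$1 + \<epsilon> * y$5 + (\<alpha> * (y$2 + 2 * \<gamma> * y$5) + \<beta> * (y$3 - \<beta> * y$5) + \<gamma> * (y$4 + 2 * \<alpha> * y$5)))
    (y$2 + 2 * \<gamma> * y$5) (y$3 - \<beta> * y$5) (y$4 + 2 * \<alpha> * y$5))"
  show ?thesis unfolding linear_inverse_def
  proof (intro exI conjI allI)
    show "lin_map G" unfolding G_def by (intro lin_intros)
    show "lin_form (\<lambda>x :: complex^4. x $ 1 + (\<alpha> * x $ 2 + \<beta> * x $ 3 + \<gamma> * x $ 4))" by (intro lin_intros)
    show "vec4 1 0 0 0 $ 1 + (\<alpha> * vec4 1 0 0 0 $ 2 + \<beta> * vec4 1 0 0 0 $ 3 + \<gamma> * vec4 1 0 0 0 $ 4) \<noteq> 0" by simp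
    show "G (F x) = (x $ 1 + (\<alpha> * x $ 2 + \<beta> * x $ 3 + \<gamma> * x $ 4)) *s x" for x
    proof -
      have "n 1 (x$2) (x$3) (x$4) = \<epsilon> * \<kappa> (x$2) (x$3) (x$4) - (\<mu> (x$2) (x$3) (x$4))\<^sup>2" using n1[of x] by simp
      then show ?thesis unfolding vec_eq_iff_4 G_def
        by (simp add: Fn n2 n3 n4 q2 \<mu>_def \<kappa>_def power2_eq_square algebra_simps)
    qed
  qed
qed

text \<open>The coefficient of x1 gives x n3 + y n2 = 0, so n2 = x \<mu> and n3 = - y \<mu> with a
  common linear form \<mu>. Up to sign the components other than the fourth are then the products of
  x1 + \<mu>, x3 with x1 - \<mu>, x2. These four forms are independent exactly when \<mu> involves
  x4, whence the case distinction.\<close>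

lemma linear_inverse_or_line_two_points_rank_four:
  assumes "admissible F"
    and e: "\<And>x. polar F (vec4 1 0 0 0) x = vec5 (x $ 1) (x $ 2 / 2) (x $ 3 / 2) (x $ 4 / 2) 0"
    and Q: "\<And>x. F x $ 1 * F x $ 5 + F x $ 2 * F x $ 3 = 0"
  shows "linear_inverse F \<or> equiv_line_two_points F"
proof -
  interpret admissible F by fact
  obtain n22 n23 n24 n33 n34 n44 where F: "\<And>x. F x = vec5 ((x $ 1)\<^sup>2) (x $ 1 * x $ 2) (x $ 1 * x $ 3) (x $ 1 * x $ 4) 0 +
    ((x$2)\<^sup>2 *s n22 + (x$2 * x$3) *s n23 + (x$2 * x$4) *s n24 + (x$3)\<^sup>2 *s n33 + (x$3 * x$4) *s n34 + (x$4)\<^sup>2 *s n44)"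
    using normal_form_expand[OF quad e] by blast
  define n where "n = (\<lambda>k x y z. x\<^sup>2 * n22 $ k + (x * y) * n23 $ k + (x * z) * n24 $ k +
    y\<^sup>2 * n33 $ k + (y * z) * n34 $ k + z\<^sup>2 * n44 $ k)"
  have Fn: "F x $ 1 = (x $ 1)\<^sup>2 + n 1 (x$2) (x$3) (x$4)" "F x $ 2 = x $ 1 * x $ 2 + n 2 (x$2) (x$3) (x$4)"
    "F x $ 3 = x $ 1 * x $ 3 + n 3 (x$2) (x$3) (x$4)" "F x $ 5 = n 5 (x$2) (x$3) (x$4)" for x
    by (simp_all add: F n_def)
  have q: "(t\<^sup>2 + n 1 x y z) * n 5 x y z + (t * x + n 2 x y z) * (t * y + n 3 x y z) = 0" for t x y z
    using Q[of "vec4 t x y z"] by (simp add: Fn)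
  have "(n 1 x y z * n 5 x y z + n 2 x y z * n 3 x y z) +
      (x * n 3 x y z + y * n 2 x y z) * t + (n 5 x y z + x * y) * t\<^sup>2 = 0" for t x y z
    using q[of t x y z] by (simp add: power2_eq_square algebra_simps)
  from quadratic_coeffs_0[OF this]
  have q0: "n 1 x y z * n 5 x y z + n 2 x y z * n 3 x y z = 0"
    and q1: "x * n 3 x y z + y * n 2 x y z = 0"
    and q2: "n 5 x y z = - (x * y)" for x y z
    by (simp_all add: eq_neg_iff_add_eq_0)
  \<comment> \<open>Setting x = 0 shows that n2 vanishes there, so its monomials without x drop out;
    y = 0 does the same for n3.\<close>
  have c1: "n33$2 = 0" "n44$2 = 0" "n34$2 = 0"
    using q1[of 0 1 0] q1[of 0 1 1] q1[of 0 1 "-1"] unfolding n_def by simp_all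
  have c2: "n22$3 = 0" "n44$3 = 0" "n24$3 = 0"
    using q1[of 1 0 0] q1[of 1 0 1] q1[of 1 0 "-1"] unfolding n_def by simp_all
  define l2 l3 l4 where "l2 = n22$2" and "l3 = n23$2" and "l4 = n24$2"
  have c3: "n23$3 = - l2" "n33$3 = - l3" "n34$3 = - l4"
    using q1[of 1 1 0] q1[of 1 "-1" 0] q1[of 1 1 1] unfolding n_def l2_def l3_def l4_def
    by (simp_all add: c1 c2) algebra+
  define \<mu> where "\<mu> = (\<lambda>x y z. l2 * x + l3 * y + l4 * z)"
  have n2: "n 2 x y z = x * \<mu> x y z" and n3: "n 3 x y z = - (y * \<mu> x y z)" for x y z
    by (simp_all add: n_def \<mu>_def c1 c2 c3 l2_def[symmetric] l3_def[symmetric] l4_def[symmetric]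
        power2_eq_square algebra_simps)
  have n1: "n 1 (x$2) (x$3) (x$4) + (\<mu> (x$2) (x$3) (x$4))\<^sup>2 = 0" for x :: "complex^4"
  proof (rule line_poly_eq_0[where z = "vec4 0 1 1 0" and k = "\<lambda>x. x$2 * x$3"])
    show "x$2 * x$3 * (n 1 (x$2) (x$3) (x$4) + (\<mu> (x$2) (x$3) (x$4))\<^sup>2) = 0" for x :: "complex^4"
      using q0[of "x$2" "x$3" "x$4"] unfolding q2 n2 n3 by algebra
    show "line_poly (\<lambda>x :: complex^4. n 1 (x$2) (x$3) (x$4) + (\<mu> (x$2) (x$3) (x$4))\<^sup>2)"
      unfolding n_def \<mu>_def by (intro line_poly_intros)
    show "line_poly (\<lambda>x :: complex^4. x$2 * x$3)" by (intro line_poly_intros)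
  qed simp
  have FF: "F x $ 1 = (x $ 1 + \<mu> (x$2) (x$3) (x$4)) * (x $ 1 - \<mu> (x$2) (x$3) (x$4))"
    "F x $ 2 = (x $ 1 + \<mu> (x$2) (x$3) (x$4)) * x $ 2"
    "F x $ 3 = (x $ 1 - \<mu> (x$2) (x$3) (x$4)) * x $ 3" "F x $ 5 = - (x $ 2 * x $ 3)" for x
    using n1[of x] by (simp_all add: Fn n2 n3 q2 power2_eq_square algebra_simps)
  show ?thesis
  proof (cases "l4 = 0")
    case True
    \<comment> \<open>With z for the new first coordinate, the dependent forms are z + 2 l3 x3 and z
      - 2 l2 x2. Their deviations from z contribute only multiples of z x2, z x3 and x2 x3, which
      \<open>T\<close> removes.\<close>
    define N where "N = (\<lambda>x :: complex^4. vec4 (x $ 1 + l2 * x $ 2 - l3 * x $ 3) (x $ 2) (x $ 3) (x $ 4))"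
    define T where "T = (\<lambda>y :: complex^5. vec5
      (y $ 1 + (2 * l2) * y $ 2 - (2 * l3) * y $ 3 + (4 * l2 * l3) * y $ 5)
      (y $ 2 + (2 * l3) * y $ 5) (y $ 3 - (2 * l2) * y $ 5) (y $ 4) (- (y $ 5)))"
    have N: "lin_iso N"
      by (rule lin_iso_injI, unfold N_def, intro lin_intros) (auto simp: vec_eq_iff_4)
    have T: "lin_iso T"
      by (rule lin_iso_injI, unfold T_def, intro lin_intros) (auto simp: vec_eq_iff_5)
    have TF: "T (F x) $ 1 = (N x $ 1)\<^sup>2" "T (F x) $ 2 = N x $ 1 * N x $ 2" "T (F x) $ 3 = N x $ 1 * N x $ 3"
      "T (F x) $ 5 = N x $ 2 * N x $ 3" for x
      by (simp_all add: T_def N_def FF \<mu>_def True power2_eq_square algebra_simps)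
    have "linear_inverse (\<lambda>x. T (F (inv N x)))"
      by (rule linear_inverse_of_vertex[OF admissible_transform[OF assms(1) lin_iso_inv[OF N] T]])
         (simp_all add: TF lin_isoD[OF N])
    from linear_inverse_transform[OF this lin_iso_inv[OF N] T] show ?thesis ..
  next
    case False
    define N where "N = (\<lambda>x :: complex^4. vec4 (x $ 1 + (l2 * x $ 2 + l3 * x $ 3 + l4 * x $ 4)) (x $ 3)
      (x $ 1 - (l2 * x $ 2 + l3 * x $ 3 + l4 * x $ 4)) (x $ 2))"
    define T where "T = (\<lambda>y :: complex^5. vec5 (y $ 1) (y $ 2) (y $ 3) (y $ 4) (- (y $ 5)))"
    have N: "lin_iso N"
      by (rule lin_iso_injI, unfold N_def, intro lin_intros) (use False in \<open>auto simp: vec_eq_iff_4\<close>)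
    have T: "lin_iso T"
      by (rule lin_iso_injI, unfold T_def, intro lin_intros) (auto simp: vec_eq_iff_5)
    have TF: "T (F x) $ 1 = N x $ 1 * N x $ 3" "T (F x) $ 2 = N x $ 1 * N x $ 4" "T (F x) $ 3 = N x $ 2 * N x $ 3"
      "T (F x) $ 5 = N x $ 2 * N x $ 4" for x
      by (simp_all add: T_def N_def FF \<mu>_def algebra_simps)
    have "equiv_line_two_points (\<lambda>x. T (F (inv N x)))"
      by (rule equiv_line_two_points_of_skew_lines[OF admissible_transform[OF assms(1) lin_iso_inv[OF N] T]])
         (simp_all add: TF lin_isoD[OF N])
    from equiv_line_two_points_transform[OF this lin_iso_inv[OF N] T] show ?thesis ..
  qed
qed

text \<open>Comparing powers of x1 gives n5 = - x2^2 and x2 n2 = 0. Hence n2 vanishes, then n1, and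
  the components one, two and five take the shape already excluded.\<close>

lemma no_rank_three_normal_form:
  assumes "admissible F"
    and e: "\<And>x. polar F (vec4 1 0 0 0) x = vec5 (x $ 1) (x $ 2 / 2) (x $ 3 / 2) (x $ 4 / 2) 0"
    and Q: "\<And>x. F x $ 1 * F x $ 5 + (F x $ 2)\<^sup>2 = 0"
  shows False
proof -
  interpret admissible F by fact
  obtain n22 n23 n24 n33 n34 n44 where F: "\<And>x. F x = vec5 ((x $ 1)\<^sup>2) (x $ 1 * x $ 2) (x $ 1 * x $ 3) (x $ 1 * x $ 4) 0 +
    ((x$2)\<^sup>2 *s n22 + (x$2 * x$3) *s n23 + (x$2 * x$4) *s n24 + (x$3)\<^sup>2 *s n33 + (x$3 * x$4) *s n34 + (x$4)\<^sup>2 *s n44)"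
    using normal_form_expand[OF quad e] by blast
  define n where "n = (\<lambda>k x y z. x\<^sup>2 * n22 $ k + (x * y) * n23 $ k + (x * z) * n24 $ k +
    y\<^sup>2 * n33 $ k + (y * z) * n34 $ k + z\<^sup>2 * n44 $ k)"
  have Fn: "F x $ 1 = (x $ 1)\<^sup>2 + n 1 (x$2) (x$3) (x$4)" "F x $ 2 = x $ 1 * x $ 2 + n 2 (x$2) (x$3) (x$4)"
    "F x $ 5 = n 5 (x$2) (x$3) (x$4)" for x
    by (simp_all add: F n_def)
  have q: "(t\<^sup>2 + n 1 x y z) * n 5 x y z + (t * x + n 2 x y z)\<^sup>2 = 0" for t x y z
    using Q[of "vec4 t x y z"] by (simp add: Fn)
  have "(n 1 x y z * n 5 x y z + (n 2 x y z)\<^sup>2) + (2 * (x * n 2 x y z)) * t + (n 5 x y z + x\<^sup>2) * t\<^sup>2 = 0" for t x y z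
    using q[of t x y z] by (simp add: power2_eq_square algebra_simps)
  from quadratic_coeffs_0[OF this]
  have q0: "n 1 x y z * n 5 x y z + (n 2 x y z)\<^sup>2 = 0"
    and q1: "x * n 2 x y z = 0"
    and q2: "n 5 x y z = - x\<^sup>2" for x y z
    by (simp_all add: eq_neg_iff_add_eq_0)
  have l: "line_poly (\<lambda>x :: complex^4. n k (x$2) (x$3) (x$4))" "line_poly (\<lambda>x :: complex^4. (x $ 2)\<^sup>2)" for k
    unfolding n_def by (intro line_poly_intros)+
  have n2: "n 2 (x$2) (x$3) (x$4) = 0" for x :: "complex^4"
  proof (rule line_poly_eq_0[OF l, of "vec4 0 1 0 0"])
    show "(x$2)\<^sup>2 * n 2 (x$2) (x$3) (x$4) = 0" for x :: "complex^4"
      using q1[of "x$2" "x$3" "x$4"] by auto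
  qed simp
  have n1: "n 1 (x$2) (x$3) (x$4) = 0" for x :: "complex^4"
  proof (rule line_poly_eq_0[OF l, of "vec4 0 1 0 0"])
    show "(x$2)\<^sup>2 * n 1 (x$2) (x$3) (x$4) = 0" for x :: "complex^4"
      using q0[of "x$2" "x$3" "x$4"] by (auto simp: q2 n2)
  qed simp
  define T where "T = (\<lambda>y :: complex^5. vec5 (y $ 1) (y $ 2) (y $ 3) (y $ 4) (- (y $ 5)))"
  have T: "lin_iso T"
    by (rule lin_iso_injI, unfold T_def, intro lin_intros) (auto simp: vec_eq_iff_5)
  show False
    by (rule no_rank_three[OF admissible_transform[OF assms(1) lin_iso_id T]])
       (simp_all add: T_def Fn n1 n2 q2)
qed


section \<open>Reduction of the quadric to a sum of squares\<close>

definition sym_bilin :: "(complex^'n::finite \<Rightarrow> complex^'n \<Rightarrow> complex) \<Rightarrow> bool" where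
  "sym_bilin b \<longleftrightarrow> (\<forall>y. lin_form (b y)) \<and> (\<forall>y z. b y z = b z y)"

lemma sym_bilinD:
  assumes "sym_bilin b"
  shows "b y z = b z y" "b y (u + v) = b y u + b y v" "b (u + v) y = b u y + b v y"
    "b y (c *s u) = c * b y u" "b (c *s u) y = c * b u y" "b y 0 = 0" "b 0 y = 0"
    "lin_form (b y)" "b y (u - v) = b y u - b y v" "b (u - v) y = b u y - b v y"
  using assms lin_formD[of "b y"] unfolding sym_bilin_def by metis+

lemma sym_bilin_diff_product:
  assumes "sym_bilin b" "lin_form l" "lin_form m"
  shows "sym_bilin (\<lambda>u v. b u v - c * (l u * m v + l v * m u))"
  unfolding sym_bilin_def
proof (intro conjI allI)
  show "lin_form (\<lambda>v. b u v - c * (l u * m v + l v * m u))" for u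
    using sym_bilinD(2,4)[OF assms(1)] lin_formD[OF assms(2)] lin_formD[OF assms(3)]
    by (simp add: lin_form_iff algebra_simps)
  show "b u v - c * (l u * m v + l v * m u) = b v u - c * (l v * m u + l u * m v)" for u v
    using sym_bilinD(1)[OF assms(1)] by (simp add: algebra_simps)
qed

lemma sym_bilin_polarize:
  assumes "sym_bilin b" "\<And>y. b y y = 0"
  shows "b y z = 0"
proof -
  have "b (y + z) (y + z) = b y y + 2 * b y z + b z z"
    using sym_bilinD(1)[OF assms(1), of z y] by (simp add: sym_bilinD(2,3)[OF assms(1)])
  then show ?thesis by (simp add: assms(2))
qed

lemma lin_form_separating:
  fixes y :: "complex^'n::finite"
  assumes "y \<notin> vec.span Y"
  obtains l where "lin_form l" "l y = 1" "\<And>d. d \<in> vec.span Y \<Longrightarrow> l d = 0"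
proof -
  obtain B where B: "B \<subseteq> Y" "vec.independent B" "Y \<subseteq> vec.span B"
    using vec.maximal_independent_subset by blast
  have span: "vec.span B = vec.span Y"
    using B by (metis vec.span_mono vec.span_minimal vec.subspace_span subset_antisym)
  then have ind: "vec.independent (insert y B)"
    using assms B(2) vec.independent_insertI by metis
  define C where "C = vec.extend_basis (insert y B)"
  have C: "vec.independent C" "vec.span C = UNIV" "insert y B \<subseteq> C"
    unfolding C_def using ind vec.extend_basis_superset vec.independent_extend_basis vec.span_extend_basis by blast+
  define l where "l v = vec.representation C v y" for v
  have l: "lin_form l"
    unfolding l_def using C by (simp add: lin_form_iff vec.representation_add vec.representation_scale)
  have "l y = 1" unfolding l_def using C by (simp add: vec.representation_basis)
  moreover have "l d = 0" if "d \<in> vec.span Y" for d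
    using that unfolding span[symmetric]
  proof (induction rule: vec.span_induct_alt)
    case base
    show ?case by (rule lin_formD(4)[OF l])
  next
    case (step c x z)
    have "y \<noteq> x" using step(1) assms span vec.span_base by blast
    then have "l x = 0" unfolding l_def using C step(1) by (simp add: vec.representation_basis subset_iff)
    then show ?case using step by (simp add: lin_formD[OF l])
  qed
  ultimately show ?thesis using that l by blast
qed

text \<open>A nonzero form takes the value 1 at some \<open>y\<close>, and \<open>b y\<close> splits
  off as a square; for the zero form any new coordinate is taken with weight 0. Both branches extend
  the known part of the radical by one dimension, so the number of iterations does not depend on the
  rank.\<close>

lemma square_reduction_step:
  fixes b :: "complex^'n::finite \<Rightarrow> complex^'n \<Rightarrow> complex"
  assumes b: "sym_bilin b" and "vec.span Y \<noteq> UNIV" and rad: "\<And>d z. d \<in> vec.span Y \<Longrightarrow> b d z = 0"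
  obtains y l e where "y \<notin> vec.span Y" "lin_form l" "l y = 1" "\<And>d. d \<in> vec.span Y \<Longrightarrow> l d = 0"
    "e = (if b = (\<lambda>u v. 0) then 0 else 1)" "sym_bilin (\<lambda>u v. b u v - e * (l u * l v))"
    "\<And>d z. d \<in> vec.span (insert y Y) \<Longrightarrow> b d z - e * (l d * l z) = 0"
proof (cases "b = (\<lambda>u v. 0)")
  case True
  obtain y where y: "y \<notin> vec.span Y" using assms(2) by blast
  obtain l where "lin_form l" "l y = 1" "\<And>d. d \<in> vec.span Y \<Longrightarrow> l d = 0"
    using lin_form_separating[OF y] by blast
  then show ?thesis using that[of y l 0] y b True by simp
next
  case False
  then obtain y0 where "b y0 y0 \<noteq> 0" using sym_bilin_polarize[OF b] by blast
  moreover obtain s where "s\<^sup>2 = b y0 y0" using complex_sqrt by blast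
  ultimately have "s \<noteq> 0" "b ((1/s) *s y0) ((1/s) *s y0) = 1"
    by (auto simp: sym_bilinD[OF b] power2_eq_square)
  then obtain y where y: "b y y = 1" by blast
  have b': "sym_bilin (\<lambda>u v. b u v - 1 * (b y u * b y v))"
    using sym_bilin_diff_product[OF b sym_bilinD(8)[OF b] sym_bilinD(8)[OF b], of "1/2" y y]
    by (simp add: algebra_simps)
  show ?thesis
  proof (rule that[of y "b y" 1])
    show "y \<notin> vec.span Y" using rad y by force
    show "b y d = 0" if "d \<in> vec.span Y" for d using rad that sym_bilinD(1)[OF b] by metis
    fix d z assume "d \<in> vec.span (insert y Y)"
    then obtain k where k: "d - k *s y \<in> vec.span Y" using vec.span_breakdown_eq by blast
    have "d = (d - k *s y) + k *s y" by simp
    then have *: "b d z = k * b y z" for z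
      using rad[OF k, of z] by (metis sym_bilinD(3,5)[OF b] add_0)
    then have "b y d = k" using y sym_bilinD(1)[OF b, of y d] by simp
    then show "b d z - 1 * (b y d * b y z) = 0" using * by simp
  qed (use y b' False in \<open>simp_all add: sym_bilinD(8)[OF b]\<close>)
qed

text \<open>The isotropic vector \<open>y0\<close> is outside the radical, so some \<open>w\<close>
  spans a hyperbolic plane with it. Splitting off this plane leaves three diagonalisation steps.
  Once a remainder is zero all later ones are, so the weights 1 precede the weights 0.\<close>

lemma quadric_coordinates:
  fixes b :: "complex^5 \<Rightarrow> complex^5 \<Rightarrow> complex"
  assumes b: "sym_bilin b" and y0: "b y0 y0 = 0" "b y0 z0 \<noteq> 0"
  obtains \<alpha> l2 l3 l4 e2 e3 e4 where
    "lin_iso (\<lambda>y. vec5 (\<alpha> y) (l2 y) (l3 y) (l4 y) (2 * b y0 y))"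
    "lin_form \<alpha>" "lin_form l2" "lin_form l3" "lin_form l4"
    "\<alpha> y0 = 1" "l2 y0 = 0" "l3 y0 = 0" "l4 y0 = 0"
    "\<And>y z. b y z = (\<alpha> y * (2 * b y0 z) + \<alpha> z * (2 * b y0 y)) / 2 +
       e2 * (l2 y * l2 z) + e3 * (l3 y * l3 z) + e4 * (l4 y * l4 z)"
    "e2 = 1 \<and> e3 = 1 \<and> e4 = 1 \<or> e2 = 1 \<and> e3 = 1 \<and> e4 = 0 \<or> e2 = 1 \<and> e3 = 0 \<and> e4 = 0 \<or>
     e2 = (0 :: complex) \<and> e3 = (0 :: complex) \<and> e4 = (0 :: complex)"
proof -
  note B = sym_bilinD[OF b]
  define w0 where "w0 = (1 / (2 * b y0 z0)) *s z0"
  have w0: "b y0 w0 = 1/2" using y0 by (simp add: w0_def B)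
  \<comment> \<open>Since b y0 w0 = 1/2, subtracting exactly this multiple of \<open>y0\<close>
    makes \<open>w\<close> isotropic.\<close>
  define w where "w = w0 - b w0 w0 *s y0"
  have w: "b y0 w = 1/2" "b w w = 0" "b w y0 = 1/2"
    using w0 y0 by (simp_all add: w_def B) (auto simp: B(1)[of w0 y0] algebra_simps)
  define \<alpha> where "\<alpha> = (\<lambda>z. 2 * b w z)"
  define \<beta> where "\<beta> = (\<lambda>z. 2 * b y0 z)"
  have lin: "lin_form \<alpha>" "lin_form \<beta>" unfolding \<alpha>_def \<beta>_def by (intro lin_form_cmult B(8))+
  have ab: "\<alpha> y0 = 1" "\<alpha> w = 0" "\<beta> y0 = 0" "\<beta> w = 1" using w y0 by (simp_all add: \<alpha>_def \<beta>_def mult.commute)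
  define b1 where "b1 = (\<lambda>u v. b u v - (1/2) * (\<alpha> u * \<beta> v + \<alpha> v * \<beta> u))"
  have b1: "sym_bilin b1" unfolding b1_def by (rule sym_bilin_diff_product[OF b lin])
  have rad1: "b1 d z = 0" if "d \<in> vec.span {y0, w}" for d z
    using that
  proof (induction rule: vec.span_induct_alt)
    case base
    show ?case by (rule sym_bilinD(7)[OF b1])
  next
    case (step c x d)
    have "b1 y0 z = 0" "b1 w z = 0" unfolding b1_def using ab by (simp_all add: \<alpha>_def \<beta>_def)
    then have "b1 x z = 0" using step by blast
    then show ?case using step by (simp add: sym_bilinD[OF b1])
  qed
  have "w \<notin> vec.span {y0}"
    using w y0 by (auto simp: vec.span_singleton B)
  moreover have "y0 \<noteq> 0" using w by (auto simp: B)
  ultimately have d2: "vec.dim {y0, w} = 2"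
    by (simp add: insert_commute[of y0] vec.dim_insert)
  have full: "vec.span Y = UNIV \<longleftrightarrow> vec.dim Y = 5" for Y :: "(complex^5) set"
    using vec.dim_eq_full[of Y] by (auto simp: vec.dimension_def card_cart_basis)
  obtain y2 l2 e2 where 2: "y2 \<notin> vec.span {y0, w}" "lin_form l2" "l2 y2 = 1"
    "\<And>d. d \<in> vec.span {y0, w} \<Longrightarrow> l2 d = 0"
    "e2 = (if b1 = (\<lambda>u v. 0) then 0 else 1)" "sym_bilin (\<lambda>u v. b1 u v - e2 * (l2 u * l2 v))"
    "\<And>d z. d \<in> vec.span {y2, y0, w} \<Longrightarrow> b1 d z - e2 * (l2 d * l2 z) = 0"
    by (rule square_reduction_step[OF b1 _ rad1]) (auto simp: full d2)
  define b2 where "b2 = (\<lambda>u v. b1 u v - e2 * (l2 u * l2 v))"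
  have d3: "vec.dim {y2, y0, w} = 3" using 2(1) d2 by (simp add: vec.dim_insert)
  obtain y3 l3 e3 where 3: "y3 \<notin> vec.span {y2, y0, w}" "lin_form l3" "l3 y3 = 1"
    "\<And>d. d \<in> vec.span {y2, y0, w} \<Longrightarrow> l3 d = 0"
    "e3 = (if b2 = (\<lambda>u v. 0) then 0 else 1)" "sym_bilin (\<lambda>u v. b2 u v - e3 * (l3 u * l3 v))"
    "\<And>d z. d \<in> vec.span {y3, y2, y0, w} \<Longrightarrow> b2 d z - e3 * (l3 d * l3 z) = 0"
    by (rule square_reduction_step[of b2 "{y2, y0, w}"]) (use 2(6,7) in \<open>auto simp: full d3 b2_def\<close>)
  define b3 where "b3 = (\<lambda>u v. b2 u v - e3 * (l3 u * l3 v))"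
  have d4: "vec.dim {y3, y2, y0, w} = 4" using 3(1) d3 by (simp add: vec.dim_insert)
  obtain y4 l4 e4 where 4: "y4 \<notin> vec.span {y3, y2, y0, w}" "lin_form l4" "l4 y4 = 1"
    "\<And>d. d \<in> vec.span {y3, y2, y0, w} \<Longrightarrow> l4 d = 0"
    "e4 = (if b3 = (\<lambda>u v. 0) then 0 else 1)" "sym_bilin (\<lambda>u v. b3 u v - e4 * (l4 u * l4 v))"
    "\<And>d z. d \<in> vec.span {y4, y3, y2, y0, w} \<Longrightarrow> b3 d z - e4 * (l4 d * l4 z) = 0"
    by (rule square_reduction_step[of b3 "{y3, y2, y0, w}"]) (use 3(6,7) in \<open>auto simp: full d4 b3_def\<close>)
  have d5: "vec.span {y4, y3, y2, y0, w} = UNIV" using 4(1) d4 unfolding full by (simp add: vec.dim_insert)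
  have bb: "b y z = (\<alpha> y * \<beta> z + \<alpha> z * \<beta> y) / 2 + e2 * (l2 y * l2 z) + e3 * (l3 y * l3 z) + e4 * (l4 y * l4 z)"
    for y z
    using 4(7)[of y z] unfolding d5 by (simp add: b3_def b2_def b1_def diff_eq_eq add_ac)
  show ?thesis
  proof (rule that[of \<alpha> l2 l3 l4 e2 e3 e4])
    show "l2 y0 = 0" "l3 y0 = 0" "l4 y0 = 0"
      using 2(4) 3(4) 4(4) by (auto intro: vec.span_base)
    show "lin_iso (\<lambda>y. vec5 (\<alpha> y) (l2 y) (l3 y) (l4 y) (2 * b y0 y))"
    proof (rule lin_iso_injI)
      show "lin_map (\<lambda>y. vec5 (\<alpha> y) (l2 y) (l3 y) (l4 y) (2 * b y0 y))"
        by (intro lin_intros lin(1) 2(2) 3(2) 4(2) B(8))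
      fix y assume "vec5 (\<alpha> y) (l2 y) (l3 y) (l4 y) (2 * b y0 y) = 0"
      then have z: "\<alpha> y = 0" "l2 y = 0" "l3 y = 0" "l4 y = 0" "\<beta> y = 0"
        by (simp_all add: vec_eq_iff_5 \<beta>_def)
      \<comment> \<open>Each l_i is 1 at y_i and 0 on the vectors listed after it, so the
        coefficients of \<open>y\<close> are stripped off one at a time.\<close>
      have "y \<in> vec.span {y4, y3, y2, y0, w}" by (simp add: d5)
      then obtain k where "y - k *s y4 \<in> vec.span {y3, y2, y0, w}" using vec.span_breakdown_eq by blast
      then have "l4 (y - k *s y4) = 0" and *: "y - k *s y4 \<in> vec.span {y3, y2, y0, w}" using 4(4) by blast+
      then have "k = 0" using z 4(3) by (simp add: lin_formD[OF 4(2)])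
      then have "y \<in> vec.span {y3, y2, y0, w}" using * by simp
      then obtain k where "y - k *s y3 \<in> vec.span {y2, y0, w}" using vec.span_breakdown_eq by blast
      then have "l3 (y - k *s y3) = 0" and *: "y - k *s y3 \<in> vec.span {y2, y0, w}" using 3(4) by blast+
      then have "k = 0" using z 3(3) by (simp add: lin_formD[OF 3(2)])
      then have "y \<in> vec.span {y2, y0, w}" using * by simp
      then obtain k where "y - k *s y2 \<in> vec.span {y0, w}" using vec.span_breakdown_eq by blast
      then have "l2 (y - k *s y2) = 0" and *: "y - k *s y2 \<in> vec.span {y0, w}" using 2(4) by blast+
      then have "k = 0" using z 2(3) by (simp add: lin_formD[OF 2(2)])
      then have "y \<in> vec.span {y0, w}" using * by simp
      then obtain k where "y - k *s y0 \<in> vec.span {w}" using vec.span_breakdown_eq by blast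
      then obtain m where m: "y - k *s y0 = m *s w" by (auto simp: vec.span_singleton)
      then have "\<alpha> (y - k *s y0) = m * \<alpha> w" "\<beta> (y - k *s y0) = m * \<beta> w"
        by (simp_all add: lin_formD[OF lin(1)] lin_formD[OF lin(2)])
      then have "k = 0" "m = 0" using z ab by (simp_all add: lin_formD[OF lin(1)] lin_formD[OF lin(2)])
      then show "y = 0" using m by simp
    qed
    show "b y z = (\<alpha> y * (2 * b y0 z) + \<alpha> z * (2 * b y0 y)) / 2 +
       e2 * (l2 y * l2 z) + e3 * (l3 y * l3 z) + e4 * (l4 y * l4 z)" for y z
      using bb[of y z] by (simp add: \<beta>_def)
    show "e2 = 1 \<and> e3 = 1 \<and> e4 = 1 \<or> e2 = 1 \<and> e3 = 1 \<and> e4 = 0 \<or> e2 = 1 \<and> e3 = 0 \<and> e4 = 0 \<or>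
     e2 = 0 \<and> e3 = 0 \<and> e4 = 0"
      unfolding 2(5) 3(5) 4(5) by (auto simp: b3_def b2_def 2(5) 3(5))
  qed (fact lin ab(1) 2(2) 3(2) 4(2))+
qed

text \<open>A vector killed by the differential is k \<open>x0\<close> with k F(x0) = 0, hence zero;
  and the image lies in y5 = 0, so four components determine the vector. The factors 2 in
  \<open>N\<close> give the mixed monomials x1 x_j coefficient one.\<close>

lemma normal_coordinates:
  assumes "admissible F" and x0: "F x0 \<noteq> 0" "\<And>v. polar F x0 v = 0 \<Longrightarrow> \<exists>k. v = k *s x0"
    and T: "lin_iso T" "T (F x0) = vec5 1 0 0 0 0" "\<And>v. T (polar F x0 v) $ 5 = 0"
  obtains S where "lin_iso S"
    "\<And>x. polar (\<lambda>x. T (F (S x))) (vec4 1 0 0 0) x = vec5 (x $ 1) (x $ 2 / 2) (x $ 3 / 2) (x $ 4 / 2) 0"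
proof -
  interpret admissible F by fact
  define P where "P = (\<lambda>v. T (polar F x0 v))"
  have P: "lin_map P" unfolding P_def by (rule lin_map_comp[OF lin_isoD(1)[OF T(1)] polar_linear2[OF quad]])
  then have Pn: "lin_form (\<lambda>v. P v $ i)" for i by (simp add: lin_map_iff_nth)
  define N where "N = (\<lambda>v. vec4 (P v $ 1) (2 * P v $ 2) (2 * P v $ 3) (2 * P v $ 4))"
  have N: "lin_iso N"
  proof (rule lin_iso_injI)
    show "lin_map N" unfolding N_def by (intro lin_intros Pn)
    fix v assume "N v = 0"
    then have "P v = 0" using T(3)[of v] by (simp add: N_def vec_eq_iff_4 vec_eq_iff_5) (simp add: P_def)
    then have *: "polar F x0 v = 0" unfolding P_def using lin_isoD(4)[OF T(1)] by blast
    then obtain k where k: "v = k *s x0" using x0(2) by blast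
    then have "k *s F x0 = 0" using * by (simp add: polar_simps[OF quad] polar_self[OF quad])
    then show "v = 0" using k x0(1) by simp
  qed
  have N0: "N x0 = vec4 1 0 0 0"
    using T(2) by (simp add: N_def P_def polar_self[OF quad])
  show ?thesis
  proof (rule that[OF lin_iso_inv[OF N]])
    fix x
    define u where "u = inv N x"
    have "inv N (vec4 1 0 0 0) = x0" using N0 lin_isoD(3)[OF N] by metis
    then have "polar (\<lambda>x. T (F (inv N x))) (vec4 1 0 0 0) x = P u"
      unfolding quad_map_compose(2)[OF quad lin_isoD(1)[OF lin_iso_inv[OF N]] lin_isoD(1)[OF T(1)]] P_def u_def
      by simp
    also have "N u = x" by (simp add: u_def lin_isoD(2)[OF N])
    then have "P u = vec5 (x $ 1) (x $ 2 / 2) (x $ 3 / 2) (x $ 4 / 2) 0"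
      using T(3)[of u] by (auto simp: N_def vec_eq_iff_5 P_def)
    finally show "polar (\<lambda>x. T (F (inv N x))) (vec4 1 0 0 0) x = vec5 (x $ 1) (x $ 2 / 2) (x $ 3 / 2) (x $ 4 / 2) 0" .
  qed
qed

lemma line_poly_lin_form_quad_map:
  assumes "lin_form c" "quad_map F"
  shows "line_poly (\<lambda>x. c (F x))"
proof -
  have "line_poly (\<lambda>x. \<Sum>i\<in>UNIV. c (axis i 1) * F x $ i)"
    by (intro line_poly_sum line_poly_mult line_poly_const line_poly_quad_map_nth assms)
  then show ?thesis by (simp flip: lin_form_expand[OF assms(1)])
qed

lemma admissible_classification:
  fixes b :: "complex^5 \<Rightarrow> complex^5 \<Rightarrow> complex"
  assumes "admissible F" and b: "sym_bilin b" and bF: "\<And>x. b (F x) (F x) = 0"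
    and irr: "\<And>l m. lin_form l \<Longrightarrow> lin_form m \<Longrightarrow> (\<And>y. b y y = l y * m y) \<Longrightarrow> False"
  shows "linear_inverse F \<or> equiv_line_two_points F \<and>
    (\<exists>v. v \<noteq> 0 \<and> (\<forall>y. (\<forall>z. b y z = 0) \<longleftrightarrow> (\<exists>k. y = k *s v)))"
proof -
  interpret admissible F by fact
  note B = sym_bilinD[OF b]
  obtain f x1 where f: "line_poly f" "f x1 \<noteq> 0"
    "\<And>x. f x \<noteq> 0 \<Longrightarrow> F x \<noteq> 0 \<and> (\<forall>v c. polar F x v = c *s F v \<longrightarrow> (\<exists>k. v = k *s x))"
    using generic by blast
  \<comment> \<open>Otherwise the image lies in the radical of \<open>b\<close>, and by
    \<open>indep\<close> the form would be zero.\<close>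
  have "\<exists>x z. b (F x) z \<noteq> 0"
  proof (rule ccontr)
    assume "\<not> ?thesis"
    then have "b z (F x) = 0" for x z using B(1) by metis
    then have "b z y = 0" for z y using indep[OF B(8)] by blast
    then show False using irr[OF lin_form_0 lin_form_0] by simp
  qed
  then obtain x2 z0 where z0: "b (F x2) z0 \<noteq> 0" by blast
  have lp: "line_poly (\<lambda>x. b (F x) z0)"
    using line_poly_lin_form_quad_map[OF B(8)[of z0] quad] by (simp add: B(1)[of z0])
  obtain x0 where x0: "f x0 \<noteq> 0" "b (F x0) z0 \<noteq> 0"
    using line_poly_common_nonzero[OF f(1) lp f(2) z0] by blast
  \<comment> \<open>The coefficient of t in the equation of the quadric along the image of a line:
    the differential maps into the tangent hyperplane.\<close>
  have tan: "b (F x0) (polar F x0 v) = 0" for v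
  proof -
    have "0 + (4 * b (F x0) (polar F x0 v)) * t +
        (2 * b (F x0) (F v) + 4 * b (polar F x0 v) (polar F x0 v)) * t ^ 2 +
        (4 * b (polar F x0 v) (F v)) * t ^ 3 + 0 * t ^ 4 + 0 * t ^ 5 + 0 * t ^ 6 = 0" for t
      using bF[of "x0 + t *s v"] bF[of x0] bF[of v]
        B(1)[of "polar F x0 v" "F x0"] B(1)[of "F v" "F x0"] B(1)[of "F v" "polar F x0 v"]
      unfolding quad_map_line[OF quad]
      by (simp add: B(2-7) power2_eq_square power3_eq_cube algebra_simps)
    from poly_coeffs_0[OF this] show ?thesis by simp
  qed
  have x0': "\<exists>k. v = k *s x0" if "polar F x0 v = 0" for v
    using f(3)[OF x0(1)] that by (auto dest: spec[of _ v] spec[of _ 0])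
  have Fx0: "F x0 \<noteq> 0" using f(3)[OF x0(1)] by blast
  obtain \<alpha> l2 l3 l4 e2 e3 e4 where co:
    "lin_iso (\<lambda>y. vec5 (\<alpha> y) (l2 y) (l3 y) (l4 y) (2 * b (F x0) y))"
    "lin_form \<alpha>" "lin_form l2" "lin_form l3" "lin_form l4"
    "\<alpha> (F x0) = 1" "l2 (F x0) = 0" "l3 (F x0) = 0" "l4 (F x0) = 0"
    "\<And>y z. b y z = (\<alpha> y * (2 * b (F x0) z) + \<alpha> z * (2 * b (F x0) y)) / 2 +
       e2 * (l2 y * l2 z) + e3 * (l3 y * l3 z) + e4 * (l4 y * l4 z)"
    "e2 = 1 \<and> e3 = 1 \<and> e4 = 1 \<or> e2 = 1 \<and> e3 = 1 \<and> e4 = 0 \<or> e2 = 1 \<and> e3 = 0 \<and> e4 = 0 \<or>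
     e2 = 0 \<and> e3 = 0 \<and> e4 = 0"
    using quadric_coordinates[OF b bF x0(2)] by blast
  define \<beta> where "\<beta> = (\<lambda>y. 2 * b (F x0) y)"
  have \<beta>: "lin_form \<beta>" "\<beta> (F x0) = 0" "\<beta> (polar F x0 v) = 0" for v
    unfolding \<beta>_def using bF tan by (auto intro: lin_form_cmult B(8))
  have inj: "y = 0" if "\<alpha> y = 0" "l2 y = 0" "l3 y = 0" "l4 y = 0" "\<beta> y = 0" for y
  proof -
    have "vec5 (\<alpha> y) (l2 y) (l3 y) (l4 y) (2 * b (F x0) y) = 0"
      using that by (simp add: vec_eq_iff_5 \<beta>_def)
    then show ?thesis using lin_isoD(4)[OF co(1), of y] by simp
  qed
  have bb: "b y z = (\<alpha> y * \<beta> z + \<alpha> z * \<beta> y) / 2 +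
       e2 * (l2 y * l2 z) + e3 * (l3 y * l3 z) + e4 * (l4 y * l4 z)" for y z
    unfolding \<beta>_def by (rule co(10))
  note lin = co(2-5) \<beta>(1)
  have i: "\<i> * (\<i> * z) = - z" for z :: complex by (simp flip: mult.assoc)
  from co(11) show ?thesis
  proof (elim disjE)
    assume e: "e2 = 1 \<and> e3 = 1 \<and> e4 = 1"
    \<comment> \<open>Chosen because (l2 + i l4) (i l4 - l2) = - (l2^2 + l4^2), which matches the
      shape y3^2 - y2 y4.\<close>
    define T where "T = (\<lambda>y. vec5 (\<alpha> y) (l2 y + \<i> * l4 y) (l3 y) (\<i> * l4 y - l2 y) (\<beta> y))"
    have T: "lin_iso T"
    proof (rule lin_iso_injI)
      show "lin_map T" unfolding T_def by (intro lin_intros lin)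
      show "y = 0" if "T y = 0" for y
      proof -
        have "T y $ 2 = 0" "T y $ 4 = 0" using that by simp_all
        then have *: "l2 y + \<i> * l4 y = 0" "\<i> * l4 y - l2 y = 0" by (simp_all only: T_def vec5_nth)
        then have "l2 y = 0" by algebra
        moreover from this * have "l4 y = 0" by simp
        ultimately show ?thesis using inj[of y] that by (simp add: T_def vec_eq_iff_5)
      qed
    qed
    obtain S where S: "lin_iso S"
      "\<And>x. polar (\<lambda>x. T (F (S x))) (vec4 1 0 0 0) x = vec5 (x $ 1) (x $ 2 / 2) (x $ 3 / 2) (x $ 4 / 2) 0"
      by (rule normal_coordinates[OF assms(1) Fx0 x0' T]) (auto simp: T_def co \<beta>)
    have "linear_inverse (\<lambda>x. T (F (S x)))"
    proof (rule linear_inverse_smooth_quadric[OF quad_map_compose(1)[OF quad lin_isoD(1)[OF S(1)] lin_isoD(1)[OF T]] S(2)])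
      show "T (F (S x)) $ 1 * T (F (S x)) $ 5 + (T (F (S x)) $ 3)\<^sup>2 - T (F (S x)) $ 2 * T (F (S x)) $ 4 = 0" for x
        using bF[of "S x"] unfolding bb by (simp add: T_def e power2_eq_square i algebra_simps)
    qed
    then show ?thesis using linear_inverse_transform[OF _ S(1) T] by blast
  next
    assume e: "e2 = 1 \<and> e3 = 1 \<and> e4 = 0"
    define T where "T = (\<lambda>y. vec5 (\<alpha> y) (l2 y + \<i> * l3 y) (l2 y - \<i> * l3 y) (l4 y) (\<beta> y))"
    have z23: "l2 y = 0 \<and> l3 y = 0" if "l2 y + \<i> * l3 y = 0" "l2 y - \<i> * l3 y = 0" for y
    proof -
      have "l2 y = 0" using that by algebra
      then show ?thesis using that by simp
    qed
    have T: "lin_iso T"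
    proof (rule lin_iso_injI)
      show "lin_map T" unfolding T_def by (intro lin_intros lin)
      show "y = 0" if "T y = 0" for y
      proof -
        have "T y $ 2 = 0" "T y $ 3 = 0" using that by simp_all
        then have "l2 y = 0 \<and> l3 y = 0" by (intro z23) (simp_all only: T_def vec5_nth)
        then show ?thesis using inj[of y] that by (simp add: T_def vec_eq_iff_5)
      qed
    qed
    obtain S where S: "lin_iso S"
      "\<And>x. polar (\<lambda>x. T (F (S x))) (vec4 1 0 0 0) x = vec5 (x $ 1) (x $ 2 / 2) (x $ 3 / 2) (x $ 4 / 2) 0"
      by (rule normal_coordinates[OF assms(1) Fx0 x0' T]) (auto simp: T_def co \<beta>)
    have "linear_inverse (\<lambda>x. T (F (S x))) \<or> equiv_line_two_points (\<lambda>x. T (F (S x)))"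
    proof (rule linear_inverse_or_line_two_points_rank_four[OF admissible_transform[OF assms(1) S(1) T] S(2)])
      show "T (F (S x)) $ 1 * T (F (S x)) $ 5 + T (F (S x)) $ 2 * T (F (S x)) $ 3 = 0" for x
        using bF[of "S x"] unfolding bb by (simp add: T_def e power2_eq_square i algebra_simps)
    qed
    then have main: "linear_inverse F \<or> equiv_line_two_points F"
      using linear_inverse_transform[OF _ S(1) T] equiv_line_two_points_transform[OF _ S(1) T] by blast
    \<comment> \<open>The vertex of the cone: all coordinates except \<open>l4\<close> vanish at
      it.\<close>
    define v where "v = inv T (vec5 0 0 0 1 0)"
    have Tv: "T v = vec5 0 0 0 1 0" by (simp add: v_def lin_isoD[OF T])
    have "v \<noteq> 0" using Tv lin_isoD(4)[OF T, of v] by (auto simp: vec_eq_iff_5)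
    have "T v $ 2 = 0" "T v $ 3 = 0" unfolding Tv by simp_all
    then have "l2 v = 0 \<and> l3 v = 0" by (intro z23) (simp_all only: T_def vec5_nth)
    then have vz: "\<alpha> v = 0" "l2 v = 0" "l3 v = 0" "\<beta> v = 0"
      using Tv by (simp_all add: T_def vec_eq_iff_5)
    have "(\<forall>z. b y z = 0) \<longleftrightarrow> (\<exists>k. y = k *s v)" for y
    proof
      assume r: "\<forall>z. b y z = 0"
      have ay: "(\<alpha> y * \<beta> z + \<alpha> z * \<beta> y) / 2 + l2 y * l2 z + l3 y * l3 z = 0" for z
        using spec[OF r, of z] unfolding bb by (simp add: e)
      \<comment> \<open>Vectors with prescribed values of \<alpha>, l2, l3, \<beta>; pairing
        \<open>y\<close> with four of them reads off its coordinates.\<close>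
      define g where "g a c d h = inv T (vec5 a (c + \<i> * d) (c - \<i> * d) 0 h)" for a c d h
      have g: "\<alpha> (g a c d h) = a \<and> l2 (g a c d h) = c \<and> l3 (g a c d h) = d \<and> \<beta> (g a c d h) = h" for a c d h
      proof -
        have "T (g a c d h) = vec5 a (c + \<i> * d) (c - \<i> * d) 0 h" by (simp add: g_def lin_isoD[OF T])
        then have *: "\<alpha> (g a c d h) = a" "\<beta> (g a c d h) = h"
          "l2 (g a c d h) + \<i> * l3 (g a c d h) = c + \<i> * d" "l2 (g a c d h) - \<i> * l3 (g a c d h) = c - \<i> * d"
          by (simp_all add: T_def vec_eq_iff_5)
        from *(3,4) have "l2 (g a c d h) = c" by algebra
        with * show ?thesis by simp
      qed
      have y0: "\<alpha> y = 0" "\<beta> y = 0" "l2 y = 0" "l3 y = 0"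
        using ay[of "g 0 0 0 1"] ay[of "g 1 0 0 0"] ay[of "g 0 1 0 0"] ay[of "g 0 0 1 0"] by (simp_all add: g)
      have "T y = T (l4 y *s v)" unfolding lin_mapD(2)[OF lin_isoD(1)[OF T]] Tv
        by (simp add: T_def y0 vec_eq_iff_5)
      then have "y = l4 y *s v" by (metis lin_isoD(3)[OF T])
      then show "\<exists>k. y = k *s v" by blast
    next
      assume "\<exists>k. y = k *s v"
      then obtain k where "y = k *s v" by blast
      moreover have "b v z = 0" for z unfolding bb by (simp add: e vz)
      ultimately show "\<forall>z. b y z = 0" by (simp add: B)
    qed
    then show ?thesis using main \<open>v \<noteq> 0\<close> by blast
  next
    assume e: "e2 = 1 \<and> e3 = 0 \<and> e4 = 0"
    define T where "T = (\<lambda>y. vec5 (\<alpha> y) (l2 y) (l3 y) (l4 y) (\<beta> y))"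
    have T: "lin_iso T" using co(1) by (simp add: T_def \<beta>_def)
    obtain S where S: "lin_iso S"
      "\<And>x. polar (\<lambda>x. T (F (S x))) (vec4 1 0 0 0) x = vec5 (x $ 1) (x $ 2 / 2) (x $ 3 / 2) (x $ 4 / 2) 0"
      by (rule normal_coordinates[OF assms(1) Fx0 x0' T]) (auto simp: T_def co \<beta>)
    have False
    proof (rule no_rank_three_normal_form[OF admissible_transform[OF assms(1) S(1) T] S(2)])
      show "T (F (S x)) $ 1 * T (F (S x)) $ 5 + (T (F (S x)) $ 2)\<^sup>2 = 0" for x
        using bF[of "S x"] unfolding bb by (simp add: T_def e power2_eq_square algebra_simps)
    qed
    then show ?thesis ..
  next
    assume e: "e2 = 0 \<and> e3 = 0 \<and> e4 = 0"
    have False by (rule irr[OF lin(1) lin(5)]) (simp add: bb e)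
    then show ?thesis ..
  qed
qed


section \<open>Homogeneous polynomials of degree one and two\<close>

lemma degree_2_monomial:
  fixes m :: "'v::finite \<Rightarrow>\<^sub>0 nat"
  assumes "(\<Sum>i\<in>UNIV. Poly_Mapping.lookup m i) = 2"
  obtains a b where "m = Poly_Mapping.single a 1 + Poly_Mapping.single b 1"
proof -
  have split: "\<exists>a m'. m = Poly_Mapping.single a 1 + m' \<and> (\<Sum>i\<in>UNIV. Poly_Mapping.lookup m' i) = d"
    if deg: "(\<Sum>i\<in>UNIV. Poly_Mapping.lookup m i) = Suc d" for d and m :: "'v \<Rightarrow>\<^sub>0 nat"
  proof -
    obtain a where a: "Poly_Mapping.lookup m a \<noteq> 0"
      using deg by (metis Zero_not_Suc sum.neutral)
    have m: "m = Poly_Mapping.single a 1 + (m - Poly_Mapping.single a 1)"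
      using a by (intro poly_mapping_eqI) (auto simp: lookup_add lookup_minus lookup_single when_def)
    have "Suc d = (\<Sum>i\<in>UNIV. Poly_Mapping.lookup (Poly_Mapping.single a 1) i) +
        (\<Sum>i\<in>UNIV. Poly_Mapping.lookup (m - Poly_Mapping.single a 1) i)"
      unfolding deg[symmetric] sum.distrib[symmetric] by (metis lookup_add m)
    also have "(\<Sum>i\<in>UNIV. Poly_Mapping.lookup (Poly_Mapping.single a (1::nat)) i) = 1"
      by (simp add: lookup_single when_def)
    finally show ?thesis using m by (intro exI[of _ a] exI[of _ "m - Poly_Mapping.single a 1"]) simp
  qed
  obtain a m' where 1: "m = Poly_Mapping.single a 1 + m'" "(\<Sum>i\<in>UNIV. Poly_Mapping.lookup m' i) = 1"
    using split[of m 1] assms by auto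
  obtain b m'' where 2: "m' = Poly_Mapping.single b 1 + m''" "(\<Sum>i\<in>UNIV. Poly_Mapping.lookup m'' i) = 0"
    using split[of m' 0] 1(2) by auto
  have "m'' = 0" using 2(2) by (intro poly_mapping_eqI) simp
  then show ?thesis using that 1 2 by simp
qed

definition bilin :: "complex^'v^'v::finite \<Rightarrow> complex^'v \<Rightarrow> complex^'v \<Rightarrow> complex" where
  "bilin M x z = (\<Sum>i\<in>UNIV. \<Sum>j\<in>UNIV. M $ i $ j * (x $ i * z $ j))"

lemma bilin_add_matrix: "bilin (M + N) x z = bilin M x z + bilin N x z"
  by (simp add: bilin_def sum.distrib ring_distribs)

lemma quad_matrix_add: "quad_matrix (f + g) = quad_matrix f + quad_matrix g"
  by (simp add: quad_matrix_def vec_eq_iff lookup_add Let_def add_divide_distrib)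

lemma quad_matrix_sym: "quad_matrix f $ i $ j = quad_matrix f $ j $ i"
  by (simp add: quad_matrix_def Let_def add.commute)

lemma quad_matrix_0: "quad_matrix 0 = 0"
  by (simp add: quad_matrix_def vec_eq_iff)

lemma single_add_single_eq_iff:
  fixes a b i j :: 'v
  shows "Poly_Mapping.single i (1::nat) + Poly_Mapping.single j 1 = Poly_Mapping.single a 1 + Poly_Mapping.single b 1
    \<longleftrightarrow> i = a \<and> j = b \<or> i = b \<and> j = a" (is "?L = ?R \<longleftrightarrow> _")
proof
  assume "?L = ?R"
  then have "Poly_Mapping.lookup ?L k = Poly_Mapping.lookup ?R k" for k by simp
  then have *: "(if i = k then 1 else 0) + (if j = k then 1 else 0) =
      (if a = k then 1 else 0) + (if b = k then (1::nat) else 0)" for k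
    by (simp only: lookup_add lookup_single when_def)
  show "i = a \<and> j = b \<or> i = b \<and> j = a"
    using *[of a] *[of b] *[of i] *[of j]
    by (cases "i = a"; cases "j = a"; cases "i = b"; cases "j = b"; cases "a = b"; simp)
qed (auto simp: add.commute)

lemma peval_monomial_2:
  "peval (Poly_Mapping.single (Poly_Mapping.single a 1 + Poly_Mapping.single b 1) c) x = c * (x $ a * x $ b)"
proof -
  have "Poly_Mapping.single (Poly_Mapping.single a 1 + Poly_Mapping.single b 1) c = pconst c * (pvar a * pvar b)"
    by (simp add: pconst_def pvar_def mult_single)
  then show ?thesis by (simp only: peval_times peval_pvar peval_pconst)
qed

lemma bilin_monomial_2:
  "bilin (quad_matrix (Poly_Mapping.single (Poly_Mapping.single a 1 + Poly_Mapping.single b 1) c)) x x =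
     c * (x $ a * x $ b)"
proof -
  let ?f = "Poly_Mapping.single (Poly_Mapping.single a (1::nat) + Poly_Mapping.single b 1) c"
  have l: "Poly_Mapping.lookup ?f (Poly_Mapping.single i 1 + Poly_Mapping.single j 1) =
      (if a = i \<and> b = j \<or> a = j \<and> b = i then c else 0)" for i j
    unfolding lookup_single when_def
    by (simp only: single_add_single_eq_iff)
  show ?thesis
  proof (cases "a = b")
    case True
    have "quad_matrix ?f $ i $ j * (x $ i * x $ j) = (if j = a then (if i = a then c * (x $ a * x $ a) else 0) else 0)" for i j
      using True unfolding quad_matrix_def Let_def vec_lambda_beta l by auto
    then show ?thesis unfolding bilin_def using True by (simp add: sum.delta)
  next
    case False
    have "quad_matrix ?f $ i $ j * (x $ i * x $ j) = (if j = b then (if i = a then c / 2 * (x $ a * x $ b) else 0) else 0) +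
        (if j = a then (if i = b then c / 2 * (x $ a * x $ b) else 0) else 0)" for i j
      using False unfolding quad_matrix_def Let_def vec_lambda_beta l by auto
    then show ?thesis unfolding bilin_def by (simp add: sum.delta sum.distrib)
  qed
qed

lemma peval_homogeneous_2:
  assumes "homogeneous 2 f"
  shows "peval f x = bilin (quad_matrix f) x x"
proof -
  let ?s = "\<lambda>m. Poly_Mapping.single m (Poly_Mapping.lookup f m)"
  have "peval (\<Sum>m\<in>K. ?s m) x = bilin (quad_matrix (\<Sum>m\<in>K. ?s m)) x x"
    if "finite K" "K \<subseteq> Poly_Mapping.keys f" for K
    using that
  proof (induction K rule: finite_induct)
    case empty
    then show ?case by (simp add: quad_matrix_0 bilin_def)
  next
    case (insert m K)
    have "(\<Sum>i\<in>UNIV. Poly_Mapping.lookup m i) = 2" using insert assms by (auto simp: homogeneous_def)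
    then obtain a b where "m = Poly_Mapping.single a 1 + Poly_Mapping.single b 1"
      by (rule degree_2_monomial)
    then have "peval (?s m) x = bilin (quad_matrix (?s m)) x x"
      by (simp only: peval_monomial_2 bilin_monomial_2)
    then show ?case using insert
      by (simp add: quad_matrix_add bilin_add_matrix del: peval_single)
  qed
  from this[of "Poly_Mapping.keys f"] show ?thesis by (simp only: sum_of_monomials finite_keys subset_refl)
qed

lemma sym_bilin_quad_matrix: "sym_bilin (bilin (quad_matrix f))"
proof -
  have "bilin (quad_matrix f) y z = bilin (quad_matrix f) z y" for y z
    unfolding bilin_def by (subst sum.swap) (simp add: quad_matrix_sym[of f] mult_ac)
  moreover have "lin_form (bilin (quad_matrix f) y)" for y
    unfolding lin_form_iff bilin_def by (simp add: sum.distrib sum_distrib_left algebra_simps)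
  ultimately show ?thesis by (auto simp: sym_bilin_def)
qed

lemma bilin_axis: "bilin M (axis i 1) (axis j 1) = M $ i $ j"
proof -
  have "M $ k $ l * (axis i 1 $ k * axis j 1 $ l) = (if l = j then (if k = i then M $ i $ j else 0) else 0)" for k l
    by (auto simp: axis_def)
  then show ?thesis unfolding bilin_def by (simp add: sum.delta)
qed

text \<open>Polarization recovers the matrix from the values, and every coefficient in degree two is
  an entry of the matrix up to a factor 2.\<close>

lemma homogeneous_2_eq_0:
  assumes "homogeneous 2 f" "\<And>x. peval f x = 0"
  shows "f = 0"
proof (rule poly_mapping_eqI)
  have M: "quad_matrix f $ i $ j = 0" for i j
    using sym_bilin_polarize[OF sym_bilin_quad_matrix, of f] assms(2)
    unfolding peval_homogeneous_2[OF assms(1)] by (metis bilin_axis)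
  fix m
  show "Poly_Mapping.lookup f m = Poly_Mapping.lookup 0 m"
  proof (cases "m \<in> Poly_Mapping.keys f")
    case True
    then have "(\<Sum>i\<in>UNIV. Poly_Mapping.lookup m i) = 2" using assms by (auto simp: homogeneous_def)
    then obtain a b where "m = Poly_Mapping.single a 1 + Poly_Mapping.single b 1"
      by (rule degree_2_monomial)
    then show ?thesis using M[of a b] by (simp add: quad_matrix_def Let_def split: if_splits)
  qed (simp add: in_keys_iff)
qed

lemma homogeneous_2_eqI:
  assumes "homogeneous 2 f" "homogeneous 2 g" "\<And>x. peval f x = peval g x"
  shows "f = g"
  using homogeneous_2_eq_0[OF homogeneous_diff[OF assms(1,2)]] assms(3) by simp

lemma lin_form_peval:
  assumes "lin_form c"
  obtains g where "homogeneous 1 g" "\<And>x. peval g x = c x"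
proof
  show "homogeneous 1 (\<Sum>i\<in>UNIV. pconst (c (axis i 1)) * pvar i)"
    by (intro homogeneous_sum homogeneous_scale homogeneous_pvar)
  show "peval (\<Sum>i\<in>UNIV. pconst (c (axis i 1)) * pvar i) x = c x" for x
    by (simp add: lin_form_expand[OF assms, of x])
qed

lemma linear_not_unit:
  assumes "homogeneous 1 g"
  shows "\<not> g dvd 1"
proof
  assume "g dvd 1"
  then obtain h where "1 = g * h" by (rule dvdE)
  then have "peval 1 (0 :: complex^'a) = peval g 0 * peval h 0" by (simp flip: peval_times)
  then show False using peval_scale[OF assms, of 0 0] by simp
qed

lemma irreducible_not_product:
  assumes "homogeneous 2 q" "irreducible q" "lin_form l" "lin_form m" "\<And>y. peval q y = l y * m y"
  shows False
proof -
  obtain g h where g: "homogeneous 1 g" "\<And>x. peval g x = l x" and h: "homogeneous 1 h" "\<And>x. peval h x = m x"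
    using lin_form_peval assms(3,4) by metis
  have "homogeneous 2 (g * h)" using homogeneous_mult[OF g(1) h(1)] by (simp only: one_add_one)
  then have "q = g * h"
    by (intro homogeneous_2_eqI assms(1)) (simp_all add: assms(5) g h)
  then show False using irreducibleD[OF assms(2)] linear_not_unit g(1) h(1) by blast
qed

text \<open>Take \<open>y0\<close> with c y0 = 1. For \<open>z\<close> in the kernel of
  \<open>c\<close>, the binary form q(s z + t y0) vanishes only where t = 0, hence is a multiple of
  t^2. So q would be a multiple of c^2.\<close>

lemma quadric_not_in_hyperplane:
  assumes "homogeneous 2 q" "irreducible q" and c: "lin_form c" "\<And>y. peval q y = 0 \<Longrightarrow> c y = 0"
  shows "c y = 0"
proof (rule ccontr)
  assume "c y \<noteq> 0"
  define y0 where "y0 = (1 / c y) *s y"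
  have y0: "c y0 = 1" using \<open>c y \<noteq> 0\<close> by (simp add: y0_def lin_formD[OF c(1)])
  define b where "b = bilin (quad_matrix q)"
  note q = peval_homogeneous_2[OF assms(1), folded b_def]
  note B = sym_bilinD[OF sym_bilin_quad_matrix[of q], folded b_def]
  have q0: "b y0 y0 \<noteq> 0" using y0 c(2)[of y0] by (auto simp: q)
  have exp: "b (s *s z + t *s y0) (s *s z + t *s y0) = b z z * s\<^sup>2 + (2 * b y0 z) * (s * t) + b y0 y0 * t\<^sup>2" for s t z
    using B(1)[of z y0] by (simp add: B(2-5) power2_eq_square algebra_simps)
  have ker: "b z z = 0 \<and> b y0 z = 0" if z: "c z = 0" for z
  proof -
    have nz: "t = 0" if "b z z * s\<^sup>2 + (2 * b y0 z) * (s * t) + b y0 y0 * t\<^sup>2 = 0" for s t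
      using c(2)[of "s *s z + t *s y0"] that unfolding q exp by (simp add: lin_formD[OF c(1)] z y0)
    obtain s t where st: "s \<noteq> 0 \<or> t \<noteq> 0" "b z z * s\<^sup>2 + (2 * b y0 z) * (s * t) + b y0 y0 * t\<^sup>2 = 0"
      using binary_form_root by blast
    then have "t = 0" using nz by blast
    then have zz: "b z z = 0" using st by simp
    \<comment> \<open>With b z z = 0 the binary form has a second root with s = 1 and this value of
      t, which must be zero too.\<close>
    then have "- (2 * b y0 z) / b y0 y0 = 0"
      using q0 by - (rule nz[of 1], simp add: power2_eq_square field_simps)
    then show ?thesis using zz q0 by simp
  qed
  have "peval q z = b y0 y0 * c z * c z" for z
  proof -
    have "c (z - c z *s y0) = 0" by (simp add: lin_formD[OF c(1)] y0)
    note k = ker[OF this]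
    have "z = 1 *s (z - c z *s y0) + c z *s y0" by simp
    then have "b z z = b y0 y0 * (c z)\<^sup>2"
      using exp[of 1 "z - c z *s y0" "c z"] k by simp
    then show ?thesis by (simp add: q power2_eq_square)
  qed
  then show False
    using irreducible_not_product[OF assms(1,2) lin_form_cmult[OF c(1)] c(1)] by blast
qed

lemma quad_map_peval:
  fixes F :: "'w::finite \<Rightarrow> 'v::finite cpoly"
  assumes "forms 2 F"
  shows "quad_map (\<lambda>x. \<chi> j. peval (F j) x)"
proof -
  have F: "peval (F j) x = bilin (quad_matrix (F j)) x x" for j x
    using assms by (intro peval_homogeneous_2) (simp add: forms_def)
  note B = sym_bilinD[OF sym_bilin_quad_matrix]
  have p: "polar (\<lambda>x. \<chi> j. peval (F j) x) x z = (\<chi> j. bilin (quad_matrix (F j)) x z)" for x z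
    unfolding polar_def vec_eq_iff F by (simp add: B(2,3)) (simp add: B(1)[of _ z x] field_simps)
  show ?thesis unfolding quad_map_def p
    by (simp add: lin_map_iff vec_eq_iff B F power2_eq_square)
qed

text \<open>A nonzero kernel vector keeps the rows from spanning. One extra row, reading a
  coordinate where \<open>v\<close> is nonzero, makes the kernel trivial, and a single row raises
  the dimension by at most one.\<close>

lemma rank_eq_4:
  fixes M :: "complex^5^5"
  assumes v: "v \<noteq> 0" and ker: "\<And>y. M *v y = 0 \<longleftrightarrow> (\<exists>k. y = k *s v)"
  shows "rank M = 4"
proof -
  obtain i where i: "v $ i \<noteq> 0" using v by (auto simp: vec_eq_iff)
  have dimU: "vec.dim S = 5 \<longleftrightarrow> vec.span S = UNIV" for S :: "(complex^5) set"
    using vec.dim_eq_full[of S] by (auto simp: vec.dimension_def card_cart_basis)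
  have "M *v v = 0" using ker[of v] by (metis vec.scale_one)
  then have "vec.span (rows M) \<noteq> UNIV"
    using v matrix_left_invertible_span_rows_gen[of M] matrix_left_invertible_ker[of M] by blast
  then have 1: "rank M \<noteq> 5" unfolding row_rank_def_gen using dimU by blast
  have le: "rank M \<le> 5"
    unfolding row_rank_def_gen using dim_subset_UNIV_cart_gen[of "rows M"] by simp
  define A :: "complex^5^(5 + 1)" where "A = (\<chi> r. case r of Inl k \<Rightarrow> M $ k | Inr _ \<Rightarrow> axis i 1)"
  have rows: "rows A = insert (axis i 1) (rows M)"
  proof -
    have "rows A = range (\<lambda>r. A $ r)" by (auto simp: rows_def row_def)
    also have "\<dots> = insert (axis i 1) (range (\<lambda>k. M $ k))"
      by (auto simp: A_def UNIV_sum image_Un image_image)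
    finally show ?thesis by (auto simp: rows_def row_def)
  qed
  have "y = 0" if "A *v y = 0" for y
  proof -
    have a: "(\<Sum>k\<in>UNIV. A $ r $ k * y $ k) = 0" for r
      using that by (simp add: matrix_vector_mult_def vec_eq_iff)
    have "M *v y = 0"
      using a[of "Inl _"] by (simp add: A_def matrix_vector_mult_def vec_eq_iff)
    then obtain k where k: "y = k *s v" using ker by blast
    have "y $ i = 0"
      using a[of "Inr 1"] by (simp add: A_def axis_def if_distrib[of "\<lambda>u. u * _"] cong: if_cong)
    then show ?thesis using k i by simp
  qed
  then have "vec.span (rows A) = UNIV"
    using matrix_left_invertible_span_rows_gen[of A] matrix_left_invertible_ker[of A] by blast
  then have "vec.dim (insert (axis i 1) (rows M)) = 5" unfolding rows[symmetric] using dimU by blast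
  then have "5 \<le> rank M + 1" unfolding row_rank_def_gen vec.dim_insert by (auto split: if_splits)
  then show ?thesis using 1 le by linarith
qed

lemma bilin_eq_0_iff_kernel: "(\<forall>z. bilin (quad_matrix q) y z = 0) \<longleftrightarrow> quad_matrix q *v y = 0"
proof -
  have e: "bilin (quad_matrix q) y z = (\<Sum>j\<in>UNIV. (quad_matrix q *v y) $ j * z $ j)" for z
    unfolding bilin_def matrix_vector_mult_def
    by (subst sum.swap) (simp add: sum_distrib_right sum_distrib_left quad_matrix_sym[of q] mult_ac)
  have "bilin (quad_matrix q) y (axis j 1) = (quad_matrix q *v y) $ j" for j
    unfolding e by (simp add: axis_def if_distrib[of "\<lambda>u. _ * u"] cong: if_cong)
  then have "(\<forall>z. bilin (quad_matrix q) y z = 0) \<Longrightarrow> quad_matrix q *v y = 0" by (simp add: vec_eq_iff)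
  moreover have "quad_matrix q *v y = 0 \<Longrightarrow> bilin (quad_matrix q) y z = 0" for z unfolding e by simp
  ultimately show ?thesis by blast
qed


section \<open>Points, rational maps and inverses\<close>

abbreviation point :: "complex^'v::finite \<Rightarrow> (complex^'v) set" where
  "point x \<equiv> vec.span {x}"

abbreviation eval_map :: "('w::finite \<Rightarrow> 'v::finite cpoly) \<Rightarrow> complex^'v \<Rightarrow> complex^'w" where
  "eval_map F x \<equiv> (\<chi> j. peval (F j) x)"

lemma point_in_proj_space: "x \<noteq> 0 \<Longrightarrow> point x \<in> proj_space"
  by (simp add: proj_of_def)

lemma proj_spaceE:
  assumes "p \<in> proj_space"
  obtains x where "x \<noteq> 0" "p = point x"
proof -
  have p: "vec.subspace p" "vec.dim p = 1" using assms by (auto simp: proj_of_def)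
  obtain B where B: "B \<subseteq> p" "vec.independent B" "p \<subseteq> vec.span B" "card B = vec.dim p"
    using vec.basis_exists by blast
  then obtain x where x: "B = {x}" using p(2) by (auto simp: card_1_singleton_iff)
  have "x \<noteq> 0" using B(2) by (simp add: x)
  moreover have "p = point x"
    using B(1,3) p(1) vec.span_minimal unfolding x by blast
  ultimately show ?thesis using that by blast
qed

lemma in_point: "y \<in> point x \<longleftrightarrow> (\<exists>k. y = k *s x)"
  by (auto simp: vec.span_singleton)

lemma point_scale: "k \<noteq> 0 \<Longrightarrow> point (k *s x) = point x"
proof -
  assume k: "k \<noteq> 0"
  have "c *s x = (c / k) *s (k *s x)" for c using k by simp
  then show ?thesis unfolding set_eq_iff in_point by (metis vector_smult_assoc)
qed

lemma vanishes_at_point: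
  assumes "homogeneous d f"
  shows "vanishes_at f (point x) \<longleftrightarrow> peval f x = 0"
proof
  assume "vanishes_at f (point x)"
  then show "peval f x = 0" by (simp add: vanishes_at_def vec.span_base)
qed (auto simp: vanishes_at_def in_point peval_scale[OF assms])

lemma zero_locus_point:
  assumes "\<And>f. f \<in> S \<Longrightarrow> \<exists>d. homogeneous d f" "x \<noteq> 0"
  shows "point x \<in> zero_locus S \<longleftrightarrow> (\<forall>f\<in>S. peval f x = 0)"
proof -
  have "vanishes_at f (point x) \<longleftrightarrow> peval f x = 0" if "f \<in> S" for f
    using assms(1)[OF that] vanishes_at_point by blast
  then show ?thesis using point_in_proj_space[OF assms(2)] by (auto simp: zero_locus_def)
qed

lemma defined_at_point:
  assumes "forms d F"
  shows "defined_at F (point x) \<longleftrightarrow> eval_map F x \<noteq> 0"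
proof -
  have "vanishes_at (F j) (point x) \<longleftrightarrow> peval (F j) x = 0" for j
    using assms vanishes_at_point unfolding forms_def by blast
  then show ?thesis by (simp add: defined_at_def vec_eq_iff)
qed

lemma rmap_point:
  assumes "forms d F"
  shows "rmap F (point x) = point (eval_map F x)"
proof -
  have "eval_map F (k *s x) = k ^ d *s eval_map F x" for k
    using assms by (simp add: forms_def vec_eq_iff peval_scale)
  then have "eval_map F ` point x \<subseteq> point (eval_map F x)" by (auto simp: in_point)
  moreover have "eval_map F x \<in> eval_map F ` point x" by (intro imageI vec.span_base) simp
  ultimately show ?thesis unfolding rmap_def
    by (intro subset_antisym vec.span_minimal vec.subspace_span vec.span_mono) auto
qed

text \<open>A form from the system cutting out the complement, nonzero at one point of
  \<open>U\<close>, describes a smaller open set; the coordinate factor excludes the origin.\<close>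

lemma nonempty_open_line_poly:
  fixes U :: "(complex^'v::finite) set set"
  assumes "nonempty_open_in proj_space U"
  obtains f x0 where "line_poly f" "f x0 \<noteq> 0" "\<And>x. f x \<noteq> 0 \<Longrightarrow> x \<noteq> 0 \<and> point x \<in> U"
proof -
  obtain S where S: "\<And>f. f \<in> S \<Longrightarrow> \<exists>d. homogeneous d f" "U = proj_space - zero_locus S" "U \<noteq> {}"
    using assms by (auto simp: nonempty_open_in_def zariski_closed_def)
  then obtain p where p: "p \<in> proj_space" "p \<in> U" by auto
  obtain x0 where x0: "x0 \<noteq> 0" "point x0 \<in> U" using proj_spaceE[OF p(1)] p(2) by metis
  then obtain g where g: "g \<in> S" "peval g x0 \<noteq> 0" using zero_locus_point[OF S(1)] S(2) by auto
  obtain i where i: "x0 $ i \<noteq> 0" using x0(1) by (auto simp: vec_eq_iff)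
  show ?thesis
  proof (rule that[of "\<lambda>x. peval g x * x $ i" x0])
    show "line_poly (\<lambda>x. peval g x * x $ i)" by (intro line_poly_mult line_poly_peval line_poly_nth)
    show "peval g x0 * x0 $ i \<noteq> 0" using g i by simp
    fix x assume *: "peval g x * x $ i \<noteq> 0"
    then have "x \<noteq> 0" by auto
    moreover have "point x \<notin> zero_locus S" using * g zero_locus_point[OF S(1) \<open>x \<noteq> 0\<close>] by auto
    ultimately show "x \<noteq> 0 \<and> point x \<in> U" using S(2) point_in_proj_space by auto
  qed
qed

lemma continuous_zero_limit:
  fixes H :: "complex \<Rightarrow> complex"
  assumes "continuous_on UNIV H" "\<And>t. t \<noteq> 0 \<Longrightarrow> H t = 0"
  shows "H 0 = 0"
proof -
  have "H \<midarrow>0\<rightarrow> H 0" using assms(1) by (simp add: continuous_on_eq_continuous_at isCont_def)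
  moreover have "H \<midarrow>0\<rightarrow> 0"
    by (rule tendsto_eventually) (auto simp: eventually_at assms(2) intro: exI[of _ 1])
  ultimately show ?thesis using LIM_unique by blast
qed

text \<open>On a chart containing the point of \<gamma> 0, reducedness expresses x_i^N a through the
  components of F. Along \<gamma> the left side would have order k if \<open>s\<close> were nonzero,
  while the right side has order at least k + 1.\<close>

lemma reduced_on_jets:
  fixes F :: "'w::finite \<Rightarrow> 'v::finite cpoly"
  assumes "reduced_base_scheme F" "forms 2 F" "lin_form a" "lin_form c" "\<And>x. (a x)\<^sup>2 = c (eval_map F x)"
    and \<gamma>: "\<gamma> 0 \<noteq> 0" "\<And>i. continuous_on UNIV (\<lambda>t. \<gamma> t $ i)" "\<And>j. continuous_on UNIV (\<lambda>t. R t $ j)"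
    and a: "\<And>t. a (\<gamma> t) = t ^ k * s" and F: "\<And>t. eval_map F (\<gamma> t) = t ^ Suc k *s R t"
  shows "s = 0"
proof -
  obtain i where i: "\<gamma> 0 $ i \<noteq> 0" using \<gamma>(1) by (auto simp: vec_eq_iff)
  obtain g where g: "homogeneous 1 g" "\<And>x. peval g x = a x" using lin_form_peval[OF assms(3)] by blast
  have "g\<^sup>2 = (\<Sum>j\<in>UNIV. pconst (c (axis j 1)) * F j)"
  proof (rule homogeneous_2_eqI)
    show "homogeneous 2 (g\<^sup>2)" using homogeneous_power[OF g(1), of 2] by simp
    show "homogeneous 2 (\<Sum>j\<in>UNIV. pconst (c (axis j 1)) * F j)"
      using assms(2) by (intro homogeneous_sum homogeneous_scale) (simp add: forms_def)
    show "peval (g\<^sup>2) x = peval (\<Sum>j\<in>UNIV. pconst (c (axis j 1)) * F j) x" for x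
      by (simp add: g(2) assms(5) lin_form_expand[OF assms(4), of "eval_map F x"])
  qed
  then have "g\<^sup>2 \<in> ideal_of F" by (auto simp: ideal_of_def)
  then have "zero_on_chart F i (g\<^sup>2)" unfolding zero_on_chart_def by (intro exI[of _ 0]) simp
  then have "zero_on_chart F i g" using assms(1) g(1) unfolding reduced_base_scheme_def by blast
  then obtain N A where A: "pvar i ^ N * g = (\<Sum>j\<in>UNIV. A j * F j)"
    unfolding zero_on_chart_def ideal_of_def by blast
  \<comment> \<open>The difference of both sides along \<gamma>, divided by t^k. It vanishes for t
    nonzero, hence at 0 by continuity.\<close>
  define H where "H = (\<lambda>t. (\<gamma> t $ i) ^ N * s - t * (\<Sum>j\<in>UNIV. peval (A j) (\<gamma> t) * R t $ j))"
  have "H 0 = 0"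
  proof (rule continuous_zero_limit)
    show "continuous_on UNIV H" unfolding H_def
      by (intro continuous_intros continuous_peval \<gamma>(2,3))
    fix t :: complex assume "t \<noteq> 0"
    have "eval_map F (\<gamma> t) $ j = t ^ Suc k * R t $ j" for j unfolding F by simp
    then have Fj: "peval (F j) (\<gamma> t) = t ^ Suc k * R t $ j" for j by simp
    have "(\<gamma> t $ i) ^ N * (t ^ k * s) = (\<Sum>j\<in>UNIV. peval (A j) (\<gamma> t) * (t ^ Suc k * R t $ j))"
      using arg_cong[OF A, of "\<lambda>h. peval h (\<gamma> t)"] by (simp only: peval_times peval_power peval_pvar peval_sum g(2) a Fj)
    also have "\<dots> = t ^ k * (t * (\<Sum>j\<in>UNIV. peval (A j) (\<gamma> t) * R t $ j))"
      by (simp add: sum_distrib_left mult_ac)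
    finally have "t ^ k * H t = 0" by (simp add: H_def algebra_simps)
    then show "H t = 0" using \<open>t \<noteq> 0\<close> by simp
  qed
  then show ?thesis using i by (simp add: H_def)
qed

section \<open>Density of the image, and inverses obtained from one composite\<close>

lemma quadric_dense_image:
  fixes F :: "'w::finite \<Rightarrow> 'v::finite cpoly"
  assumes "forms d F" "zero_locus {q} = image_closure F" "homogeneous e q"
    and r: "homogeneous c r" "\<And>x. peval r (eval_map F x) = 0" and "peval q y = 0"
  shows "peval r y = 0"
proof (cases "y = 0")
  case True
  then show ?thesis using peval_scale[OF r(1), of 0 "eval_map F 0"] r(2)[of 0] by simp
next
  case False
  have pt: "point z \<in> zero_locus {r} \<longleftrightarrow> peval r z = 0" if "z \<noteq> 0" for z
    using zero_locus_point[of "{r}"] r(1) that by auto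
  have "zariski_closed (zero_locus {r})" unfolding zariski_closed_def using r(1) by blast
  moreover have "rmap F ` {p \<in> proj_space. defined_at F p} \<subseteq> zero_locus {r}"
  proof (clarify elim!: proj_spaceE)
    fix x :: "complex^'v" assume "defined_at F (point x)"
    then show "rmap F (point x) \<in> zero_locus {r}"
      using pt r(2) by (simp add: defined_at_point[OF assms(1)] rmap_point[OF assms(1)])
  qed
  ultimately have "zero_locus {q} \<subseteq> zero_locus {r}"
    unfolding assms(2) image_closure_def zariski_closure_def by blast
  moreover have "point y \<in> zero_locus {q}"
    using zero_locus_point[of "{q}" y] assms(3,6) False by auto
  ultimately show ?thesis using pt[OF False] by blast
qed

lemma eval_map_0:
  assumes "forms d F" "0 < d"
  shows "eval_map F 0 = 0"
  using peval_scale[of d "F _" 0 0] assms by (simp add: forms_def vec_eq_iff power_0_left)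

lemma quadric_contains_image:
  fixes F :: "'w::finite \<Rightarrow> 'v::finite cpoly"
  assumes "forms d F" "0 < d" "zero_locus {q} = image_closure F" "homogeneous e q" "0 < e"
  shows "peval q (eval_map F x) = 0"
proof (cases "eval_map F x = 0")
  case True
  then show ?thesis using peval_scale[OF assms(4), of 0 0] assms(5) by (simp add: power_0_left)
next
  case False
  then have "x \<noteq> 0" using eval_map_0[OF assms(1,2)] by auto
  then have "point (eval_map F x) \<in> rmap F ` {p \<in> proj_space. defined_at F p}"
    using point_in_proj_space False
    by (auto simp: defined_at_point[OF assms(1)] rmap_point[OF assms(1)] intro!: image_eqI[of _ _ "point x"])
  then have "point (eval_map F x) \<in> zero_locus {q}"
    unfolding assms(3) image_closure_def zariski_closure_def by blast
  then show ?thesis using zero_locus_point[of "{q}" "eval_map F x"] assms(4) False by auto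
qed

lemma nonempty_open_inI:
  assumes "\<And>f. f \<in> S \<Longrightarrow> \<exists>d. homogeneous d f" "p \<in> X" "p \<notin> zero_locus S"
  shows "nonempty_open_in X (X - zero_locus S)"
  unfolding nonempty_open_in_def zariski_closed_def using assms by auto

text \<open>For \<open>y\<close> in the image, F(G(y)) is proportional to \<open>y\<close>. This is
  the vanishing of 2 by 2 minors, which are forms, so it extends to the quadric as the closure of
  the image.\<close>

lemma rational_inverseI:
  fixes F :: "'w::finite \<Rightarrow> 'v::finite cpoly"
  assumes F: "forms e F" "0 < e" and q: "zero_locus {q} = image_closure F" "homogeneous k q" "0 < k"
    and G: "forms d G" "0 < d" "\<And>x. eval_map G (eval_map F x) = h x *s x" and h: "h x0 \<noteq> 0" "x0 \<noteq> 0"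
  shows "rational_inverse F (zero_locus {q}) G"
  unfolding rational_inverse_def
proof (intro conjI)
  obtain H where H: "\<And>i. homogeneous (d * e) (H i)" "\<And>i x. peval (H i) x = peval (G i) (eval_map F x)"
  proof -
    have "\<exists>h. homogeneous (d * e) h \<and> (\<forall>x. peval h x = peval (G i) (eval_map F x))" for i
      by (rule peval_compose[of d "G i" e F]) (use F G(1) in \<open>auto simp: forms_def\<close>)
    then show ?thesis using that by metis
  qed
  \<comment> \<open>\<open>h\<close> is an arbitrary function; its zero set becomes Zariski closed
    through the components of the composite.\<close>
  have Hx: "eval_map H x = h x *s x" for x using G(3)[of x] by (simp add: vec_eq_iff H(2))
  note G0 = eval_map_0[OF G(1,2)]
  have defF: "eval_map F x \<noteq> 0" if "h x \<noteq> 0" "x \<noteq> 0" for x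
    using G(3)[of x] G0 that by (metis vec.scale_eq_0_iff)
  have rg: "point x \<in> zero_locus (range H) \<longleftrightarrow> h x = 0" if "x \<noteq> 0" for x
  proof -
    have "point x \<in> zero_locus (range H) \<longleftrightarrow> eval_map H x = 0"
      using zero_locus_point[of "range H" x] H(1) that by (auto simp: vec_eq_iff)
    then show ?thesis using that by (simp add: Hx)
  qed
  show "\<exists>U. nonempty_open_in proj_space U \<and>
      (\<forall>p\<in>U. defined_at F p \<and> defined_at G (rmap F p) \<and> rmap G (rmap F p) = p)"
  proof (intro exI conjI ballI)
    show "nonempty_open_in proj_space (proj_space - zero_locus (range H))"
      by (rule nonempty_open_inI[where p = "point x0"]) (use rg[OF h(2)] h point_in_proj_space[OF h(2)] H(1) in auto)
    fix p assume "p \<in> proj_space - zero_locus (range H)"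
    then have p: "p \<in> proj_space" "p \<notin> zero_locus (range H)" by auto
    obtain x where x: "x \<noteq> 0" "p = point x" using proj_spaceE[OF p(1)] by blast
    then have hx: "h x \<noteq> 0" using p(2) rg by simp
    note x = x hx
    show "defined_at F p" using defF x by (simp add: defined_at_point[OF F(1)])
    show "defined_at G (rmap F p)"
      using x by (simp add: rmap_point[OF F(1)] defined_at_point[OF G(1)] G(3))
    show "rmap G (rmap F p) = p"
      using x by (simp add: rmap_point[OF F(1)] rmap_point[OF G(1)] G(3) point_scale)
  qed
  obtain K where K: "\<And>j. homogeneous (e * d) (K j)" "\<And>j y. peval (K j) y = peval (F j) (eval_map G y)"
  proof -
    have "\<exists>h. homogeneous (e * d) h \<and> (\<forall>x. peval h x = peval (F j) (eval_map G x))" for j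
      by (rule peval_compose[of e "F j" d G]) (use F G(1) in \<open>auto simp: forms_def\<close>)
    then show ?thesis using that by metis
  qed
  have KF: "peval (K j) (eval_map F x) = h x ^ e * peval (F j) x" for j x
    using F by (simp add: K(2) G(3) peval_scale forms_def)
  have par: "y $ i * peval (K j) y = y $ j * peval (K i) y" if "peval q y = 0" for i j y
  proof -
    have "peval (pvar i * K j - pvar j * K i) y = 0"
    proof (rule quadric_dense_image[OF F(1) q(1,2) _ _ that])
      show "homogeneous (1 + e * d) (pvar i * K j - pvar j * K i)"
        by (intro homogeneous_diff homogeneous_mult homogeneous_pvar K(1))
      show "peval (pvar i * K j - pvar j * K i) (eval_map F x) = 0" for x
        by (simp add: KF)
    qed
    then show ?thesis by simp
  qed
  have K0: "point y \<in> zero_locus (range K) \<longleftrightarrow> eval_map F (eval_map G y) = 0" if "y \<noteq> 0" for y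
    using zero_locus_point[of "range K" y] K that by (auto simp: vec_eq_iff)
  show "\<exists>V. nonempty_open_in (zero_locus {q}) V \<and>
      (\<forall>y\<in>V. defined_at G y \<and> defined_at F (rmap G y) \<and> rmap F (rmap G y) = y)"
  proof (intro exI conjI ballI)
    let ?V = "zero_locus {q} - zero_locus (range K)"
    have nz: "eval_map F x0 \<noteq> 0" by (rule defF[OF h])
    have "eval_map F (eval_map G (eval_map F x0)) = h x0 ^ e *s eval_map F x0"
      using KF[of _ x0] by (simp add: vec_eq_iff K(2))
    then have "point (eval_map F x0) \<notin> zero_locus (range K)" using K0[OF nz] nz h by simp
    moreover have "point (eval_map F x0) \<in> zero_locus {q}"
      using quadric_contains_image[OF F q] zero_locus_point[of "{q}"] q(2) nz by auto
    ultimately show "nonempty_open_in (zero_locus {q}) ?V"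
      by (intro nonempty_open_inI[where p = "point (eval_map F x0)"]) (use K(1) in auto)
    fix p assume p: "p \<in> ?V"
    then have "p \<in> proj_space" by (simp add: zero_locus_def)
    then obtain y where y: "y \<noteq> 0" "p = point y" by (rule proj_spaceE)
    have qy: "peval q y = 0" using p y zero_locus_point[of "{q}" y] q(2) by auto
    have Fy: "eval_map F (eval_map G y) \<noteq> 0" using p y K0 by auto
    have "eval_map G y \<noteq> 0"
      using Fy eval_map_0[OF F] by auto
    then show "defined_at G p" by (simp add: y defined_at_point[OF G(1)])
    show "defined_at F (rmap G p)" using Fy by (simp add: y rmap_point[OF G(1)] defined_at_point[OF F(1)])
    obtain i where i: "y $ i \<noteq> 0" using y(1) by (auto simp: vec_eq_iff)
    have "eval_map F (eval_map G y) = (peval (K i) y / y $ i) *s y"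
      using par[OF qy, of i] i by (simp add: vec_eq_iff K(2) field_simps)
    moreover from this have "peval (K i) y / y $ i \<noteq> 0" using Fy by auto
    ultimately show "rmap F (rmap G p) = p"
      by (simp add: y rmap_point[OF G(1)] rmap_point[OF F(1)] point_scale)
  qed
qed

lemma inverse_in_degreeE:
  assumes "inverse_in_degree F Y d"
  obtains G U where "forms d G" "nonempty_open_in proj_space U"
    "\<And>p. p \<in> U \<Longrightarrow> defined_at F p" "\<And>p. p \<in> U \<Longrightarrow> rmap G (rmap F p) = p"
proof -
  obtain G where G: "forms d G" "rational_inverse F Y G"
    using assms by (auto simp: inverse_in_degree_def)
  from G(2) have "\<exists>U. nonempty_open_in proj_space U \<and>
      (\<forall>p\<in>U. defined_at F p \<and> defined_at G (rmap F p) \<and> rmap G (rmap F p) = p)"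
    unfolding rational_inverse_def by (rule conjunct1)
  then show ?thesis using that[OF G(1)] by auto
qed

lemma base_points_point:
  assumes "forms d F" "x \<noteq> 0"
  shows "point x \<in> base_points F \<longleftrightarrow> eval_map F x = 0"
proof -
  have "point x \<in> zero_locus (range F) \<longleftrightarrow> (\<forall>f\<in>range F. peval f x = 0)"
    by (rule zero_locus_point) (use assms in \<open>auto simp: forms_def\<close>)
  then show ?thesis by (simp add: base_points_def vec_eq_iff)
qed

text \<open>Forms of degree zero are constant, so the inverse would have a single value on an open
  set that contains two distinct points.\<close>

lemma no_inverse_in_degree_0:
  fixes F :: "'w::finite \<Rightarrow> 4 cpoly"
  assumes "forms d F"
  shows "\<not> inverse_in_degree F Y 0"
proof
  assume inv: "inverse_in_degree F Y 0"
  obtain G U where G: "forms 0 G" and U: "nonempty_open_in proj_space U"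
      "\<And>p. p \<in> U \<Longrightarrow> rmap G (rmap F p) = p"
    by (rule inverse_in_degreeE[OF inv], rule that; assumption)
  obtain f x0 where f: "line_poly f" "f x0 \<noteq> 0" "\<And>x. f x \<noteq> 0 \<Longrightarrow> x \<noteq> 0 \<and> point x \<in> U"
    by (rule nonempty_open_line_poly[OF U(1)], rule that; assumption)
  have const: "peval (G i) y = peval (G i) 0" for i y
    using peval_scale[of 0 "G i" 0 y] G by (simp add: forms_def)
  have pt: "point x = point (eval_map G 0)" if "f x \<noteq> 0" for x
  proof -
    have "point x = rmap G (rmap F (point x))" using U(2) f(3)[OF that] by metis
    also have "\<dots> = point (eval_map G 0)"
      unfolding rmap_point[OF assms] rmap_point[OF G] by (subst const) (rule refl)
    finally show ?thesis .
  qed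
  obtain v where v: "v \<notin> point x0"
  proof -
    have "vec4 1 0 0 0 \<notin> point x0 \<or> vec4 0 1 0 0 \<notin> point x0"
      by (auto simp: in_point vec_eq_iff_4)
    then show ?thesis using that by blast
  qed
  have "finite {t. f (x0 + t *s v) = 0}" using line_poly_cofinite[OF f(1), of x0 0 v] f(2) by simp
  then have "finite (insert 0 {t. f (x0 + t *s v) = 0})" by simp
  from ex_new_if_finite[OF infinite_UNIV_char_0 this] obtain t where t: "t \<noteq> 0" "f (x0 + t *s v) \<noteq> 0" by auto
  have "point (x0 + t *s v) = point x0" using pt[OF t(2)] pt[OF f(2)] by simp
  then have "x0 + t *s v \<in> point x0" using vec.span_base[of "x0 + t *s v" "{x0 + t *s v}"] by simp
  then have "(x0 + t *s v) - x0 \<in> point x0" by (rule vec.span_diff) (simp add: vec.span_base)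
  then have "t *s v \<in> point x0" by simp
  then have "(1 / t) *s (t *s v) \<in> point x0" by (rule vec.span_scale)
  then show False using v t(1) by simp
qed

text \<open>A linear relation among the components would put the closure of the image, an
  irreducible quadric, into a hyperplane. \<open>generic\<close> comes from the inverse,
  \<open>red1\<close> and \<open>red2\<close> from \<open>reduced_on_jets\<close>.\<close>

lemma admissible_birational:
  fixes F :: "5 \<Rightarrow> 4 cpoly"
  assumes F: "forms 2 F" and q: "homogeneous 2 q" "irreducible q" "zero_locus {q} = image_closure F"
    and inv: "inverse_in_degree F Y d" and "base_points F \<noteq> {}" "reduced_base_scheme F"
  shows "admissible (eval_map F)"
proof
  show Q: "quad_map (eval_map F)" by (rule quad_map_peval[OF F])
  show "c y = 0" if c: "lin_form c" "\<And>x. c (eval_map F x) = 0" for c y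
  proof (rule quadric_not_in_hyperplane[OF q(1,2) c(1)])
    obtain r where r: "homogeneous 1 r" "\<And>x. peval r x = c x" using lin_form_peval[OF c(1)] by blast
    show "c y = 0" if "peval q y = 0" for y
      using quadric_dense_image[OF F q(3,1) r(1) _ that] by (simp add: r(2) c(2))
  qed
  obtain G U where G: "nonempty_open_in proj_space U"
      "\<And>p. p \<in> U \<Longrightarrow> defined_at F p \<and> rmap G (rmap F p) = p"
    using inverse_in_degreeE[OF inv] by metis
  obtain f x0 where f: "line_poly f" "f x0 \<noteq> 0" "\<And>x. f x \<noteq> 0 \<Longrightarrow> x \<noteq> 0 \<and> point x \<in> U"
    by (rule nonempty_open_line_poly[OF G(1)], rule that; assumption)
  show "\<exists>f. line_poly f \<and> (\<exists>x. f x \<noteq> 0) \<and> (\<forall>x. f x \<noteq> 0 \<longrightarrow> eval_map F x \<noteq> 0 \<and>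
      (\<forall>v c. polar (eval_map F) x v = c *s eval_map F v \<longrightarrow> (\<exists>k. v = k *s x)))"
  proof (intro exI[of _ f] conjI allI impI)
    show "line_poly f" "\<exists>x. f x \<noteq> 0" using f by auto
    show "eval_map F x \<noteq> 0" if "f x \<noteq> 0" for x
      using G(2)[OF conjunct2[OF f(3)[OF that]]] defined_at_point[OF F, of x] by simp
    fix x v c assume x: "f x \<noteq> 0" and p: "polar (eval_map F) x v = c *s eval_map F v"
    show "\<exists>k. v = k *s x"
    proof -
      \<comment> \<open>\<open>?s\<close> is the involution of the line that preserves the value of
        F. A \<open>t\<close> other than its fixed point - c is chosen with both points in the open
        set where \<open>G\<close> inverts F, so the two points agree projectively.\<close>
      let ?s = "\<lambda>t. - 2 * c - t"
      have "finite {t. f (x + t *s v) = 0}" using line_poly_cofinite[OF f(1), of x 0 v] x by simp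
      moreover have eq: "x + (- 2 * c) *s v + t *s (- v) = x + ?s t *s v" for t by (simp add: vec_eq_iff algebra_simps)
      have "finite {t. f (x + ?s t *s v) = 0}"
        using line_poly_cofinite[OF f(1), of "x + (- 2 * c) *s v" "- 2 * c" "- v"] x unfolding eq by simp
      ultimately have "finite (insert (- c) ({t. f (x + t *s v) = 0} \<union> {t. f (x + ?s t *s v) = 0}))" by simp
      from ex_new_if_finite[OF infinite_UNIV_char_0 this] obtain t
        where t: "t \<noteq> - c" "f (x + t *s v) \<noteq> 0" "f (x + ?s t *s v) \<noteq> 0" by auto
      have val: "eval_map F (x + t *s v) = eval_map F x + (2 * c * t + t\<^sup>2) *s eval_map F v" for t
        unfolding quad_map_line[OF Q] p by (simp add: vec_eq_iff algebra_simps)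
      have "2 * c * ?s t + (?s t)\<^sup>2 = 2 * c * t + t\<^sup>2" by (simp add: power2_eq_square algebra_simps)
      then have same: "eval_map F (x + ?s t *s v) = eval_map F (x + t *s v)" unfolding val by simp
      have "point (x + t *s v) = rmap G (rmap F (point (x + t *s v)))" using G(2) f(3)[OF t(2)] by simp
      also have "\<dots> = rmap G (rmap F (point (x + ?s t *s v)))" unfolding rmap_point[OF F] same ..
      also have "\<dots> = point (x + ?s t *s v)" using G(2) f(3)[OF t(3)] by simp
      finally have "x + t *s v \<in> point (x + ?s t *s v)" by (metis vec.span_base singletonI)
      then obtain k where "x + t *s v = k *s (x + ?s t *s v)" unfolding in_point by blast
      then have k: "(t - k * ?s t) *s v = (k - 1) *s x" by (simp add: vec_eq_iff algebra_simps)
      show ?thesis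
      proof (cases "t - k * ?s t = 0")
        case True
        have "(k - 1) *s x = 0" using k unfolding True vec.scale_zero_left by (rule sym)
        then have "k = 1" using f(3)[OF x] unfolding vec.scale_eq_0_iff by simp
        then have "2 * (t + c) = 0" using True by (simp add: algebra_simps)
        then have "t = - c" by (simp only: mult_eq_0_iff eq_neg_iff_add_eq_0) simp
        then show ?thesis using t(1) by simp
      next
        case False
        then have "v = ((k - 1) / (t - k * ?s t)) *s x" using k by (simp add: vec_eq_iff field_simps)
        then show ?thesis by blast
      qed
    qed
  qed
  show r1: "a v = 0" if a: "lin_form a" "lin_form c" "\<And>x. (a x)\<^sup>2 = c (eval_map F x)"
    and p: "p \<noteq> 0" "eval_map F p = 0" "polar (eval_map F) p v = 0" for a c p v
  proof (rule reduced_on_jets[OF assms(7) F a, where \<gamma> = "\<lambda>t. p + t *s v" and R = "\<lambda>t. eval_map F v" and k = 1])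
    have "a p = 0" using a(3)[of p] p(2) lin_formD(4)[OF a(2)] by simp
    then show "a (p + t *s v) = t ^ 1 * a v" for t by (simp add: lin_formD[OF a(1)])
    show "eval_map F (p + t *s v) = t ^ Suc 1 *s eval_map F v" for t
      unfolding quad_map_line[OF Q] p by (simp add: power2_eq_square)
  qed (use p in \<open>auto intro!: continuous_intros\<close>)
  show "a w = 0" if a: "lin_form a" "lin_form c" "\<And>x. (a x)\<^sup>2 = c (eval_map F x)"
    and p: "p \<noteq> 0" "eval_map F p = 0" "polar (eval_map F) p v = 0"
      "eval_map F v + 2 *s polar (eval_map F) p w = 0" for a c p v w
  proof (rule reduced_on_jets[OF assms(7) F a, where \<gamma> = "\<lambda>t. p + t *s v + t\<^sup>2 *s w" and
        R = "\<lambda>t. 2 *s polar (eval_map F) v w + t *s eval_map F w" and k = 2])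
    have "a p = 0" using a(3)[of p] p(2) lin_formD(4)[OF a(2)] by simp
    \<comment> \<open>The first-order statement is applied before the second, so that
      \<open>a\<close> has order at least two along the curve.\<close>
    moreover have "a v = 0" by (rule r1[OF a p(1-3)])
    ultimately show "a (p + t *s v + t\<^sup>2 *s w) = t ^ 2 * a w" for t by (simp add: lin_formD[OF a(1)])
    show "eval_map F (p + t *s v + t\<^sup>2 *s w) = t ^ Suc 2 *s (2 *s polar (eval_map F) v w + t *s eval_map F w)" for t
      unfolding quad_map_curve[OF Q] p by (simp add: eval_nat_numeral)
  qed (use p in \<open>auto intro!: continuous_intros\<close>)
  obtain p where p: "p \<in> base_points F" using assms(6) by blast
  then have "p \<in> proj_space" by (simp add: base_points_def zero_locus_def)
  then obtain x where "x \<noteq> 0" "p = point x" by (rule proj_spaceE)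
  then show "\<exists>p. p \<noteq> 0 \<and> eval_map F p = 0" using base_points_point[OF F] p by blast
qed

section \<open>Degree of the inverse and base locus in the two outcomes\<close>

lemma linear_inverse_degree_1:
  fixes F :: "5 \<Rightarrow> 4 cpoly"
  assumes F: "forms 2 F" and q: "homogeneous 2 q" "zero_locus {q} = image_closure F"
    and "linear_inverse (eval_map F)"
  shows "inverse_in_degree F (zero_locus {q}) 1"
proof -
  obtain G l x0 where G: "lin_map G" "lin_form l" "l x0 \<noteq> 0" "\<And>x. G (eval_map F x) = l x *s x"
    using assms(4) unfolding linear_inverse_def by blast
  have "\<exists>g. homogeneous 1 g \<and> (\<forall>y. peval g y = G y $ i)" for i
  proof -
    have "lin_form (\<lambda>y. G y $ i)" using G(1) by (simp add: lin_map_iff_nth)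
    then show ?thesis using lin_form_peval by metis
  qed
  then obtain g where g: "\<And>i. homogeneous 1 (g i)" "\<And>i y. peval (g i) y = G y $ i" by metis
  have "rational_inverse F (zero_locus {q}) g"
  proof (rule rational_inverseI[OF F _ q(2,1)])
    show "forms 1 g" using g(1) by (simp add: forms_def)
    show "eval_map g (eval_map F x) = l x *s x" for x using G(4)[of x] by (simp add: g(2) vec_eq_iff)
    show "l x0 \<noteq> 0" "x0 \<noteq> 0" using G(3) lin_formD(4)[OF G(2)] by auto
  qed simp_all
  then show ?thesis using g(1) unfolding inverse_in_degree_def forms_def by blast
qed

lemma line_two_points_degree_2:
  fixes F :: "5 \<Rightarrow> 4 cpoly"
  assumes F: "forms 2 F" and q: "homogeneous 2 q" "zero_locus {q} = image_closure F"
    and "equiv_line_two_points (eval_map F)"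
  shows "inverse_in_degree F (zero_locus {q}) 2"
proof -
  obtain S T where S: "lin_iso S" and T: "lin_iso T" and ST: "\<And>x. T (eval_map F (S x)) = line_two_points x"
    using assms(4) unfolding equiv_line_two_points_def by blast
  have "\<exists>g. homogeneous 1 g \<and> (\<forall>y. peval g y = T y $ i)" for i
  proof -
    have "lin_form (\<lambda>y. T y $ i)" using lin_isoD(1)[OF T] by (simp add: lin_map_iff_nth)
    then show ?thesis using lin_form_peval by metis
  qed
  then obtain g where g: "\<And>i. homogeneous 1 (g i)" "\<And>i y. peval (g i) y = T y $ i" by metis
  \<comment> \<open>On \<open>line_two_points x\<close> these four products are x1 x2 x3 times x1,
    x2, x3, x4.\<close>
  define m :: "4 \<Rightarrow> 5 cpoly" where
    "m = (\<lambda>k. if k = 1 then g 1 * g 4 else if k = 2 then g 3 * g 4 else if k = 3 then g 1 * g 3 else g 1 * g 5)"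
  have m: "homogeneous 2 (m k)" for k
    using homogeneous_mult[OF g(1) g(1)] unfolding one_add_one by (simp add: m_def)
  have m': "eval_map m y = vec4 (T y $ 1 * T y $ 4) (T y $ 3 * T y $ 4) (T y $ 1 * T y $ 3) (T y $ 1 * T y $ 5)" for y
    by (simp add: vec_eq_iff_4 m_def g(2))
  define G where "G = (\<lambda>i. \<Sum>k\<in>UNIV. pconst (S (axis k 1) $ i) * m k)"
  have G: "homogeneous 2 (G i)" for i unfolding G_def by (intro homogeneous_sum homogeneous_scale m)
  have Sn: "lin_form (\<lambda>u. S u $ i)" for i using lin_isoD(1)[OF S] by (simp add: lin_map_iff_nth)
  have G': "eval_map G y = S (eval_map m y)" for y
    unfolding vec_eq_iff by (simp add: G_def lin_form_expand[OF Sn, where x = "eval_map m y"])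
  define h where "h = (\<lambda>x. inv S x $ 1 * inv S x $ 2 * inv S x $ 3)"
  have "rational_inverse F (zero_locus {q}) G"
  proof (rule rational_inverseI[OF F _ q(2,1)])
    show "forms 2 G" using G by (simp add: forms_def)
    show "eval_map G (eval_map F x) = h x *s x" for x
    proof -
      have Tx: "T (eval_map F x) = line_two_points (inv S x)"
        using ST[of "inv S x"] by (simp add: lin_isoD[OF S])
      have "eval_map m (eval_map F x) = h x *s inv S x"
        unfolding m' Tx by (simp add: line_two_points_def h_def vec_eq_iff_4 mult_ac)
      then show ?thesis unfolding G' by (simp add: lin_mapD(2)[OF lin_isoD(1)[OF S]] lin_isoD(2)[OF S])
    qed
    show "h (S (vec4 1 1 1 1)) \<noteq> 0" by (simp add: h_def lin_isoD[OF S])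
    show "S (vec4 1 1 1 1) \<noteq> 0" unfolding lin_isoD(4)[OF S] by (simp add: vec_eq_iff_4)
  qed simp_all
  then show ?thesis using G unfolding inverse_in_degree_def forms_def by blast
qed

text \<open>In the coordinates given by \<open>S\<close>, the base locus is the line x1 = x2 = 0
  with the first two coordinate points. Their join x3 = x4 = 0 meets that line only in the zero
  vector.\<close>

lemma line_two_points_base_points:
  fixes F :: "5 \<Rightarrow> 4 cpoly"
  assumes F: "forms 2 F" and "equiv_line_two_points (eval_map F)"
  shows "\<exists>r p1 p2. proj_line r \<and> p1 \<in> proj_space \<and> p2 \<in> proj_space \<and> p1 \<noteq> p2 \<and>
         base_points F = r \<union> {p1, p2} \<and> proj_join p1 p2 \<inter> r = {}"
proof -
  obtain S T where S: "lin_iso S" and T: "lin_iso T" and ST: "\<And>x. T (eval_map F (S x)) = line_two_points x"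
    using assms(2) unfolding equiv_line_two_points_def by blast
  note SS = lin_isoD[OF S] lin_mapD[OF lin_isoD(1)[OF S]]
  have B: "eval_map F (S x) = 0 \<longleftrightarrow> x $ 1 = 0 \<and> x $ 2 = 0 \<or> x $ 3 = 0 \<and> x $ 4 = 0 \<and> x $ 1 * x $ 2 = 0" for x
  proof -
    have "eval_map F (S x) = 0 \<longleftrightarrow> line_two_points x = 0" using lin_isoD(4)[OF T] ST by metis
    then show ?thesis by (auto simp: line_two_points_def vec_eq_iff_5)
  qed
  have base: "point (S x) \<in> base_points F \<longleftrightarrow> eval_map F (S x) = 0" if "x \<noteq> 0" for x
    by (rule base_points_point[OF F]) (use that in \<open>simp add: SS(4)\<close>)
  let ?e1 = "vec4 1 0 0 0" and ?e2 = "vec4 0 1 0 0" and ?e3 = "vec4 0 0 1 0" and ?e4 = "vec4 0 0 0 1"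
  let ?W = "vec.span {S ?e3, S ?e4}" and ?p1 = "point (S ?e1)" and ?p2 = "point (S ?e2)"
  have span2: "y \<in> vec.span {S u, S v} \<longleftrightarrow> (\<exists>a b. y = S (a *s u + b *s v))" for y u v
    unfolding vec.span_breakdown_eq[of y "S u" "{S v}"] in_point by (simp add: SS diff_eq_eq add.commute)
  have inj: "S x = S y \<longleftrightarrow> x = y" for x y by (metis SS(3))
  have W: "S x \<in> ?W \<longleftrightarrow> x $ 1 = 0 \<and> x $ 2 = 0" for x
  proof
    assume "x $ 1 = 0 \<and> x $ 2 = 0"
    then have "x = x $ 3 *s ?e3 + x $ 4 *s ?e4" by (simp add: vec_eq_iff_4)
    then show "S x \<in> ?W" unfolding span2 by metis
  qed (auto simp: span2 inj)
  have J: "S x \<in> vec.span {S ?e1, S ?e2} \<longleftrightarrow> x $ 3 = 0 \<and> x $ 4 = 0" for x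
  proof
    assume "x $ 3 = 0 \<and> x $ 4 = 0"
    then have "x = x $ 1 *s ?e1 + x $ 2 *s ?e2" by (simp add: vec_eq_iff_4)
    then show "S x \<in> vec.span {S ?e1, S ?e2}" unfolding span2 by metis
  qed (auto simp: span2 inj)
  have P: "S x \<in> point (S u) \<longleftrightarrow> (\<exists>k. x = k *s u)" for x u
    unfolding in_point by (metis SS(3,6))
  have ptS: "\<exists>x. x \<noteq> 0 \<and> p = point (S x)" if "p \<in> proj_space" for p :: "(complex^4) set"
    using that by (metis proj_spaceE SS(2,4))
  have pproj: "point (S x) \<in> proj_of V \<longleftrightarrow> S x \<in> V" if "vec.subspace V" "x \<noteq> 0" for x V
  proof -
    have "point (S x) \<in> proj_space" using that by (intro point_in_proj_space) (simp add: SS)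
    then show ?thesis
      using that(1) vec.span_minimal[of "{S x}" V] vec.span_base[of "S x" "{S x}"] by (auto simp: proj_of_def)
  qed
  have pt_eq: "point (S x) = point (S u) \<longleftrightarrow> (\<exists>k. x = k *s u)" if "x \<noteq> 0" for x u
  proof
    assume "point (S x) = point (S u)"
    then show "\<exists>k. x = k *s u" using P vec.span_base[of "S x" "{S x}"] by simp
  next
    assume "\<exists>k. x = k *s u"
    then obtain k where "x = k *s u" by blast
    moreover from this that have "k \<noteq> 0" by auto
    ultimately show "point (S x) = point (S u)" by (simp add: SS point_scale)
  qed
  have join: "vec.span (?p1 \<union> ?p2) = vec.span {S ?e1, S ?e2}"
  proof (rule subset_antisym)
    show "vec.span (?p1 \<union> ?p2) \<subseteq> vec.span {S ?e1, S ?e2}"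
      by (intro vec.span_minimal vec.subspace_span Un_least vec.span_mono) auto
    show "vec.span {S ?e1, S ?e2} \<subseteq> vec.span (?p1 \<union> ?p2)"
      by (intro vec.span_mono) (auto intro: vec.span_base)
  qed
  have nz: "S ?e1 \<noteq> 0" "S ?e2 \<noteq> 0" "S ?e4 \<noteq> 0" unfolding SS(4) by (simp_all add: vec_eq_iff_4)
  show ?thesis
  proof (intro exI conjI)
    have "S ?e3 \<notin> vec.span {S ?e4}" unfolding P by (simp add: vec_eq_iff_4)
    then have "vec.dim ?W = 2" using nz by (simp add: vec.dim_insert)
    then show "proj_line (proj_of ?W)" unfolding proj_line_def using vec.subspace_span by blast
    show "?p1 \<in> proj_space" "?p2 \<in> proj_space" by (intro point_in_proj_space nz)+
    show "?p1 \<noteq> ?p2" by (subst pt_eq) (simp_all add: vec_eq_iff_4)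
    show "base_points F = proj_of ?W \<union> {?p1, ?p2}"
    proof -
      have *: "point (S x) \<in> base_points F \<longleftrightarrow> point (S x) \<in> proj_of ?W \<union> {?p1, ?p2}" if "x \<noteq> 0" for x
      proof -
        have "(\<exists>k. x = k *s ?e1) \<longleftrightarrow> x $ 2 = 0 \<and> x $ 3 = 0 \<and> x $ 4 = 0"
          "(\<exists>k. x = k *s ?e2) \<longleftrightarrow> x $ 1 = 0 \<and> x $ 3 = 0 \<and> x $ 4 = 0"
          by (auto simp: vec_eq_iff_4)
        then show ?thesis
          using base[OF that] B[of x] pproj[OF vec.subspace_span that] W[of x] pt_eq[OF that] by auto
      qed
      have "base_points F \<subseteq> proj_space" "proj_of ?W \<union> {?p1, ?p2} \<subseteq> proj_space"
        using point_in_proj_space nz by (auto simp: base_points_def zero_locus_def proj_of_def)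
      moreover have "p \<in> base_points F \<longleftrightarrow> p \<in> proj_of ?W \<union> {?p1, ?p2}" if p: "p \<in> proj_space" for p
        using ptS[OF p] * by (elim exE conjE) (simp only:)
      ultimately show ?thesis by (intro set_eqI) (meson subset_iff)
    qed
    show "proj_join ?p1 ?p2 \<inter> proj_of ?W = {}"
    proof (rule equals0I)
      fix p assume p: "p \<in> proj_join ?p1 ?p2 \<inter> proj_of ?W"
      then have "p \<in> proj_space" by (auto simp: proj_of_def)
      then obtain x where x: "x \<noteq> 0" "p = point (S x)" using ptS by blast
      have "S x \<in> vec.span {S ?e1, S ?e2}" "S x \<in> ?W"
        using p unfolding proj_join_def join x(2) by (simp_all add: pproj x(1) vec.subspace_span)
      then show False using x(1) unfolding W J by (simp add: vec_eq_iff_4)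
    qed
  qed
qed

theorem proposition8p3:
  fixes F :: "5 \<Rightarrow> 4 cpoly" and q :: "5 cpoly" and Q :: "(complex^5) set set"
  assumes "quadratic_map F"
    and "homogeneous 2 q" and "irreducible q" and "Q = zero_locus {q}"
    and "birational_onto F Q"
    and "base_points F \<noteq> {}" and "reduced_base_scheme F"
  shows "of_type_2 F Q 1 \<or>
    (of_type_2 F Q 2 \<and> quad_rank q = 4 \<and>
      (\<exists>r p1 p2. proj_line r \<and> p1 \<in> proj_space \<and> p2 \<in> proj_space \<and> p1 \<noteq> p2 \<and>
         base_points F = r \<union> {p1, p2} \<and> proj_join p1 p2 \<inter> r = {}))"
proof -
  have F: "forms 2 F" using assms(1) by (simp add: quadratic_map_def)
  have Q: "zero_locus {q} = image_closure F" using assms(4,5) by (simp add: birational_onto_def)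
  obtain d where d: "inverse_in_degree F Q d" using assms(5) by (auto simp: birational_onto_def)
  have adm: "admissible (eval_map F)"
    by (rule admissible_birational[OF F assms(2,3) Q d assms(6,7)])
  define b where "b = bilin (quad_matrix q)"
  have qb: "peval q y = b y y" for y unfolding b_def by (rule peval_homogeneous_2[OF assms(2)])
  have "linear_inverse (eval_map F) \<or> equiv_line_two_points (eval_map F) \<and>
    (\<exists>v. v \<noteq> 0 \<and> (\<forall>y. (\<forall>z. b y z = 0) \<longleftrightarrow> (\<exists>k. y = k *s v)))"
  proof (rule admissible_classification[OF adm])
    show "sym_bilin b" unfolding b_def by (rule sym_bilin_quad_matrix)
    show "b (eval_map F x) (eval_map F x) = 0" for x
      using quadric_contains_image[OF F _ Q assms(2), of x] by (simp add: qb)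
    show False if "lin_form l" "lin_form m" "\<And>y. b y y = l y * m y" for l m
      using irreducible_not_product[OF assms(2,3) that(1,2)] by (simp add: qb that(3))
  qed
  then show ?thesis
  proof (elim disjE conjE exE)
    assume "linear_inverse (eval_map F)"
    then have "inverse_in_degree F Q 1"
      using linear_inverse_degree_1[OF F assms(2) Q] assms(4) by simp
    then show ?thesis using no_inverse_in_degree_0[OF F] assms(1,5) by (auto simp: of_type_2_def)
  next
    fix v assume e: "equiv_line_two_points (eval_map F)" and v: "v \<noteq> 0" "\<forall>y. (\<forall>z. b y z = 0) \<longleftrightarrow> (\<exists>k. y = k *s v)"
    have "inverse_in_degree F Q 2"
      using line_two_points_degree_2[OF F assms(2) Q e] assms(4) by simp
    moreover have "quad_rank q = 4" unfolding quad_rank_def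
      by (rule rank_eq_4[OF v(1)]) (use v(2) in \<open>simp add: b_def bilin_eq_0_iff_kernel\<close>)
    \<comment> \<open>Minimality by cases: an inverse of degree 1 gives the first alternative, and
      otherwise 2 is the least degree.\<close>
    moreover have "e = 0 \<or> e = 1" if "e < 2" for e :: nat using that by linarith
    ultimately show ?thesis
      using no_inverse_in_degree_0[OF F, of Q] assms(1,5) line_two_points_base_points[OF F e]
      unfolding of_type_2_def by (metis less_one)
  qed
qed

end
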